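(* There is an integer $D\ge 0$ such that for every $d\ge D$ there exists an infinite family of pairwise combinatorially distinct inscribed $d$-dimensional polytopes $P_n$, $n\ge1$, where $P_n$ has $12(n+1)+d+D-9$ vertices, and all of which are projectively unique.
   Context: A polytope is inscribed if all its vertices lie on a common sphere. A $d$-polytope $P$ is projectively unique if the projective group $\mathrm{PGL}(\mathbb{R}^{d+1})$ acts transitively on its realization space, i.e. for every polytope $P'$ and every combinatorial (face-lattice) isomorphism from $P$ to $P'$ there is a projective transformation mapping $P$ onto $P'$ and inducing that isomorphism on vertices. *)

theory Defs
  imports "HOL-Analysis.Analysis" "HOL-Analysis.Finite_Function_Topology"
begin

text \<open>
  The dimension \<open>d\<close> is quantified inside the statement, so it cannot be a type. The spaces
  \<open>\<real>\<^sup>0 \<subseteq> \<real>\<^sup>1 \<subseteq> \<real>\<^sup>2 \<subseteq> \<dots>\<close> are taken as the coordinate subspaces of the real vector space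
  \<open>nat \<Rightarrow>\<^sub>0 real\<close> of finitely supported sequences. Convex hulls, polytopes, faces and extreme
  points are then the library notions, all of which are defined over any real vector space.
\<close>

type_synonym rseq = "nat \<Rightarrow>\<^sub>0 real"

definition Rn :: "nat \<Rightarrow> rseq set"
  where "Rn d = {x. Poly_Mapping.keys x \<subseteq> {..<d}}"

text \<open>
  The library's \<open>aff_dim\<close> is confined to Euclidean spaces; this is its defining condition.
\<close>

definition has_aff_dim :: "'a::real_vector set \<Rightarrow> nat \<Rightarrow> bool"
  where "has_aff_dim S d \<longleftrightarrow>
    (\<exists>B. affine hull B = affine hull S \<and> \<not> affine_dependent B \<and> card B = d + 1)"

definition d_polytope :: "nat \<Rightarrow> rseq set \<Rightarrow> bool"
  where "d_polytope d P \<longleftrightarrow> polytope P \<and> P \<subseteq> Rn d \<and> has_aff_dim P d"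

definition vertices :: "'a::real_vector set \<Rightarrow> 'a set"
  where "vertices P = {v. v extreme_point_of P}"

text \<open>
  The distance is spelled out with \<open>L2_set\<close> because the library's norm on \<open>nat \<Rightarrow>\<^sub>0 real\<close> is
  the 1-norm, not the Euclidean one.
\<close>

definition inscribed :: "nat \<Rightarrow> rseq set \<Rightarrow> bool"
  where "inscribed d P \<longleftrightarrow>
    (\<exists>c\<in>Rn d. \<exists>r>0. \<forall>v\<in>vertices P.
       L2_set (\<lambda>i. Poly_Mapping.lookup v i - Poly_Mapping.lookup c i) {..<d} = r)"

text \<open>
  Both \<open>{}\<close> and \<open>P\<close> itself satisfy \<open>F face_of P\<close>, so the faces form the full face lattice.
\<close>

definition face_lattice_iso ::
    "('a::real_vector set \<Rightarrow> 'b::real_vector set) \<Rightarrow> 'a set \<Rightarrow> 'b set \<Rightarrow> bool"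
  where "face_lattice_iso f P Q \<longleftrightarrow>
    bij_betw f {F. F face_of P} {F. F face_of Q} \<and>
    (\<forall>F G. F face_of P \<longrightarrow> G face_of P \<longrightarrow> (F \<subseteq> G \<longleftrightarrow> f F \<subseteq> f G))"

definition combinatorially_equivalent :: "'a::real_vector set \<Rightarrow> 'b::real_vector set \<Rightarrow> bool"
  where "combinatorially_equivalent P Q \<longleftrightarrow> (\<exists>f. face_lattice_iso f P Q)"

text \<open>
  Coordinate \<open>d\<close> of \<open>\<real>\<^sup>d\<^sup>+\<^sup>1\<close> is the homogenizing one: \<open>x \<in> \<real>\<^sup>d\<close> corresponds to the point
  of projective space spanned by \<open>homogenize d x\<close>. A linear automorphism \<open>L\<close> of \<open>\<real>\<^sup>d\<^sup>+\<^sup>1\<close>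
  induces the projective transformation \<open>projective_map d L\<close>, which is defined at \<open>x\<close> iff
  coordinate \<open>d\<close> of \<open>L (homogenize d x)\<close> is nonzero.
\<close>

definition homogenize :: "nat \<Rightarrow> rseq \<Rightarrow> rseq"
  where "homogenize d x = x + Poly_Mapping.single d 1"

definition linear_automorphism :: "nat \<Rightarrow> (rseq \<Rightarrow> rseq) \<Rightarrow> bool"
  where "linear_automorphism m L \<longleftrightarrow> linear L \<and> bij_betw L (Rn m) (Rn m)"

definition projective_map :: "nat \<Rightarrow> (rseq \<Rightarrow> rseq) \<Rightarrow> rseq \<Rightarrow> rseq"
  where "projective_map d L x =
    (1 / Poly_Mapping.lookup (L (homogenize d x)) d) *\<^sub>R L (homogenize d x)
      - Poly_Mapping.single d 1"

definition projective_map_defined_on :: "nat \<Rightarrow> (rseq \<Rightarrow> rseq) \<Rightarrow> rseq set \<Rightarrow> bool"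
  where "projective_map_defined_on d L S \<longleftrightarrow>
    (\<forall>x\<in>S. Poly_Mapping.lookup (L (homogenize d x)) d \<noteq> 0)"

definition projectively_unique :: "nat \<Rightarrow> rseq set \<Rightarrow> bool"
  where "projectively_unique d P \<longleftrightarrow>
    d_polytope d P \<and>
    (\<forall>P' f. polytope P' \<and> P' \<subseteq> Rn d \<and> face_lattice_iso f P P' \<longrightarrow>
      (\<exists>L. linear_automorphism (d + 1) L \<and> projective_map_defined_on d L P \<and>
           projective_map d L ` P = P' \<and>
           (\<forall>v\<in>vertices P. f {v} = {projective_map d L v})))"

end

theory Submission
  imports Defs
begin

text \<open>
  Consider four interleaved arithmetic progressions: the point \<open>s = 0,\<dots>,N - 1\<close> is placed at height \<open>s\<close>
  over the vertex \<open>s mod 4\<close> of a simplex. Lifted to a paraboloid (or, by stereographic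
  projection, to a sphere) these points have, for every integer \<open>t\<close>, a supporting hyperplane
  \<open>\<phi>\<^sub>t\<close> touching exactly the points with \<open>\<bar>s - t\<bar> \<le> 2\<close>. If \<open>d\<^sub>a(t)\<close> is the distance from \<open>t\<close> to the
  \<open>a\<close>-th progression, then \<open>y = d\<^sub>0\<^sup>2 - d\<^sub>2\<^sup>2\<close> and \<open>z = d\<^sub>1\<^sup>2 - d\<^sub>3\<^sup>2\<close> are piecewise linear triangle waves
  with alternating bends, and \<open>(y, z)\<close> runs around a square, with a corner at every integer time.
  The four sides and two diagonals of the square are linear functions of \<open>\<phi>\<^sub>t\<close>, that is, exterior
  vectors, and each is encoded by a pair of vertices (Lawrence extension), so that the face lattice
  records its sign on every supporting functional.

  In any realization the faces force opposite sides of the path to be parallel and the diagonals to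
  be parallel to the bends, hence the path is again a square. Since a wave is linear while the
  other one bends, and passes its zero exactly at that bend, consecutive times are equally spaced,
  and all points are determined up to a projective transformation. The number of points
  is arbitrary while the dimension is fixed; cone points raise the dimension.
\<close>

section \<open>Finite-dimensional linear algebra and polytopes\<close>

text \<open>A face lattice yields only this: for each affine functional that is nonnegative on the
  vertices, some functional on a realization vanishes at the corresponding vertices and is positive
  at the others. Such a functional is not unique, and the scale of each homogenized vertex carries
  no information. The coordinates are therefore chosen as 13 + \<open>K\<close> supporting
  functionals: four for the fibres of the progressions, one growing along them,
  \<open>time_val 2\<close>, six for the pairs, \<open>K + 1\<close> for the apexes. This is one
  more than the dimension 12 + \<open>K\<close>. Rigidity means that after rescaling functionals and
  vertices by positive factors the values form a fixed table \<open>canon\<close>. Positivity of the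
  factors makes the linear map between two realizations a projective transformation defined on the
  whole polytope.

  An exterior vector is not a vertex, and a supporting functional may be negative on it. The
  Lawrence coordinate of a pair vanishes on all other vertices, so it can be shifted until the
  functional is zero on one vertex of the pair and nonnegative on the other; which of the two is
  touched reveals the sign.\<close>

lemma lookup_scaleR [simp]:
  fixes x :: rseq
  shows "Poly_Mapping.lookup (r *\<^sub>R x) i = r * Poly_Mapping.lookup x i"
proof -
  have "finite {i. r *\<^sub>R Poly_Mapping.lookup x i \<noteq> 0}"
    by (rule finite_subset[OF _ finite_keys[of x]]) (auto simp: in_keys_iff)
  then show ?thesis
    by (simp add: scaleR_poly_mapping_def Abs_poly_mapping_inverse)
qed

lemma in_Rn_iff: "x \<in> Rn m \<longleftrightarrow> (\<forall>i\<ge>m. Poly_Mapping.lookup x i = 0)"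
  unfolding Rn_def subset_eq in_keys_iff mem_Collect_eq lessThan_iff Ball_def by (meson not_le)

lemma subspace_Rn: "subspace (Rn m)"
  unfolding subspace_def by (auto simp: in_Rn_iff lookup_add)

lemma Rn_mono: "m \<le> n \<Longrightarrow> Rn m \<subseteq> Rn n"
  by (auto simp: in_Rn_iff)

lemma single_in_Rn: "i < m \<Longrightarrow> Poly_Mapping.single i c \<in> Rn m"
  by (auto simp: in_Rn_iff lookup_single_not_eq)

lemma Rn_expand:
  assumes "x \<in> Rn m"
  shows "x = (\<Sum>i<m. Poly_Mapping.lookup x i *\<^sub>R Poly_Mapping.single i 1)"
proof (rule poly_mapping_eqI)
  fix k
  have "Poly_Mapping.lookup (\<Sum>i<m. Poly_Mapping.lookup x i *\<^sub>R Poly_Mapping.single i (1::real)) k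
      = (\<Sum>i<m. if i = k then Poly_Mapping.lookup x k else 0)"
    unfolding lookup_sum by (rule sum.cong) (auto simp: lookup_single)
  also have "\<dots> = Poly_Mapping.lookup x k"
    using assms by (auto simp: in_Rn_iff not_less)
  finally show "Poly_Mapping.lookup x k
    = Poly_Mapping.lookup (\<Sum>i<m. Poly_Mapping.lookup x i *\<^sub>R Poly_Mapping.single i 1) k" by simp
qed

lemma Rn_eq_span: "Rn m = span ((\<lambda>i. Poly_Mapping.single i 1) ` {..<m})"
proof
  show "Rn m \<subseteq> span ((\<lambda>i. Poly_Mapping.single i 1) ` {..<m})"
  proof
    fix x assume "x \<in> Rn m"
    then show "x \<in> span ((\<lambda>i. Poly_Mapping.single i 1) ` {..<m})"
      by (subst Rn_expand[of x m], assumption) (rule span_sum, rule span_scale, rule span_base, simp)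
  qed
  show "span ((\<lambda>i. Poly_Mapping.single i 1) ` {..<m}) \<subseteq> Rn m"
    by (rule span_minimal) (auto intro: single_in_Rn subspace_Rn)
qed

lemma independent_Rn_card:
  assumes "independent B" "B \<subseteq> Rn m"
  shows "finite B \<and> card B \<le> m"
proof -
  have "finite B \<and> card B \<le> card ((\<lambda>i. Poly_Mapping.single i (1::real)) ` {..<m})"
    using assms by (intro independent_span_bound) (auto simp: Rn_eq_span)
  then show ?thesis
    using card_image_le[of "{..<m}" "\<lambda>i. Poly_Mapping.single i (1::real)"] by auto
qed

section \<open>Dual bases\<close>

text \<open>The functionals live on all finitely supported sequences, so the expansion is demanded
  only on \<open>Rn m\<close>; their behaviour outside is left open.\<close>

definition dual_basis :: "nat \<Rightarrow> (nat \<Rightarrow> rseq \<Rightarrow> real) \<Rightarrow> (nat \<Rightarrow> rseq) \<Rightarrow> bool" where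
  "dual_basis m F v \<longleftrightarrow> (\<forall>i<m. linear (F i)) \<and> (\<forall>i<m. v i \<in> Rn m) \<and>
    (\<forall>i<m. \<forall>j<m. F j (v i) = (if j = i then 1 else 0)) \<and>
    (\<forall>x\<in>Rn m. x = (\<Sum>i<m. F i x *\<^sub>R v i))"

text \<open>Gaussian elimination: \<open>v i\<close> arises from \<open>u i\<close> by removing its
  components along the earlier \<open>v k\<close>, and triangularity takes care of the later
  functionals. A nonzero vector killed by every \<open>F j\<close> would give m + 1 independent
  vectors in \<open>Rn m\<close>, hence the expansion. The clause on spans later shows that the
  vertices span.\<close>

lemma dual_basis_triangular:
  assumes lin: "\<And>i. i < m \<Longrightarrow> linear (F i)" and u: "\<And>i. i < m \<Longrightarrow> u i \<in> Rn m"
    and nz: "\<And>i. i < m \<Longrightarrow> F i (u i) \<noteq> 0"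
    and tri: "\<And>i j. i < j \<Longrightarrow> j < m \<Longrightarrow> F j (u i) = 0"
  shows "\<exists>v. dual_basis m F v \<and> (\<forall>i<m. v i \<in> span (u ` {..<m}))"
proof -
  have "\<exists>v\<in>span (u ` {..<m}). \<forall>j<m. F j v = (if j = i then 1 else 0)" if "i < m" for i
    using that
  proof (induction i rule: less_induct)
    case (less i)
    then have "\<forall>k. \<exists>v. k < i \<longrightarrow> v \<in> span (u ` {..<m}) \<and> (\<forall>j<m. F j v = (if j = k then 1 else 0))"
      by (meson less_trans)
    then obtain v where v: "\<And>k. k < i \<Longrightarrow> v k \<in> span (u ` {..<m})"
        "\<And>k j. k < i \<Longrightarrow> j < m \<Longrightarrow> F j (v k) = (if j = k then 1 else 0)"
      by metis
    define w where "w = (1 / F i (u i)) *\<^sub>R (u i - (\<Sum>k<i. F k (u i) *\<^sub>R v k))"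
    have "u i \<in> span (u ` {..<m})" using less.prems by (intro span_base) simp
    then have "w \<in> span (u ` {..<m})"
      unfolding w_def using v(1) by (intro span_scale span_diff span_sum) auto
    moreover have "F j w = (if j = i then 1 else 0)" if j: "j < m" for j
    proof -
      have "F j (\<Sum>k<i. F k (u i) *\<^sub>R v k) = (\<Sum>k<i. F k (u i) * F j (v k))"
        by (simp add: linear_sum[OF lin[OF j]] linear_scale[OF lin[OF j]])
      also have "\<dots> = (\<Sum>k<i. if k = j then F j (u i) else 0)"
        by (rule sum.cong) (auto simp: v(2) j)
      also have "\<dots> = (if j < i then F j (u i) else 0)" by simp
      finally have "F j w = (F j (u i) - (if j < i then F j (u i) else 0)) / F i (u i)"
        unfolding w_def by (simp add: linear_scale[OF lin[OF j]] linear_diff[OF lin[OF j]])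
      then show ?thesis using nz[OF less.prems] tri[of i j] j by (cases j i rule: linorder_cases) auto
    qed
    ultimately show ?case by blast
  qed
  then obtain v where v_span: "\<And>i. i < m \<Longrightarrow> v i \<in> span (u ` {..<m})" and v2:
      "\<And>i j. i < m \<Longrightarrow> j < m \<Longrightarrow> F j (v i) = (if j = i then 1 else 0)"
    by metis
  have "span (u ` {..<m}) \<subseteq> Rn m" by (rule span_minimal) (use u in \<open>auto intro: subspace_Rn\<close>)
  then have v1: "\<And>i. i < m \<Longrightarrow> v i \<in> Rn m" using v_span by blast
  note v = v1 v2
  have inj: "inj_on v {..<m}"
  proof (rule inj_onI)
    fix i j assume "i \<in> {..<m}" "j \<in> {..<m}" "v i = v j"
    then show "i = j" using v(2)[of i i] v(2)[of j i] by (auto split: if_splits)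
  qed
  have F_comb: "F j (\<Sum>i<m. c i *\<^sub>R v i) = c j" if j: "j < m" for c j
  proof -
    have "F j (\<Sum>i<m. c i *\<^sub>R v i) = (\<Sum>i<m. if i = j then c j else 0)"
      unfolding linear_sum[OF lin[OF j]] linear_scale[OF lin[OF j]]
      by (rule sum.cong) (auto simp: v(2) j)
    then show ?thesis using j by simp
  qed
  have ind: "independent (v ` {..<m})"
  proof (rule independent_if_scalars_zero)
    fix f x assume "(\<Sum>x\<in>v ` {..<m}. f x *\<^sub>R x) = 0" and "x \<in> v ` {..<m}"
    then obtain j where j: "j < m" "x = v j" and "(\<Sum>i<m. f (v i) *\<^sub>R v i) = 0"
      by (auto simp: sum.reindex[OF inj])
    then show "f x = 0" using F_comb[of j "\<lambda>i. f (v i)"] linear_0[OF lin[of j]] by simp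
  qed simp
  have "x = (\<Sum>i<m. F i x *\<^sub>R v i)" if x: "x \<in> Rn m" for x
  proof -
    define y where "y = x - (\<Sum>i<m. F i x *\<^sub>R v i)"
    have y: "y \<in> Rn m"
      unfolding y_def using x v(1)
      by (intro subspace_diff subspace_sum subspace_scale subspace_Rn) auto
    have Fy: "F j y = 0" if "j < m" for j
      using that F_comb[of j "\<lambda>i. F i x"] by (simp add: y_def linear_diff[OF lin])
    have "y = 0"
    proof (rule ccontr)
      assume "y \<noteq> 0"
      have "y \<notin> span (v ` {..<m})"
      proof
        assume "y \<in> span (v ` {..<m})"
        then obtain f where "y = (\<Sum>x\<in>v ` {..<m}. f x *\<^sub>R x)"
          by (auto simp: span_finite)
        then have eq: "y = (\<Sum>i<m. f (v i) *\<^sub>R v i)" by (simp add: sum.reindex[OF inj])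
        have "f (v j) = 0" if "j < m" for j
          using Fy[OF that] F_comb[OF that, of "\<lambda>i. f (v i)"] eq by simp
        with eq have "y = 0" by simp
        with \<open>y \<noteq> 0\<close> show False by simp
      qed
      then have "independent (insert y (v ` {..<m}))" using ind by (rule independent_insertI)
      moreover have "insert y (v ` {..<m}) \<subseteq> Rn m" using y v(1) by auto
      ultimately have "card (insert y (v ` {..<m})) \<le> m" by (rule independent_Rn_card[THEN conjunct2])
      moreover have "y \<notin> v ` {..<m}"
        using \<open>y \<notin> span (v ` {..<m})\<close> span_base[of y "v ` {..<m}"] by blast
      ultimately show False by (simp add: card_image[OF inj])
    qed
    then show ?thesis by (simp add: y_def)
  qed
  then have "dual_basis m F v" unfolding dual_basis_def using lin v by auto
  then show ?thesis using v_span by blast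
qed

section \<open>Existence of functionals with prescribed signs\<close>

lemma ex_linear_vanishing:
  fixes b :: "'a::real_vector"
  assumes "subspace S" "b \<notin> S"
  shows "\<exists>h::'a \<Rightarrow> real. linear h \<and> (\<forall>x\<in>S. h x = 0) \<and> h b = 1"
proof -
  obtain B where B: "B \<subseteq> S" "independent B" "S \<subseteq> span B"
    using maximal_independent_subset[of S] by blast
  have "span B \<subseteq> S" using B(1) assms(1) by (rule span_minimal)
  then have "b \<notin> span B" using assms(2) by blast
  then have "independent (insert b B)" using B(2) by (rule independent_insertI)
  then obtain h :: "'a \<Rightarrow> real" where h: "linear h" "\<forall>x\<in>insert b B. h x = (if x = b then 1 else 0)"
    using linear_independent_extend[of "insert b B" "\<lambda>x. if x = b then 1 else 0"] by blast
  have "b \<notin> B" using \<open>b \<notin> span B\<close> span_base[of b B] by blast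
  then have "h x = 0" if "x \<in> B" for x using h(2) that by auto
  then have "h x = 0" if "x \<in> span B" for x
    using linear_eq_0_on_span[OF h(1), of B x] that by blast
  then show ?thesis using h B(3) by (intro exI[of _ h]) auto
qed

text \<open>
  If the functional obtained for \<open>B\<close> is not positive at the new vector \<open>b\<close>, then no conic
  combination of \<open>B\<close> lies in \<open>S + \<real>b\<close>, so the induction hypothesis applies to that larger
  subspace; a small multiple of a functional with value \<open>1\<close> at \<open>b\<close> repairs the zero at \<open>b\<close>.
\<close>

lemma ex_linear_positive:
  fixes B :: "'a::real_vector set"
  assumes "finite B" "subspace S"
    and "\<And>u. (\<And>b. b \<in> B \<Longrightarrow> u b \<ge> 0) \<Longrightarrow> (\<Sum>b\<in>B. u b *\<^sub>R b) \<in> S \<Longrightarrow> \<forall>b\<in>B. u b = 0"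
  shows "\<exists>g::'a \<Rightarrow> real. linear g \<and> (\<forall>x\<in>S. g x = 0) \<and> (\<forall>b\<in>B. g b > 0)"
  using assms
proof (induction B arbitrary: S rule: finite_induct)
  case empty
  show ?case by (rule exI[of _ "\<lambda>_. 0"]) (simp add: linear_iff)
next
  case (insert b B)
  note pos = insert.prems(2)
  have comb: "u b = 0 \<and> (\<forall>x\<in>B. u x = 0)"
    if "u b \<ge> 0" "\<And>x. x \<in> B \<Longrightarrow> u x \<ge> 0" "u b *\<^sub>R b + (\<Sum>x\<in>B. u x *\<^sub>R x) \<in> S" for u
  proof -
    have "(\<Sum>x\<in>insert b B. u x *\<^sub>R x) \<in> S" using that(3) insert.hyps by simp
    moreover have "u x \<ge> 0" if "x \<in> insert b B" for x
      using that \<open>u b \<ge> 0\<close> \<open>\<And>x. x \<in> B \<Longrightarrow> u x \<ge> 0\<close> by blast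
    ultimately have "\<forall>x\<in>insert b B. u x = 0" by (rule pos[rotated])
    then show ?thesis by simp
  qed
  have "\<forall>x\<in>B. u x = 0" if "\<And>x. x \<in> B \<Longrightarrow> u x \<ge> 0" "(\<Sum>x\<in>B. u x *\<^sub>R x) \<in> S" for u
  proof -
    have "(\<Sum>x\<in>B. (u(b := 0)) x *\<^sub>R x) = (\<Sum>x\<in>B. u x *\<^sub>R x)"
      using insert.hyps by (intro sum.cong) auto
    then have "\<forall>x\<in>B. (u(b := 0)) x = 0"
      using comb[of "u(b := 0)"] that insert.hyps by auto
    then show ?thesis using insert.hyps(2) by (metis fun_upd_apply)
  qed
  then obtain g :: "'a \<Rightarrow> real" where g: "linear g" "\<forall>x\<in>S. g x = 0" "\<forall>x\<in>B. g x > 0"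
    using insert.IH[OF insert.prems(1)] by blast
  show ?case
  proof (cases "g b > 0")
    case True
    then show ?thesis using g by auto
  next
    case False
    define S1 where "S1 = {x + c *\<^sub>R b | x c. x \<in> S}"
    have S1: "subspace S1"
      unfolding subspace_def
    proof (intro conjI ballI allI)
      have "0 = 0 + 0 *\<^sub>R b" by simp
      then show "0 \<in> S1" unfolding S1_def using subspace_0[OF insert.prems(1)] by blast
      fix x y assume "x \<in> S1" "y \<in> S1"
      then obtain x1 c1 y1 c2 where "x = x1 + c1 *\<^sub>R b" "y = y1 + c2 *\<^sub>R b" "x1 \<in> S" "y1 \<in> S"
        unfolding S1_def by blast
      moreover from this have "x + y = (x1 + y1) + (c1 + c2) *\<^sub>R b" by (simp add: algebra_simps)
      ultimately show "x + y \<in> S1"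
        unfolding S1_def using subspace_add[OF insert.prems(1)] by blast
    next
      fix c x assume "x \<in> S1"
      then obtain x1 c1 where "x = x1 + c1 *\<^sub>R b" "x1 \<in> S" unfolding S1_def by blast
      moreover from this have "c *\<^sub>R x = c *\<^sub>R x1 + (c * c1) *\<^sub>R b" by (simp add: algebra_simps)
      ultimately show "c *\<^sub>R x \<in> S1"
        unfolding S1_def using subspace_scale[OF insert.prems(1)] by blast
    qed
    have "\<forall>x\<in>B. u x = 0" if u: "\<And>x. x \<in> B \<Longrightarrow> u x \<ge> 0" "(\<Sum>x\<in>B. u x *\<^sub>R x) \<in> S1" for u
    proof -
      obtain s c where sc: "s \<in> S" "(\<Sum>x\<in>B. u x *\<^sub>R x) = s + c *\<^sub>R b"
        using u(2) unfolding S1_def by blast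
      have "g (\<Sum>x\<in>B. u x *\<^sub>R x) = (\<Sum>x\<in>B. u x * g x)"
        by (simp add: linear_sum[OF g(1)] linear_scale[OF g(1)])
      moreover have "g (s + c *\<^sub>R b) = c * g b"
        using g(2) sc(1) by (simp add: linear_add[OF g(1)] linear_scale[OF g(1)])
      ultimately have gsum: "(\<Sum>x\<in>B. u x * g x) = c * g b" using sc(2) by simp
      \<comment> \<open>If c is at most 0, moving c b to the other side gives a nonnegative
        combination of \<open>insert b B\<close> in S. If c is positive, applying \<open>g\<close>
        gives a sum of nonnegative terms equal to \<open>c * g b\<close>, which is at most
        0.\<close>
      show ?thesis
      proof (cases "c \<le> 0")
        case True
        have "(\<Sum>x\<in>B. (u(b := - c)) x *\<^sub>R x) = (\<Sum>x\<in>B. u x *\<^sub>R x)"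
          using insert.hyps by (intro sum.cong) auto
        then have "(u(b := - c)) b *\<^sub>R b + (\<Sum>x\<in>B. (u(b := - c)) x *\<^sub>R x) = s"
          using sc(2) by simp
        then have "\<forall>x\<in>B. (u(b := - c)) x = 0"
          using comb[of "u(b := - c)"] True u(1) sc(1) insert.hyps by auto
        then show ?thesis using insert.hyps(2) by (metis fun_upd_apply)
      next
        case False
        have nn: "u x * g x \<ge> 0" if "x \<in> B" for x using u(1) g(3) that by (simp add: less_imp_le)
        have "c * g b \<le> 0" using False \<open>\<not> g b > 0\<close> by (simp add: mult_nonneg_nonpos)
        then have "(\<Sum>x\<in>B. u x * g x) = 0"
          using gsum sum_nonneg[of B "\<lambda>x. u x * g x", OF nn] by linarith
        then have "\<forall>x\<in>B. u x * g x = 0"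
          using sum_nonneg_eq_0_iff[OF insert.hyps(1), of "\<lambda>x. u x * g x"] nn by blast
        then show ?thesis using g(3) by (metis less_irrefl mult_eq_0_iff)
      qed
    qed
    then obtain g1 :: "'a \<Rightarrow> real" where g1: "linear g1" "\<forall>x\<in>S1. g1 x = 0" "\<forall>x\<in>B. g1 x > 0"
      using insert.IH[OF S1] by blast
    have "b \<notin> S"
    proof
      assume "b \<in> S"
      define u where "u x = (if x = b then 1 else 0 :: real)" for x
      have "(\<Sum>x\<in>B. u x *\<^sub>R x) = 0"
        using insert.hyps(2) by (intro sum.neutral) (auto simp: u_def)
      then have "u b *\<^sub>R b + (\<Sum>x\<in>B. u x *\<^sub>R x) \<in> S" using \<open>b \<in> S\<close> by (simp add: u_def)
      then have "u b = 0 \<and> (\<forall>x\<in>B. u x = 0)" by (intro comb) (simp_all add: u_def)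
      then have "(1::real) = 0" by (simp add: u_def)
      then show False by simp
    qed
    then obtain h :: "'a \<Rightarrow> real" where h: "linear h" "\<forall>x\<in>S. h x = 0" "h b = 1"
      using ex_linear_vanishing[OF insert.prems(1)] by blast
    have "\<forall>x\<in>B. \<exists>e>0. g1 x - e * \<bar>h x\<bar> > 0"
    proof
      fix x assume "x \<in> B"
      then have "g1 x > 0" using g1(3) by blast
      then have "g1 x - g1 x / (\<bar>h x\<bar> + 1) * \<bar>h x\<bar> > 0"
        by (simp add: field_simps)
      moreover have "g1 x / (\<bar>h x\<bar> + 1) > 0" using \<open>g1 x > 0\<close> by (simp add: add_nonneg_pos)
      ultimately show "\<exists>e>0. g1 x - e * \<bar>h x\<bar> > 0" by blast
    qed
    then obtain e where e: "\<And>x. x \<in> B \<Longrightarrow> e x > 0" "\<And>x. x \<in> B \<Longrightarrow> g1 x - e x * \<bar>h x\<bar> > 0"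
      by metis
    \<comment> \<open>The extra element 1 keeps the set nonempty when \<open>B\<close> is
      empty.\<close>
    define e0 where "e0 = Min (insert 1 (e ` B))"
    have e0: "e0 > 0" "\<And>x. x \<in> B \<Longrightarrow> e0 \<le> e x"
      unfolding e0_def using insert.hyps(1) e(1) by auto
    have "g1 x + e0 * h x > 0" if x: "x \<in> B" for x
    proof -
      have "e0 * \<bar>h x\<bar> \<le> e x * \<bar>h x\<bar>" using e0(2)[OF x] by (rule mult_right_mono) simp
      moreover have "- (e0 * \<bar>h x\<bar>) \<le> e0 * h x"
        using e0(1) by (metis abs_ge_minus_self abs_mult abs_of_pos minus_le_iff)
      ultimately show ?thesis using e(2)[OF x] by linarith
    qed
    moreover have "g1 b = 0"
    proof -
      have "b = 0 + 1 *\<^sub>R b" by simp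
      then have "b \<in> S1" unfolding S1_def using subspace_0[OF insert.prems(1)] by blast
      then show ?thesis using g1(2) by blast
    qed
    moreover have "g1 x = 0" if "x \<in> S" for x
    proof -
      have "x = x + 0 *\<^sub>R b" by simp
      then have "x \<in> S1" unfolding S1_def using that by blast
      then show ?thesis using g1(2) by blast
    qed
    moreover have "linear (\<lambda>x. g1 x + e0 * h x)"
      using g1(1) h(1) by (simp add: linear_iff algebra_simps)
    ultimately show ?thesis
      using h e0(1) by (intro exI[of _ "\<lambda>x. g1 x + e0 * h x"]) auto
  qed
qed

section \<open>Faces and extreme points of finitely generated convex sets\<close>

text \<open>Collecting all terms except the j-th into one point z places the sum on the segment from
  \<open>y j\<close> to z, so the two-point definition of a face applies; the degenerate segments
  are treated separately.\<close>

lemma face_of_sum: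
  fixes F :: "'a::real_vector set"
  assumes F: "F face_of P" "convex P" and I: "finite I" "\<And>i. i \<in> I \<Longrightarrow> u i \<ge> 0" "sum u I = 1"
    and y: "\<And>i. i \<in> I \<Longrightarrow> y i \<in> P" and in_F: "(\<Sum>i\<in>I. u i *\<^sub>R y i) \<in> F"
    and j: "j \<in> I" "u j > 0"
  shows "y j \<in> F"
proof -
  define r where "r = sum u (I - {j})"
  have r: "u j + r = 1" using I(1,3) j(1) by (simp add: r_def sum.remove[of I j])
  have eq: "(\<Sum>i\<in>I. u i *\<^sub>R y i) = u j *\<^sub>R y j + (\<Sum>i\<in>I - {j}. u i *\<^sub>R y i)"
    using I(1) j(1) by (simp add: sum.remove[of I j])
  have r_nonneg: "r \<ge> 0" unfolding r_def using I(2) by (intro sum_nonneg) auto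
  show ?thesis
  proof (cases "r = 0")
    case True
    then have "\<forall>i\<in>I - {j}. u i = 0"
      unfolding r_def using I by (subst (asm) sum_nonneg_eq_0_iff) auto
    then have "(\<Sum>i\<in>I - {j}. u i *\<^sub>R y i) = 0" by (intro sum.neutral) auto
    then show ?thesis using in_F eq r True by simp
  next
    case False
    define z where "z = (\<Sum>i\<in>I - {j}. (u i / r) *\<^sub>R y i)"
    have z: "z \<in> P"
      unfolding z_def using I r_nonneg y False
      by (intro convex_sum F(2)) (auto simp: r_def sum_divide_distrib[symmetric])
    have "r *\<^sub>R z = (\<Sum>i\<in>I - {j}. u i *\<^sub>R y i)"
      using False by (simp add: z_def scaleR_sum_right)
    then have comb: "u j *\<^sub>R y j + r *\<^sub>R z \<in> F" using in_F eq by simp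
    show ?thesis
    proof (cases "y j = z")
      case True
      then show ?thesis using comb r by (simp add: scaleR_add_left[symmetric])
    next
      case ne: False
      have "u j *\<^sub>R y j + r *\<^sub>R z = (1 - r) *\<^sub>R y j + r *\<^sub>R z" using r by (metis add_diff_cancel_right')
      moreover have "0 < r" "r < 1" using r r_nonneg False j(2) by auto
      ultimately have "u j *\<^sub>R y j + r *\<^sub>R z \<in> open_segment (y j) z"
        using ne by (auto simp: in_segment)
      then show ?thesis using face_ofD[OF F(1) _ y[OF j(1)] z comb] by blast
    qed
  qed
qed

lemma face_of_hull_finite:
  fixes V :: "'a::real_vector set"
  assumes V: "finite V" and F: "F face_of convex hull V"
  shows "F = convex hull (V \<inter> F)"
proof
  have "convex F" using F face_of_imp_convex by blast
  then show "convex hull (V \<inter> F) \<subseteq> F" by (intro hull_minimal) auto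
  show "F \<subseteq> convex hull (V \<inter> F)"
  proof
    fix x assume x: "x \<in> F"
    then have "x \<in> convex hull V" using F face_of_imp_subset by blast
    then obtain u where u: "\<forall>v\<in>V. 0 \<le> u v" "sum u V = 1" "(\<Sum>v\<in>V. u v *\<^sub>R v) = x"
      by (auto simp: convex_hull_finite[OF V])
    have in_F: "v \<in> F" if "v \<in> V" "u v \<noteq> 0" for v
    proof (rule face_of_sum[OF F convex_convex_hull V, of u "\<lambda>v. v"])
      show "0 < u v" using u(1) that by (simp add: order_less_le)
    qed (use u x that in \<open>auto intro: hull_inc\<close>)
    have "sum u (V \<inter> F) = 1"
      using u(2) by (subst sum.mono_neutral_left[of V "V \<inter> F" u]) (use V in_F in auto)
    moreover have "(\<Sum>v\<in>V \<inter> F. u v *\<^sub>R v) = x"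
      using u(3) by (subst sum.mono_neutral_left[of V "V \<inter> F"]) (use V in_F in auto)
    ultimately show "x \<in> convex hull (V \<inter> F)"
      using u(1) V by (auto simp: convex_hull_finite intro!: exI[of _ u])
  qed
qed

text \<open>Krein-Milman for finitely many points of an arbitrary real vector space: a generating
  subset of least cardinality has no redundant point, so each of its points is extreme.\<close>

lemma hull_extreme_points:
  fixes V :: "'a::real_vector set"
  assumes V: "finite V"
  shows "convex hull {v. v extreme_point_of convex hull V} = convex hull V"
proof -
  have "\<exists>W. W \<subseteq> V \<and> convex hull W = convex hull V" by blast
  then obtain W where W: "W \<subseteq> V" "convex hull W = convex hull V"
    and min: "\<And>W'. W' \<subseteq> V \<and> convex hull W' = convex hull V \<Longrightarrow> card W \<le> card W'"
    using arg_min_nat_lemma[of "\<lambda>W. W \<subseteq> V \<and> convex hull W = convex hull V" V card]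
    by (metis (no_types, lifting) order_refl)
  have fin: "finite W" using W(1) V finite_subset by blast
  have "W \<subseteq> {v. v extreme_point_of convex hull V}"
  proof
    fix v assume v: "v \<in> W"
    have ins: "insert v (W - {v}) = W" using v by blast
    have "v \<notin> convex hull (W - {v})"
    proof
      assume "v \<in> convex hull (W - {v})"
      then have "convex hull (W - {v}) = convex hull V"
        using hull_redundant[of v convex "W - {v}"] ins W(2) by simp
      then have "card W \<le> card (W - {v})" using W(1) by (intro min) auto
      then show False using fin v by (meson card_Diff1_less not_le)
    qed
    then show "v \<in> {v. v extreme_point_of convex hull V}"
      using extreme_point_of_convex_hull_insert[of "W - {v}" v] fin ins W(2) by simp
  qed
  then have "convex hull V \<subseteq> convex hull {v. v extreme_point_of convex hull V}"
    using W(2) hull_mono by metis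
  moreover have "convex hull {v. v extreme_point_of convex hull V} \<subseteq> convex hull V"
    by (intro hull_minimal) (auto simp: extreme_point_of_def)
  ultimately show ?thesis by blast
qed

lemma face_contains_extreme_point:
  fixes V :: "'a::real_vector set"
  assumes V: "finite V" and F: "F face_of convex hull V" "F \<noteq> {}"
  shows "\<exists>e\<in>F. e extreme_point_of convex hull V"
proof -
  define E where "E = {v. v extreme_point_of convex hull V}"
  have "E \<subseteq> V" unfolding E_def using extreme_point_of_convex_hull by blast
  then have "finite E" using V finite_subset by blast
  moreover have "F face_of convex hull E" using F(1) hull_extreme_points[OF V] by (simp add: E_def)
  ultimately have "F = convex hull (E \<inter> F)" by (rule face_of_hull_finite)
  then have "E \<inter> F \<noteq> {}" using F(2) by force
  then show ?thesis unfolding E_def by blast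
qed

lemma supporting_face:
  fixes V :: "'a::real_vector set" and g :: "'a \<Rightarrow> real"
  assumes "linear g" "\<And>v. v \<in> V \<Longrightarrow> g v + c \<ge> 0"
  shows "{x \<in> convex hull V. g x + c = 0} face_of convex hull V"
proof -
  have conv: "g ((1 - u) *\<^sub>R a + u *\<^sub>R b) + c = (1 - u) * (g a + c) + u * (g b + c)" for u a b
    unfolding linear_add[OF assms(1)] linear_scale[OF assms(1)] by (simp add: algebra_simps)
  have "convex {x. g x + c \<ge> 0}"
    unfolding convex_alt using conv by auto
  then have nonneg: "g x + c \<ge> 0" if "x \<in> convex hull V" for x
    using that hull_minimal[of V "{x. g x + c \<ge> 0}" convex] assms(2) by blast
  show ?thesis
    unfolding face_of_def
  proof (intro conjI ballI impI)
    have "convex {x. g x + c = 0}" unfolding convex_alt using conv by auto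
    moreover have "{x \<in> convex hull V. g x + c = 0} = convex hull V \<inter> {x. g x + c = 0}" by blast
    ultimately show "convex {x \<in> convex hull V. g x + c = 0}"
      by (simp add: convex_Int)
    fix a b x assume ab: "a \<in> convex hull V" "b \<in> convex hull V"
      and x: "x \<in> {x \<in> convex hull V. g x + c = 0}" "x \<in> open_segment a b"
    obtain u where u: "0 < u" "u < 1" "x = (1 - u) *\<^sub>R a + u *\<^sub>R b"
      using x(2) by (auto simp: in_segment)
    have "(1 - u) * (g a + c) + u * (g b + c) = 0" using x(1) u(3) conv[of u a b] by simp
    moreover have "(1 - u) * (g a + c) \<ge> 0" "u * (g b + c) \<ge> 0"
      using u nonneg ab by simp_all
    ultimately have "(1 - u) * (g a + c) = 0" "u * (g b + c) = 0" by linarith+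
    then have "g a + c = 0" "g b + c = 0" using u by auto
    then show "a \<in> {x \<in> convex hull V. g x + c = 0}" "b \<in> {x \<in> convex hull V. g x + c = 0}"
      using ab by auto
  qed auto
qed

section \<open>Homogenization and exposed faces\<close>

lemma lookup_homogenize:
  "x \<in> Rn d \<Longrightarrow> Poly_Mapping.lookup (homogenize d x) d = 1"
  by (simp add: homogenize_def lookup_add in_Rn_iff)

lemma homogenize_in_Rn: "x \<in> Rn d \<Longrightarrow> homogenize d x \<in> Rn (d + 1)"
  unfolding homogenize_def
  by (intro subspace_add subspace_Rn single_in_Rn) (use Rn_mono[of d "d + 1"] in auto)

lemma inj_homogenize: "inj (homogenize d)"
  by (auto simp: inj_def homogenize_def)

lemma sum_homogenize:
  "(\<Sum>v\<in>A. w v *\<^sub>R homogenize d v) = (\<Sum>v\<in>A. w v *\<^sub>R v) + sum w A *\<^sub>R Poly_Mapping.single d 1"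
  by (simp add: homogenize_def scaleR_add_right sum.distrib scaleR_sum_left)

text \<open>By the alternative in \<open>ex_linear_positive\<close>, failure would give a nontrivial
  nonnegative combination of homogenized points outside \<open>F\<close> in the span of those
  inside. Moving negative coefficients across and normalizing turns this into a point of
  \<open>F\<close> written as a convex combination that uses a vertex outside
  \<open>F\<close>.\<close>

lemma face_exposed:
  assumes V: "finite V" "V \<subseteq> Rn d" and F: "F face_of convex hull V"
  shows "\<exists>h::rseq \<Rightarrow> real. linear h \<and> (\<forall>v\<in>V. if v \<in> F then h (homogenize d v) = 0 else h (homogenize d v) > 0)"
proof -
  let ?h = "homogenize d"
  define A where "A = V \<inter> F"
  define B where "B = V - F"
  have fin: "finite A" "finite B" using V by (auto simp: A_def B_def)
  have inj: "inj_on ?h S" for S using inj_homogenize by (rule inj_on_subset) simp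
  have conv_F: "convex F" using F face_of_imp_convex by blast
  have "\<forall>b\<in>?h ` B. u b = 0"
    if u: "\<And>b. b \<in> ?h ` B \<Longrightarrow> u b \<ge> 0" "(\<Sum>b\<in>?h ` B. u b *\<^sub>R b) \<in> span (?h ` A)" for u
  proof (rule ccontr)
    assume "\<not> (\<forall>b\<in>?h ` B. u b = 0)"
    then obtain v0 where v0: "v0 \<in> B" "u (?h v0) \<noteq> 0" by blast
    define w where "w v = u (?h v)" for v
    have w: "w v \<ge> 0" if "v \<in> B" for v using that u(1) by (simp add: w_def)
    obtain c0 where "(\<Sum>b\<in>?h ` B. u b *\<^sub>R b) = (\<Sum>a\<in>?h ` A. c0 a *\<^sub>R a)"
      using u(2) fin(1) by (auto simp: span_finite)
    define c where "c v = c0 (?h v)" for v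
    have sums: "(\<Sum>v\<in>B. w v *\<^sub>R ?h v) = (\<Sum>v\<in>A. c v *\<^sub>R ?h v)"
      using \<open>(\<Sum>b\<in>?h ` B. u b *\<^sub>R b) = (\<Sum>a\<in>?h ` A. c0 a *\<^sub>R a)\<close>
      by (simp add: sum.reindex[OF inj] w_def c_def)
    define cp where "cp v = max (c v) 0" for v
    define cm where "cm v = max (- c v) 0" for v
    have c_eq: "c v = cp v - cm v" for v by (simp add: cp_def cm_def)
    have "Poly_Mapping.lookup (?h v) d = 1" if "v \<in> V" for v
      using that V(2) lookup_homogenize by blast
    then have "sum w B = sum c A"
      using arg_cong[OF sums, of "\<lambda>x. Poly_Mapping.lookup x d"]
      by (simp add: lookup_sum A_def B_def)
    then have U: "sum w B + sum cm A = sum cp A" by (simp add: c_eq sum_subtractf)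
    define U where "U = sum cp A"
    have "w v0 > 0" using v0 w[of v0] by (simp add: w_def)
    then have "sum w B > 0" using w v0(1) fin(2) by (intro sum_pos2[of B v0]) auto
    moreover have "sum cm A \<ge> 0" by (intro sum_nonneg) (simp add: cm_def)
    ultimately have U_pos: "U > 0" using U by (simp add: U_def)
    have points: "(\<Sum>v\<in>B. w v *\<^sub>R v) + (\<Sum>v\<in>A. cm v *\<^sub>R v) = (\<Sum>v\<in>A. cp v *\<^sub>R v)"
    proof -
      have "(\<Sum>v\<in>B. w v *\<^sub>R v) = (\<Sum>v\<in>A. c v *\<^sub>R v)"
        using sums \<open>sum w B = sum c A\<close> unfolding sum_homogenize by simp
      then show ?thesis by (simp add: c_eq scaleR_diff_left sum_subtractf)
    qed
    define x where "x = (\<Sum>v\<in>A. (cp v / U) *\<^sub>R v)"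
    have "x \<in> F"
      unfolding x_def using U_pos fin(1)
      by (intro convex_sum conv_F) (auto simp: cp_def A_def U_def sum_divide_distrib[symmetric])
    \<comment> \<open>A second representation of \<open>x\<close>: weights \<open>w\<close> outside
      \<open>F\<close>, and on \<open>F\<close> the negative parts that changed sides. The last
      homogeneous coordinate shows that the total is again \<open>U\<close>.\<close>
    define q where "q v = (if v \<in> F then cm v else w v) / U" for v
    have VAB: "V = A \<union> B" "A \<inter> B = {}" by (auto simp: A_def B_def)
    have q_sum: "(\<Sum>v\<in>V. q v *\<^sub>R v) = x"
    proof -
      have "(\<Sum>v\<in>V. q v *\<^sub>R v) = (\<Sum>v\<in>A. q v *\<^sub>R v) + (\<Sum>v\<in>B. q v *\<^sub>R v)"
        unfolding VAB(1) using fin VAB(2) by (rule sum.union_disjoint)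
      also have "\<dots> = (1 / U) *\<^sub>R ((\<Sum>v\<in>B. w v *\<^sub>R v) + (\<Sum>v\<in>A. cm v *\<^sub>R v))"
        by (simp add: q_def A_def B_def scaleR_add_right scaleR_sum_right divide_inverse mult.commute)
      also have "\<dots> = x"
        unfolding points x_def by (simp add: scaleR_sum_right)
      finally show ?thesis .
    qed
    have "sum q V = sum q A + sum q B"
      unfolding VAB(1) using fin VAB(2) by (rule sum.union_disjoint)
    also have "\<dots> = (sum w B + sum cm A) / U"
      by (simp add: q_def A_def B_def sum_divide_distrib add_divide_distrib)
    finally have q1: "sum q V = 1" using U U_pos by (simp add: U_def)
    have "v0 \<in> F"
    proof (rule face_of_sum[OF F convex_convex_hull V(1), of q "\<lambda>v. v"])
      show "q v \<ge> 0" if "v \<in> V" for v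
        using that w[of v] U_pos by (auto simp: q_def cm_def B_def)
      show "0 < q v0" using v0(1) \<open>w v0 > 0\<close> U_pos by (auto simp: q_def B_def)
    qed (use q1 q_sum \<open>x \<in> F\<close> v0(1) in \<open>auto simp: B_def intro: hull_inc\<close>)
    then show False using v0(1) by (simp add: B_def)
  qed
  then obtain g :: "rseq \<Rightarrow> real" where g: "linear g" "\<forall>x\<in>span (?h ` A). g x = 0" "\<forall>b\<in>?h ` B. g b > 0"
    using ex_linear_positive[of "?h ` B" "span (?h ` A)"] fin(2) by blast
  have "g (?h v) = 0" if "v \<in> V" "v \<in> F" for v
    using g(2) that span_base[of "?h v" "?h ` A"] by (auto simp: A_def)
  moreover have "g (?h v) > 0" if "v \<in> V" "v \<notin> F" for v
    using g(3) that by (auto simp: B_def)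
  ultimately show ?thesis using g(1) by auto
qed

section \<open>Transport along a face lattice isomorphism\<close>

text \<open>Extreme points are the minimal nonempty faces, a notion of the order alone: an extreme
  point inside \<open>f {v}\<close> has as preimage a nonempty face inside
  \<open>{v}\<close>.\<close>

lemma face_iso_vertices:
  fixes V :: "'a::real_vector set" and P' :: "'b::real_vector set"
  assumes V: "finite V" "\<And>v. v \<in> V \<Longrightarrow> v extreme_point_of convex hull V"
    and P': "polytope P'" and iso: "face_lattice_iso f (convex hull V) P'"
  shows "\<exists>\<phi>. (\<forall>v\<in>V. f {v} = {\<phi> v}) \<and> inj_on \<phi> V \<and> \<phi> ` V = {e. e extreme_point_of P'} \<and>
    (\<forall>F. F face_of convex hull V \<longrightarrow> f F face_of P' \<and> (\<forall>v\<in>V. v \<in> F \<longleftrightarrow> \<phi> v \<in> f F))"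
proof -
  let ?P = "convex hull V"
  obtain V' where V': "finite V'" "P' = convex hull V'" using P' by (auto simp: polytope_def)
  have bij: "bij_betw f {F. F face_of ?P} {F. F face_of P'}"
    and mono: "\<And>F G. F face_of ?P \<Longrightarrow> G face_of ?P \<Longrightarrow> F \<subseteq> G \<longleftrightarrow> f F \<subseteq> f G"
    using iso by (auto simp: face_lattice_iso_def)
  have face: "f F face_of P'" if "F face_of ?P" for F using bij that by (auto simp: bij_betw_def)
  have surj: "\<exists>F. F face_of ?P \<and> f F = G" if "G face_of P'" for G
    using bij_betw_imp_surj_on[OF bij] that by (metis (mono_tags) imageE mem_Collect_eq)
  have inj: "F = G" if "F face_of ?P" "G face_of ?P" "f F = f G" for F G
    using mono[OF that(1,2)] mono[OF that(2,1)] that(3) by blast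
  have empty: "f {} = {}"
    using surj[of "{}"] mono[of "{}"] by (metis bot.extremum_uniqueI empty_face_of empty_subsetI)
  have vface: "{v} face_of ?P" if "v \<in> V" for v using V(2)[OF that] by (simp add: face_of_singleton)
  have single: "\<exists>e. e extreme_point_of P' \<and> f {v} = {e}" if v: "v \<in> V" for v
  proof -
    have "f {v} \<noteq> {}" using inj[OF vface[OF v], of "{}"] empty by auto
    then obtain e where e: "e \<in> f {v}" "e extreme_point_of P'"
      using face_contains_extreme_point[OF V'(1), of "f {v}"] face[OF vface[OF v]] V'(2) by blast
    then have "{e} face_of P'" by (simp add: face_of_singleton)
    then obtain G where G: "G face_of ?P" "f G = {e}" using surj by blast
    then have "G \<subseteq> {v}" using mono[OF G(1) vface[OF v]] e(1) by simp
    moreover have "G \<noteq> {}" using G(2) empty by auto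
    ultimately have "G = {v}" by blast
    then show ?thesis using G(2) e(2) by blast
  qed
  then obtain \<phi> where \<phi>: "\<And>v. v \<in> V \<Longrightarrow> \<phi> v extreme_point_of P'" "\<And>v. v \<in> V \<Longrightarrow> f {v} = {\<phi> v}"
    by metis
  have "\<exists>v\<in>V. e = \<phi> v" if e: "e extreme_point_of P'" for e
  proof -
    have "{e} face_of P'" using e by (simp add: face_of_singleton)
    then obtain G where G: "G face_of ?P" "f G = {e}" using surj by blast
    then have "G \<noteq> {}" using empty by auto
    then obtain v where v: "v \<in> G" "v extreme_point_of ?P"
      using face_contains_extreme_point[OF V(1) G(1)] by blast
    then have "v \<in> V" using extreme_point_of_convex_hull by blast
    moreover have "f {v} \<subseteq> f G" using mono[OF vface[OF \<open>v \<in> V\<close>] G(1)] v(1) by simp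
    ultimately show ?thesis using \<phi>(2) G(2) by auto
  qed
  then have "\<phi> ` V = {e. e extreme_point_of P'}" using \<phi>(1) by auto
  moreover have "v \<in> F \<longleftrightarrow> \<phi> v \<in> f F" if "F face_of ?P" "v \<in> V" for F v
    using mono[OF vface[OF that(2)] that(1)] \<phi>(2)[OF that(2)] by simp
  moreover have "inj_on \<phi> V"
  proof (rule inj_onI)
    fix v v' assume v: "v \<in> V" "v' \<in> V" "\<phi> v = \<phi> v'"
    then have "f {v} = f {v'}" using \<phi>(2) by simp
    then show "v = v'" using inj[OF vface[OF v(1)] vface[OF v(2)]] by simp
  qed
  ultimately show ?thesis using \<phi>(2) face by (intro exI[of _ \<phi>]) blast
qed

text \<open>The bridge from combinatorics to linear algebra. The zero set of a nonnegative affine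
  functional is a face, its image is a face, and a functional exposing that image has the wanted
  signs. Since \<open>h\<close> acts on homogenized points, it needs no constant term.\<close>

lemma functional_transfer:
  fixes V :: "rseq set"
  assumes V: "finite V" "\<And>v. v \<in> V \<Longrightarrow> v extreme_point_of convex hull V"
    and P': "polytope P'" "P' \<subseteq> Rn d" and iso: "face_lattice_iso f (convex hull V) P'"
  shows "\<exists>\<phi>. (\<forall>v\<in>V. f {v} = {\<phi> v}) \<and> inj_on \<phi> V \<and> \<phi> ` V \<subseteq> Rn d \<and> P' = convex hull (\<phi> ` V) \<and>
    (\<forall>g::rseq \<Rightarrow> real. \<forall>c. linear g \<longrightarrow> (\<forall>v\<in>V. g v + c \<ge> 0) \<longrightarrow>
      (\<exists>h::rseq \<Rightarrow> real. linear h \<and> (\<forall>v\<in>V. sgn (h (homogenize d (\<phi> v))) = sgn (g v + c))))"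
proof -
  obtain \<phi> where inj: "inj_on \<phi> V" and \<phi>: "\<forall>v\<in>V. f {v} = {\<phi> v}" "\<phi> ` V = {e. e extreme_point_of P'}"
      "\<And>F. F face_of convex hull V \<Longrightarrow> f F face_of P' \<and> (\<forall>v\<in>V. v \<in> F \<longleftrightarrow> \<phi> v \<in> f F)"
    using face_iso_vertices[OF V P'(1) iso] by blast
  obtain V' where V': "finite V'" "P' = convex hull V'" using P'(1) by (auto simp: polytope_def)
  have hull: "P' = convex hull (\<phi> ` V)"
    unfolding \<phi>(2) V'(2) using hull_extreme_points[OF V'(1)] by simp
  then have sub: "\<phi> ` V \<subseteq> Rn d" using P'(2) hull_subset[of "\<phi> ` V" convex] by blast
  have "\<exists>h::rseq \<Rightarrow> real. linear h \<and> (\<forall>v\<in>V. sgn (h (homogenize d (\<phi> v))) = sgn (g v + c))"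
    if g: "linear g" "\<forall>v\<in>V. g v + c \<ge> 0" for g :: "rseq \<Rightarrow> real" and c
  proof -
    define F where "F = {x \<in> convex hull V. g x + c = 0}"
    have F: "F face_of convex hull V" unfolding F_def using g by (intro supporting_face) auto
    have "f F face_of convex hull (\<phi> ` V)" using \<phi>(3)[OF F] hull by simp
    then obtain h :: "rseq \<Rightarrow> real" where h: "linear h" "\<forall>v\<in>\<phi> ` V. if v \<in> f F then h (homogenize d v) = 0
        else h (homogenize d v) > 0"
      using face_exposed[of "\<phi> ` V" d "f F"] V(1) sub by blast
    have "sgn (h (homogenize d (\<phi> v))) = sgn (g v + c)" if v: "v \<in> V" for v
    proof (cases "g v + c = 0")
      case True
      then have "v \<in> F" using v by (simp add: F_def hull_inc)
      then have "\<phi> v \<in> f F" using \<phi>(3)[OF F] v by blast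
      then show ?thesis using h(2) v True by auto
    next
      case False
      then have "v \<notin> F" by (simp add: F_def)
      then have "\<phi> v \<notin> f F" using \<phi>(3)[OF F] v by blast
      then have "h (homogenize d (\<phi> v)) > 0" using h(2) v by auto
      moreover have "g v + c > 0" using g(2) v False by (simp add: order_less_le)
      ultimately show ?thesis by simp
    qed
    then show ?thesis using h(1) by blast
  qed
  then show ?thesis using \<phi>(1) inj hull sub by (intro exI[of _ \<phi>]) blast
qed

section \<open>Coordinates and automorphisms from dual bases\<close>

lemma dual_basisD:
  assumes "dual_basis m F v"
  shows "i < m \<Longrightarrow> linear (F i)" "i < m \<Longrightarrow> v i \<in> Rn m"
    "i < m \<Longrightarrow> j < m \<Longrightarrow> F j (v i) = (if j = i then 1 else 0)"
    "x \<in> Rn m \<Longrightarrow> x = (\<Sum>i<m. F i x *\<^sub>R v i)"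
  using assms unfolding dual_basis_def by blast+

text \<open>Supporting functionals come with arbitrary positive scales; this permits normalizing
  them afterwards.\<close>

lemma dual_basis_rescale:
  assumes "dual_basis m F v" "\<And>i. i < m \<Longrightarrow> s i > 0"
  shows "dual_basis m (\<lambda>i x. s i * F i x) (\<lambda>i. (1 / s i) *\<^sub>R v i)"
  unfolding dual_basis_def
proof (intro conjI allI impI ballI)
  fix i assume i: "i < m"
  have lin: "linear (F i)" using dual_basisD(1)[OF assms(1) i] .
  show "linear (\<lambda>x. s i * F i x)" using linear_compose_scale_right[OF lin, of "s i"] by simp
  show "(1 / s i) *\<^sub>R v i \<in> Rn m"
    using dual_basisD(2)[OF assms(1) i] by (intro subspace_scale subspace_Rn)
  fix j assume j: "j < m"
  have "linear (F j)" using dual_basisD(1)[OF assms(1) j] .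
  then have "s j * F j ((1 / s i) *\<^sub>R v i) = s j / s i * F j (v i)" by (simp add: linear_scale)
  then show "s j * F j ((1 / s i) *\<^sub>R v i) = (if j = i then 1 else 0)"
    using dual_basisD(3)[OF assms(1) i j] assms(2)[OF i] by simp
next
  fix x assume "x \<in> Rn m"
  then have "x = (\<Sum>i<m. F i x *\<^sub>R v i)" by (rule dual_basisD(4)[OF assms(1)])
  also have "\<dots> = (\<Sum>i<m. (s i * F i x) *\<^sub>R (1 / s i) *\<^sub>R v i)"
    by (rule sum.cong) (use assms(2) less_irrefl in force)+
  finally show "x = (\<Sum>i<m. (s i * F i x) *\<^sub>R (1 / s i) *\<^sub>R v i)" .
qed

lemma dual_basis_functional:
  fixes h :: "rseq \<Rightarrow> real"
  assumes "dual_basis m F v" "linear h" "x \<in> Rn m"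
  shows "h x = (\<Sum>i<m. F i x * h (v i))"
proof -
  have "x = (\<Sum>i<m. F i x *\<^sub>R v i)" using dual_basisD(4)[OF assms(1,3)] .
  then have "h x = h (\<Sum>i<m. F i x *\<^sub>R v i)" by (rule arg_cong)
  then show ?thesis by (simp add: linear_sum[OF assms(2)] linear_scale[OF assms(2)])
qed

lemma dual_basis_comb:
  assumes "dual_basis m F v" "j < m"
  shows "F j (\<Sum>i<m. c i *\<^sub>R v i) = c j"
proof -
  have lin: "linear (F j)" using dual_basisD(1)[OF assms] .
  have "F j (\<Sum>i<m. c i *\<^sub>R v i) = (\<Sum>i<m. c i * F j (v i))"
    by (simp add: linear_sum[OF lin] linear_scale[OF lin])
  also have "\<dots> = (\<Sum>i<m. if i = j then c j else 0)"
    by (rule sum.cong) (use dual_basisD(3)[OF assms(1) _ assms(2)] in auto)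
  finally show ?thesis using assms(2) by simp
qed

text \<open>This is the map taking each \<open>v i\<close> to \<open>w i\<close>; exchanging the two
  dual bases gives its inverse.\<close>

lemma dual_basis_automorphism:
  assumes F: "dual_basis m F v" and G: "dual_basis m G w"
  shows "linear_automorphism m (\<lambda>x. \<Sum>i<m. F i x *\<^sub>R w i)"
  unfolding linear_automorphism_def
proof
  have F_lin: "linear (F i)" if "i < m" for i using dual_basisD(1)[OF F that] .
  show "linear (\<lambda>x. \<Sum>i<m. F i x *\<^sub>R w i)"
  proof (rule linearI)
    fix x y c
    show "(\<Sum>i<m. F i (x + y) *\<^sub>R w i) = (\<Sum>i<m. F i x *\<^sub>R w i) + (\<Sum>i<m. F i y *\<^sub>R w i)"
      unfolding sum.distrib[symmetric]
      by (rule sum.cong) (auto simp: linear_add[OF F_lin] scaleR_add_left)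
    show "(\<Sum>i<m. F i (c *\<^sub>R x) *\<^sub>R w i) = c *\<^sub>R (\<Sum>i<m. F i x *\<^sub>R w i)"
      unfolding scaleR_sum_right by (rule sum.cong) (auto simp: linear_scale[OF F_lin])
  qed
  have in_Rn: "(\<Sum>i<m. F i x *\<^sub>R w i) \<in> Rn m" if "dual_basis m F v" "dual_basis m G w" for F G v w x
    by (intro subspace_sum subspace_scale subspace_Rn) (use dual_basisD(2)[OF that(2)] in auto)
  have inv: "(\<Sum>i<m. G i (\<Sum>j<m. F j x *\<^sub>R w j) *\<^sub>R v i) = x"
    if "dual_basis m F v" "dual_basis m G w" "x \<in> Rn m" for F G v w x
  proof -
    have "(\<Sum>i<m. G i (\<Sum>j<m. F j x *\<^sub>R w j) *\<^sub>R v i) = (\<Sum>i<m. F i x *\<^sub>R v i)"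
      by (rule sum.cong) (simp_all add: dual_basis_comb[OF that(2)])
    also have "\<dots> = x" using dual_basisD(4)[OF that(1,3)] by (rule sym)
    finally show ?thesis .
  qed
  show "bij_betw (\<lambda>x. \<Sum>i<m. F i x *\<^sub>R w i) (Rn m) (Rn m)"
  proof (rule bij_betw_byWitness[where f' = "\<lambda>x. \<Sum>i<m. G i x *\<^sub>R v i"])
    show "\<forall>x\<in>Rn m. (\<Sum>i<m. G i (\<Sum>i<m. F i x *\<^sub>R w i) *\<^sub>R v i) = x"
      by (rule ballI) (rule inv[OF F G])
    show "\<forall>x\<in>Rn m. (\<Sum>i<m. F i (\<Sum>i<m. G i x *\<^sub>R v i) *\<^sub>R w i) = x"
      by (rule ballI) (rule inv[OF G F])
    show "(\<lambda>x. \<Sum>i<m. F i x *\<^sub>R w i) ` Rn m \<subseteq> Rn m"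
      by (rule image_subsetI) (rule in_Rn[OF F G])
    show "(\<lambda>x. \<Sum>i<m. G i x *\<^sub>R v i) ` Rn m \<subseteq> Rn m"
      by (rule image_subsetI) (rule in_Rn[OF G F])
  qed
qed

section \<open>Projective maps determined on vertices\<close>

text \<open>A convex combination with weights \<open>u v\<close> goes to the one with weights
  proportional to \<open>u v * t v\<close>. As \<open>t\<close> is positive, the denominator never
  vanishes on the hull, and dividing weights by \<open>t\<close> shows surjectivity.\<close>

lemma projective_map_hull:
  assumes V: "finite V" "V \<subseteq> Rn d" and \<phi>: "inj_on \<phi> V" "\<phi> ` V \<subseteq> Rn d"
    and L: "linear L" and t: "\<And>v. v \<in> V \<Longrightarrow> t v > 0"
    and Lv: "\<And>v. v \<in> V \<Longrightarrow> L (homogenize d v) = t v *\<^sub>R homogenize d (\<phi> v)"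
  shows "projective_map_defined_on d L (convex hull V)"
    and "projective_map d L ` (convex hull V) = convex hull (\<phi> ` V)"
    and "\<And>v. v \<in> V \<Longrightarrow> projective_map d L v = \<phi> v"
proof -
  have hom1: "Poly_Mapping.lookup (homogenize d (\<phi> v)) d = 1" if "v \<in> V" for v
    using that \<phi>(2) lookup_homogenize by blast
  have L_comb: "L (homogenize d (\<Sum>v\<in>V. u v *\<^sub>R v)) = (\<Sum>v\<in>V. (u v * t v) *\<^sub>R homogenize d (\<phi> v))"
    if "sum u V = 1" for u
  proof -
    have "homogenize d (\<Sum>v\<in>V. u v *\<^sub>R v) = (\<Sum>v\<in>V. u v *\<^sub>R homogenize d v)"
      unfolding sum_homogenize using that by (simp add: homogenize_def)
    then have "L (homogenize d (\<Sum>v\<in>V. u v *\<^sub>R v)) = (\<Sum>v\<in>V. u v *\<^sub>R L (homogenize d v))"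
      by (simp add: linear_sum[OF L] linear_scale[OF L])
    also have "\<dots> = (\<Sum>v\<in>V. (u v * t v) *\<^sub>R homogenize d (\<phi> v))"
      by (rule sum.cong) (simp_all add: Lv)
    finally show ?thesis .
  qed
  have lookup_comb: "Poly_Mapping.lookup (L (homogenize d (\<Sum>v\<in>V. u v *\<^sub>R v))) d = (\<Sum>v\<in>V. u v * t v)"
    if "sum u V = 1" for u
    unfolding L_comb[OF that] lookup_sum by (rule sum.cong) (simp_all add: hom1)
  have pos: "(\<Sum>v\<in>V. u v * t v) > 0" if "sum u V = 1" "\<forall>v\<in>V. u v \<ge> 0" for u
  proof -
    have "sum u V \<noteq> 0" using that(1) by simp
    then obtain v where v: "v \<in> V" "u v \<noteq> 0" by (rule sum.not_neutral_contains_not_neutral)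
    then have "u v * t v > 0" using that(2) t[OF v(1)] by (simp add: order_less_le)
    then show ?thesis
      using v(1) V(1) that(2) t by (intro sum_pos2[of V v]) (auto simp: less_imp_le)
  qed
  have map_comb: "projective_map d L (\<Sum>v\<in>V. u v *\<^sub>R v)
      = (\<Sum>v\<in>V. (u v * t v / (\<Sum>v\<in>V. u v * t v)) *\<^sub>R \<phi> v)"
    if u: "sum u V = 1" "\<forall>v\<in>V. u v \<ge> 0" for u
  proof -
    let ?T = "\<Sum>v\<in>V. u v * t v"
    have "(1 / ?T) *\<^sub>R (\<Sum>v\<in>V. (u v * t v) *\<^sub>R homogenize d (\<phi> v))
        = (\<Sum>v\<in>V. (u v * t v / ?T) *\<^sub>R homogenize d (\<phi> v))"
      by (simp add: scaleR_sum_right)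
    also have "\<dots> = (\<Sum>v\<in>V. (u v * t v / ?T) *\<^sub>R \<phi> v) + (\<Sum>v\<in>V. u v * t v / ?T) *\<^sub>R Poly_Mapping.single d 1"
      by (simp add: homogenize_def scaleR_add_right sum.distrib scaleR_sum_left)
    also have "(\<Sum>v\<in>V. u v * t v / ?T) = 1"
      using pos[OF u] by (simp add: sum_divide_distrib[symmetric])
    finally show ?thesis
      unfolding projective_map_def lookup_comb[OF u(1)] unfolding L_comb[OF u(1)] by simp
  qed
  have hull_V: "x \<in> convex hull V \<longleftrightarrow> (\<exists>u. (\<forall>v\<in>V. 0 \<le> u v) \<and> sum u V = 1 \<and> (\<Sum>v\<in>V. u v *\<^sub>R v) = x)" for x
    by (simp add: convex_hull_finite[OF V(1)])
  have hull_\<phi>: "x \<in> convex hull (\<phi> ` V) \<longleftrightarrow>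
      (\<exists>u. (\<forall>v\<in>V. 0 \<le> u v) \<and> sum u V = 1 \<and> (\<Sum>v\<in>V. u v *\<^sub>R \<phi> v) = x)" for x
  proof
    assume "x \<in> convex hull (\<phi> ` V)"
    then obtain u where "\<forall>v\<in>\<phi> ` V. 0 \<le> u v" "sum u (\<phi> ` V) = 1" "(\<Sum>v\<in>\<phi> ` V. u v *\<^sub>R v) = x"
      using V(1) by (auto simp: convex_hull_finite)
    then show "\<exists>u. (\<forall>v\<in>V. 0 \<le> u v) \<and> sum u V = 1 \<and> (\<Sum>v\<in>V. u v *\<^sub>R \<phi> v) = x"
      by (intro exI[of _ "u \<circ> \<phi>"]) (simp add: sum.reindex[OF \<phi>(1)])
  next
    assume "\<exists>u. (\<forall>v\<in>V. 0 \<le> u v) \<and> sum u V = 1 \<and> (\<Sum>v\<in>V. u v *\<^sub>R \<phi> v) = x"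
    then obtain u where u: "\<forall>v\<in>V. 0 \<le> u v" "sum u V = 1" "(\<Sum>v\<in>V. u v *\<^sub>R \<phi> v) = x" by blast
    have "(\<Sum>v\<in>V. u v *\<^sub>R \<phi> v) \<in> convex hull (\<phi> ` V)"
      using u V(1) by (intro convex_sum convex_convex_hull) (auto intro: hull_inc)
    then show "x \<in> convex hull (\<phi> ` V)" using u(3) by simp
  qed
  show "projective_map_defined_on d L (convex hull V)"
    unfolding projective_map_defined_on_def
  proof
    fix x assume "x \<in> convex hull V"
    then obtain u where u: "\<forall>v\<in>V. 0 \<le> u v" "sum u V = 1" "(\<Sum>v\<in>V. u v *\<^sub>R v) = x"
      using hull_V by blast
    then show "Poly_Mapping.lookup (L (homogenize d x)) d \<noteq> 0"
      using lookup_comb[OF u(2)] pos[OF u(2,1)] by simp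
  qed
  show "projective_map d L ` (convex hull V) = convex hull (\<phi> ` V)"
  proof
    show "projective_map d L ` (convex hull V) \<subseteq> convex hull (\<phi> ` V)"
    proof
      fix y assume "y \<in> projective_map d L ` (convex hull V)"
      then obtain x where x: "x \<in> convex hull V" "y = projective_map d L x" by blast
      from x(1) obtain u where u: "\<forall>v\<in>V. 0 \<le> u v" "sum u V = 1" "(\<Sum>v\<in>V. u v *\<^sub>R v) = x"
        unfolding hull_V by blast
      have "(\<Sum>v\<in>V. u v * t v / (\<Sum>v\<in>V. u v * t v)) = 1"
        using pos[OF u(2,1)] by (simp add: sum_divide_distrib[symmetric])
      moreover have "\<forall>v\<in>V. 0 \<le> u v * t v / (\<Sum>v\<in>V. u v * t v)"
        using u(1) t pos[OF u(2,1)] by (simp add: less_imp_le)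
      ultimately show "y \<in> convex hull (\<phi> ` V)"
        unfolding hull_\<phi> x(2) u(3)[symmetric] map_comb[OF u(2,1)]
        by (intro exI[of _ "\<lambda>v. u v * t v / (\<Sum>v\<in>V. u v * t v)"]) simp
    qed
    show "convex hull (\<phi> ` V) \<subseteq> projective_map d L ` (convex hull V)"
    proof
      fix y assume "y \<in> convex hull (\<phi> ` V)"
      then obtain q where q: "\<forall>v\<in>V. 0 \<le> q v" "sum q V = 1" "(\<Sum>v\<in>V. q v *\<^sub>R \<phi> v) = y"
        using hull_\<phi> by blast
      define S where "S = (\<Sum>v\<in>V. q v / t v)"
      have "S > 0"
      proof -
        have "sum q V \<noteq> 0" using q(2) by simp
        then obtain v where v: "v \<in> V" "q v \<noteq> 0" by (rule sum.not_neutral_contains_not_neutral)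
        then have "q v / t v > 0" using q(1) t[OF v(1)] by (simp add: order_less_le)
        then show ?thesis
          unfolding S_def using v(1) V(1) q(1) t by (intro sum_pos2[of V v]) (auto simp: less_imp_le)
      qed
      define u where "u v = q v / t v / S" for v
      have "sum u V = S / S" unfolding u_def S_def by (rule sum_divide_distrib[symmetric])
      moreover have "u v \<ge> 0" if "v \<in> V" for v
        using q(1) t[OF that] \<open>S > 0\<close> that by (simp add: u_def)
      ultimately have u: "\<forall>v\<in>V. u v \<ge> 0" "sum u V = 1" using \<open>S > 0\<close> by simp_all
      have ut: "u v * t v = q v / S" if "v \<in> V" for v using t[OF that] by (simp add: u_def)
      then have "(\<Sum>v\<in>V. u v * t v) = (\<Sum>v\<in>V. q v / S)" by (rule sum.cong[OF refl])
      then have T: "(\<Sum>v\<in>V. u v * t v) = 1 / S"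
        using q(2) by (simp add: sum_divide_distrib[symmetric])
      have "projective_map d L (\<Sum>v\<in>V. u v *\<^sub>R v) = (\<Sum>v\<in>V. q v *\<^sub>R \<phi> v)"
        unfolding map_comb[OF u(2,1)] T by (rule sum.cong) (use \<open>S > 0\<close> in \<open>auto simp: ut\<close>)
      then have "y = projective_map d L (\<Sum>v\<in>V. u v *\<^sub>R v)" using q(3) by simp
      moreover have "(\<Sum>v\<in>V. u v *\<^sub>R v) \<in> convex hull V" using u hull_V by blast
      ultimately show "y \<in> projective_map d L ` (convex hull V)" by blast
    qed
  qed
  show "projective_map d L v = \<phi> v" if v: "v \<in> V" for v
    unfolding projective_map_def Lv[OF v] using hom1[OF v] t[OF v] by (simp add: homogenize_def)
qed

section \<open>Rigidity of the coordinates\<close>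

text \<open>
  The rows are the four sides and the two diagonals of the square described above.
\<close>

definition theta :: "nat \<Rightarrow> nat \<Rightarrow> real" where
  "theta f a = [[-1,-1,1,1], [1,1,-1,-1], [1,-1,-1,1], [-1,1,1,-1], [-1,0,1,0], [0,-1,0,1]] ! f ! a"

text \<open>The difference of squared norms within a Lawrence pair. It provides the constant in the
  side equations 4 + y + z, 4 - y - z, 4 - y + z, 4 + y - z, whereas the diagonals y and z pass
  through the centre.\<close>

definition theta_sq :: "nat \<Rightarrow> real" where
  "theta_sq f = (if f < 4 then 4 else 0)"

text \<open>
  A functional with coefficient \<open>c\<close> on the squared norm, \<open>e\<close> on the progression coordinate and
  \<open>b\<close> on the simplex coordinates takes these values on the long vertices and on the exterior
  vectors; the constant \<open>1\<close> in the squared norm of a long vertex is absorbed in \<open>b\<close>.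
\<close>

definition long_val :: "real \<Rightarrow> real \<Rightarrow> (nat \<Rightarrow> real) \<Rightarrow> nat \<Rightarrow> real" where
  "long_val c e b s = c * (real s)\<^sup>2 + e * real s + b (s mod 4)"

definition ext_val :: "real \<Rightarrow> (nat \<Rightarrow> real) \<Rightarrow> nat \<Rightarrow> real" where
  "ext_val c b f = c * theta_sq f + (\<Sum>a<4. b a * theta f a)"

text \<open>Squared distance from \<open>z\<close> to \<open>4\<int>\<close>.\<close>

definition cyc_sq :: "int \<Rightarrow> real" where
  "cyc_sq z = (if z mod 4 = 0 then 0 else if z mod 4 = 2 then 4 else 1)"

text \<open>Completes the square: the functional becomes (s - t)^2 minus the squared distance from t
  to the progression of s, which is nonnegative at every integer s.\<close>

definition time_coeff :: "nat \<Rightarrow> nat \<Rightarrow> real" where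
  "time_coeff t a = (real t)\<^sup>2 - cyc_sq (int a - int t)"

definition time_val :: "nat \<Rightarrow> nat \<Rightarrow> real" where
  "time_val t = long_val 1 (- 2 * real t) (time_coeff t)"

definition time_ext :: "nat \<Rightarrow> nat \<Rightarrow> real" where
  "time_ext t = ext_val 1 (time_coeff t)"

text \<open>Turns the height s into s - (s mod 2), a supporting functional without quadratic part
  that touches only the points 0 and 1.\<close>

definition kap_coeff :: "nat \<Rightarrow> real" where
  "kap_coeff a = - real (a mod 2)"

section \<open>Values of the standard functionals\<close>

lemma lessThan_4: "{..<4::nat} = {0,1,2,3}"
  by auto

lemma sum_less_4: "(\<Sum>a<4::nat. g a) = g 0 + g 1 + g 2 + (g 3 :: real)"
  by (simp add: lessThan_4)

lemma mod_4_cases: "(t::nat) mod 4 = 0 \<or> t mod 4 = 1 \<or> t mod 4 = 2 \<or> t mod 4 = 3"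
  by linarith

lemma mod_4_add:
  fixes s :: nat
  shows "s mod 4 = 0 \<Longrightarrow> (s + 1) mod 4 = 1" "s mod 4 = 1 \<Longrightarrow> (s + 1) mod 4 = 2"
    "s mod 4 = 2 \<Longrightarrow> (s + 1) mod 4 = 3" "s mod 4 = 3 \<Longrightarrow> (s + 1) mod 4 = 0"
    "s mod 4 = 0 \<Longrightarrow> (s + 2) mod 4 = 2" "s mod 4 = 1 \<Longrightarrow> (s + 2) mod 4 = 3"
    "s mod 4 = 2 \<Longrightarrow> (s + 2) mod 4 = 0" "s mod 4 = 3 \<Longrightarrow> (s + 2) mod 4 = 1"
  by (simp_all add: mod_Suc)

lemma theta_simps:
  "theta 0 0 = -1" "theta 0 (Suc 0) = -1" "theta 0 2 = 1" "theta 0 3 = 1"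
  "theta (Suc 0) 0 = 1" "theta (Suc 0) (Suc 0) = 1" "theta (Suc 0) 2 = -1" "theta (Suc 0) 3 = -1"
  "theta 2 0 = 1" "theta 2 (Suc 0) = -1" "theta 2 2 = -1" "theta 2 3 = 1"
  "theta 3 0 = -1" "theta 3 (Suc 0) = 1" "theta 3 2 = 1" "theta 3 3 = -1"
  "theta 4 0 = -1" "theta 4 (Suc 0) = 0" "theta 4 2 = 1" "theta 4 3 = 0"
  "theta 5 0 = 0" "theta 5 (Suc 0) = -1" "theta 5 2 = 0" "theta 5 3 = 1"
  by (simp_all add: theta_def numeral_eq_Suc)

text \<open>Hence \<open>ext_val\<close> depends on \<open>b\<close> only through b 2 - b 0 and b 3
  - b 1, the two waves y and z.\<close>

lemma theta_opposite:
  assumes "f < 6"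
  shows "theta f 0 + theta f 2 = 0" "theta f 1 + theta f 3 = 0"
proof -
  consider "f = 0" | "f = 1" | "f = 2" | "f = 3" | "f = 4" | "f = 5" using assms by linarith
  then have "theta f 0 + theta f 2 = 0 \<and> theta f 1 + theta f 3 = 0"
    by cases (simp_all add: theta_simps)
  then show "theta f 0 + theta f 2 = 0" "theta f 1 + theta f 3 = 0" by simp_all
qed

lemma time_val_eq: "time_val t s = (real_of_int (int s - int t))\<^sup>2 - cyc_sq (int s - int t)"
proof -
  have "(int (s mod 4) - int t) mod 4 = (int s - int t) mod 4"
    unfolding of_nat_mod of_nat_numeral by (rule mod_diff_left_eq)
  then have eq: "cyc_sq (int (s mod 4) - int t) = cyc_sq (int s - int t)"
    by (simp only: cyc_sq_def)
  show ?thesis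
    unfolding time_val_def long_val_def time_coeff_def eq
    by (simp add: power2_eq_square algebra_simps)
qed

lemma cyc_sq_le: "cyc_sq z \<le> (real_of_int z)\<^sup>2"
  and cyc_sq_eq_iff: "cyc_sq z = (real_of_int z)\<^sup>2 \<longleftrightarrow> \<bar>z\<bar> \<le> 2"
proof -
  have small: "cyc_sq z = (real_of_int z)\<^sup>2" if "\<bar>z\<bar> \<le> 2"
  proof -
    have "z = -2 \<or> z = -1 \<or> z = 0 \<or> z = 1 \<or> z = 2" using that by linarith
    then show ?thesis by (auto simp: cyc_sq_def)
  qed
  have big: "cyc_sq z < (real_of_int z)\<^sup>2" if "\<not> \<bar>z\<bar> \<le> 2"
  proof -
    have "(2::real)\<^sup>2 < \<bar>real_of_int z\<bar>\<^sup>2"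
      using that by (intro power_strict_mono) linarith+
    moreover have "cyc_sq z \<le> 4" by (simp add: cyc_sq_def)
    ultimately show ?thesis by simp
  qed
  show "cyc_sq z \<le> (real_of_int z)\<^sup>2" using small big by fastforce
  show "cyc_sq z = (real_of_int z)\<^sup>2 \<longleftrightarrow> \<bar>z\<bar> \<le> 2" using small big by fastforce
qed

lemma time_val_nonneg: "time_val t s \<ge> 0"
  using cyc_sq_le[of "int s - int t"] by (simp add: time_val_eq)

lemma time_val_eq_0_iff: "time_val t s = 0 \<longleftrightarrow> s \<le> t + 2 \<and> t \<le> s + 2"
  using cyc_sq_eq_iff[of "int s - int t"] by (auto simp: time_val_eq)

lemma time_coeff_mod:
  assumes "t mod 4 = k"
  shows "time_coeff t a = (real t)\<^sup>2 - cyc_sq (int a - int k)"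
proof -
  have "(int a - int t) mod 4 = (int a - int k) mod 4"
    unfolding assms[symmetric] of_nat_mod of_nat_numeral by (rule mod_diff_right_eq[symmetric])
  then show ?thesis by (simp only: time_coeff_def cyc_sq_def)
qed

lemma cyc_sq_simps:
  "cyc_sq 0 = 0" "cyc_sq 1 = 1" "cyc_sq 2 = 4" "cyc_sq 3 = 1" "cyc_sq (-1) = 1" "cyc_sq (-2) = 4" "cyc_sq (-3) = 1"
  by (simp_all add: cyc_sq_def)

text \<open>The term t^2 is common to all fibres and each row of \<open>theta\<close> sums to zero,
  so only the part periodic in t survives.\<close>

lemma time_ext_mod:
  assumes "t mod 4 = k" "f < 6"
  shows "time_ext t f = theta_sq f - (cyc_sq (- int k) * theta f 0 + cyc_sq (1 - int k) * theta f 1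
    + cyc_sq (2 - int k) * theta f 2 + cyc_sq (3 - int k) * theta f 3)"
proof -
  have opp: "theta f 2 = - theta f 0" "theta f 3 = - theta f 1"
    using theta_opposite[OF assms(2)] by linarith+
  have "time_ext t f = theta_sq f + (((real t)\<^sup>2 - cyc_sq (- int k)) * theta f 0
    + ((real t)\<^sup>2 - cyc_sq (1 - int k)) * theta f 1 + ((real t)\<^sup>2 - cyc_sq (2 - int k)) * theta f 2
    + ((real t)\<^sup>2 - cyc_sq (3 - int k)) * theta f 3)"
    by (simp only: time_ext_def ext_val_def sum_less_4 time_coeff_mod[OF assms(1)] mult_1
        of_nat_0 of_nat_1 of_nat_numeral diff_0)
  then show ?thesis unfolding opp by algebra
qed

text \<open>At times 0, 1, 2, 3 modulo 4 the point (y, z) is at the corners (-4,0), (0,-4), (4,0),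
  (0,4). At each corner two sides and one diagonal vanish.\<close>

lemma time_ext_simps:
  "t mod 4 = 0 \<Longrightarrow> time_ext t 0 = 0" "t mod 4 = 0 \<Longrightarrow> time_ext t (Suc 0) = 8"
  "t mod 4 = 0 \<Longrightarrow> time_ext t 3 = 0" "t mod 4 = 0 \<Longrightarrow> time_ext t 5 = 0"
  "t mod 4 = Suc 0 \<Longrightarrow> time_ext t 0 = 0" "t mod 4 = Suc 0 \<Longrightarrow> time_ext t (Suc 0) = 8"
  "t mod 4 = Suc 0 \<Longrightarrow> time_ext t 2 = 0" "t mod 4 = Suc 0 \<Longrightarrow> time_ext t 4 = 0"
  "t mod 4 = 2 \<Longrightarrow> time_ext t 0 = 8" "t mod 4 = 2 \<Longrightarrow> time_ext t (Suc 0) = 0"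
  "t mod 4 = 2 \<Longrightarrow> time_ext t 2 = 0" "t mod 4 = 2 \<Longrightarrow> time_ext t 3 = 8"
  "t mod 4 = 2 \<Longrightarrow> time_ext t 4 = 4" "t mod 4 = 2 \<Longrightarrow> time_ext t 5 = 0"
  "t mod 4 = 3 \<Longrightarrow> time_ext t 0 = 8" "t mod 4 = 3 \<Longrightarrow> time_ext t (Suc 0) = 0"
  "t mod 4 = 3 \<Longrightarrow> time_ext t 3 = 0" "t mod 4 = 3 \<Longrightarrow> time_ext t 4 = 0"
  by (simp_all add: time_ext_mod theta_sq_def theta_simps cyc_sq_simps)

lemma kap_val: "long_val 0 1 kap_coeff s = 2 * real (s div 2)"
proof -
  have "s mod 4 mod 2 = s mod 2" by (simp add: mod_mod_cancel)
  moreover have "real s = 2 * real (s div 2) + real (s mod 2)"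
    by (metis of_nat_add of_nat_mult of_nat_numeral mult_div_mod_eq)
  ultimately show ?thesis by (simp add: long_val_def kap_coeff_def)
qed

lemma time_val_2_add_4: "time_val 2 (s + 4) = time_val 2 s + 8 * real s"
proof -
  have "int (s + 4) - int 2 = (int s - int 2) + 4" by simp
  then have "cyc_sq (int (s + 4) - int 2) = cyc_sq (int s - int 2)"
    unfolding cyc_sq_def by (simp only: mod_add_self2)
  then show ?thesis unfolding time_val_eq by (simp add: power2_eq_square algebra_simps)
qed

text \<open>
  In an arbitrary realization, scaled so that the functional of the own fibre is \<open>1\<close> on each long
  vertex, \<open>sg\<close> and \<open>rh\<close> are the remaining two coordinates of the long vertices, and \<open>th\<close>, \<open>r\<close> are
  the coordinates of the exterior vectors. All that is known is that every supporting functional of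
  the original polytope has a counterpart with the same signs.
\<close>

locale realization_coordinates =
  fixes N :: nat and th :: "nat \<Rightarrow> nat \<Rightarrow> real" and r sg rh :: "nat \<Rightarrow> real"
  assumes N_ge: "N \<ge> 12"
    and sgn_th: "\<And>f a. f < 6 \<Longrightarrow> a < 4 \<Longrightarrow> sgn (th f a) = sgn (theta f a)"
    and sgn_r: "\<And>f. f < 6 \<Longrightarrow> sgn (r f) = sgn (time_ext 2 f)"
    and sgn_sg: "\<And>s. s < N \<Longrightarrow> sgn (sg s) = sgn (long_val 0 1 kap_coeff s)"
    and sgn_rh: "\<And>s. s < N \<Longrightarrow> sgn (rh s) = sgn (time_val 2 s)"
    and functional: "\<And>c e b. (\<And>s. s < N \<Longrightarrow> long_val c e b s \<ge> 0) \<Longrightarrow>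
      \<exists>A B C. (\<forall>s<N. sgn (A (s mod 4) + B * sg s + C * rh s) = sgn (long_val c e b s)) \<and>
        (\<forall>f<6. sgn ((\<Sum>a<4. A a * th f a) + C * r f) = sgn (ext_val c b f))"
begin

lemma sg_simps: "sg 0 = 0" "sg (Suc 0) = 0" "2 \<le> s \<Longrightarrow> s < N \<Longrightarrow> sg s > 0"
  using sgn_sg[of 0] sgn_sg[of 1] sgn_sg[of s] N_ge
  by (auto simp: kap_val sgn_0_0 sgn_1_pos div_greater_zero_iff split: if_splits)

lemma rh_simps: "s \<le> 4 \<Longrightarrow> rh s = 0" "4 < s \<Longrightarrow> s < N \<Longrightarrow> rh s > 0"
proof -
  show "rh s = 0" if "s \<le> 4"
    using that sgn_rh[of s] time_val_eq_0_iff[of 2 s] N_ge by (auto simp: sgn_0_0)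
  show "rh s > 0" if "4 < s" "s < N"
    using that sgn_rh[of s] time_val_eq_0_iff[of 2 s] time_val_nonneg[of 2 s]
    by (auto simp: sgn_1_pos)
qed

lemma th_simps:
  "th 0 2 > 0" "th 1 2 < 0" "th 2 2 < 0" "th 3 2 > 0" "th 4 2 > 0" "th 5 3 > 0"
  "th 4 1 = 0" "th 4 3 = 0" "th 5 0 = 0" "th 5 2 = 0"
  using sgn_th[of 0 2] sgn_th[of 1 2] sgn_th[of 2 2] sgn_th[of 3 2] sgn_th[of 4 2] sgn_th[of 5 3]
    sgn_th[of 4 1] sgn_th[of 4 3] sgn_th[of 5 0] sgn_th[of 5 2]
  by (simp_all add: theta_simps sgn_0_0 sgn_1_pos sgn_1_neg)

lemma r_simps: "r 0 > 0" "r 1 = 0" "r 2 = 0" "r 3 > 0" "r 4 > 0" "r 5 = 0"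
  using sgn_r[of 0] sgn_r[of 1] sgn_r[of 2] sgn_r[of 3] sgn_r[of 4] sgn_r[of 5]
  by (simp_all add: time_ext_simps sgn_0_0 sgn_1_pos)

section \<open>Counterparts of supporting functionals\<close>

text \<open>A, B, C are coefficients of a counterpart of \<open>time_val t\<close>. The second line
  has no B because the functional behind \<open>sg\<close> vanishes on the exterior vectors.\<close>

definition time_functional :: "nat \<Rightarrow> (nat \<Rightarrow> real) \<Rightarrow> real \<Rightarrow> real \<Rightarrow> bool" where
  "time_functional t A B C \<longleftrightarrow>
    (\<forall>s<N. sgn (A (s mod 4) + B * sg s + C * rh s) = sgn (time_val t s)) \<and>
    (\<forall>f<6. sgn ((\<Sum>a<4. A a * th f a) + C * r f) = sgn (time_ext t f))"

lemma ex_time_functional: "\<exists>A B C. time_functional t A B C"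
  using functional[of 1 "- 2 * real t" "time_coeff t"] time_val_nonneg[of t]
  by (simp add: time_functional_def time_val_def time_ext_def)

lemma time_functional_contact:
  assumes "time_functional t A B C" "s < N" "s \<le> t + 2" "t \<le> s + 2"
  shows "A (s mod 4) + B * sg s + C * rh s = 0"
proof -
  have "sgn (A (s mod 4) + B * sg s + C * rh s) = sgn (time_val t s)"
    using assms by (simp add: time_functional_def)
  then show ?thesis using assms time_val_eq_0_iff[of t s] by (simp add: sgn_0_0)
qed

lemma time_functional_pos:
  assumes "time_functional t A B C" "s < N" "s > t + 2"
  shows "A (s mod 4) + B * sg s + C * rh s > 0"
proof -
  have "time_val t s > 0"
    using assms(3) time_val_eq_0_iff[of t s] time_val_nonneg[of t s] by auto
  moreover have "sgn (A (s mod 4) + B * sg s + C * rh s) = sgn (time_val t s)"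
    using assms by (simp add: time_functional_def)
  ultimately show ?thesis by (simp add: sgn_1_pos)
qed

lemma fibre_functional:
  assumes b: "\<And>a. a < 4 \<Longrightarrow> b a \<ge> 0"
  shows "\<exists>A B C. (\<forall>s<N. sgn (A (s mod 4) + B * sg s + C * rh s) = sgn (b (s mod 4))) \<and>
        (\<forall>f<6. sgn ((\<Sum>a<4. A a * th f a) + C * r f) = sgn (\<Sum>a<4. b a * theta f a))"
  using functional[of 0 0 b] b by (simp add: long_val_def ext_val_def)

text \<open>The contacts 0, 4, 8 all lie in fibre 0 and kill A 0, B and C in turn: \<open>sg\<close>
  and \<open>rh\<close> vanish at 0, only \<open>rh\<close> vanishes at 4, and \<open>rh\<close> is
  positive at 8. Once C is gone, a zero on an exterior vector is a relation among its fibre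
  coordinates alone.\<close>

lemma fibre_functional_0:
  assumes b: "\<And>a. a < 4 \<Longrightarrow> b a \<ge> 0" and b0: "b 0 = 0"
  obtains A where "\<And>a. a < 4 \<Longrightarrow> sgn (A a) = sgn (b a)"
    and "\<And>f. f < 6 \<Longrightarrow> (\<Sum>a<4. b a * theta f a) = 0 \<Longrightarrow> (\<Sum>a<4. A a * th f a) = 0"
proof -
  obtain A B C
    where X: "\<And>s. s < N \<Longrightarrow> sgn (A (s mod 4) + B * sg s + C * rh s) = sgn (b (s mod 4))"
      and W: "\<And>f. f < 6 \<Longrightarrow> sgn ((\<Sum>a<4. A a * th f a) + C * r f) = sgn (\<Sum>a<4. b a * theta f a)"
    using fibre_functional[of b] b by blast
  have "A 0 = 0"
    using X[of 0] N_ge b0 by (simp add: sg_simps rh_simps sgn_0_0)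
  moreover have "B = 0"
    using X[of 4] N_ge b0 sg_simps(3)[of 4] \<open>A 0 = 0\<close> by (simp add: rh_simps sgn_0_0)
  moreover have "C = 0"
    using X[of 8] N_ge b0 rh_simps(2)[of 8] \<open>A 0 = 0\<close> \<open>B = 0\<close> by (simp add: sgn_0_0)
  ultimately have *: "sgn (A a) = sgn (b a)" if "a < 4" for a
    using X[of a] that N_ge by simp
  have "(\<Sum>a<4. A a * th f a) = 0" if "f < 6" "(\<Sum>a<4. b a * theta f a) = 0" for f
    using W[of f] that \<open>C = 0\<close> by (simp add: sgn_0_0)
  with * show thesis using that by blast
qed

text \<open>Now the contacts are 1, 5, 9, and \<open>rh\<close> is already positive at 5, so the
  elimination is no longer triangular. A counterpart of time 3 vanishes at 1 and 5 but is positive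
  at 9; this makes the pairs (sg, rh) at 5 and at 9 linearly independent.\<close>

lemma fibre_functional_1:
  assumes b: "\<And>a. a < 4 \<Longrightarrow> b a \<ge> 0" and b1: "b 1 = 0"
  obtains A where "\<And>a. a < 4 \<Longrightarrow> sgn (A a) = sgn (b a)"
    and "\<And>f. f < 6 \<Longrightarrow> (\<Sum>a<4. b a * theta f a) = 0 \<Longrightarrow> (\<Sum>a<4. A a * th f a) = 0"
proof -
  obtain A B C
    where X: "\<And>s. s < N \<Longrightarrow> sgn (A (s mod 4) + B * sg s + C * rh s) = sgn (b (s mod 4))"
      and W: "\<And>f. f < 6 \<Longrightarrow> sgn ((\<Sum>a<4. A a * th f a) + C * r f) = sgn (\<Sum>a<4. b a * theta f a)"
    using fibre_functional[of b] b by blast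
  obtain A' B' C' where T: "time_functional 3 A' B' C'" using ex_time_functional by blast
  have "A 1 = 0"
    using X[of 1] N_ge b1 by (simp add: sg_simps rh_simps sgn_0_0)
  moreover have "A' 1 = 0"
    using time_functional_contact[OF T, of 1] N_ge by (simp add: sg_simps rh_simps)
  ultimately have 5: "B * sg 5 + C * rh 5 = 0" "B' * sg 5 + C' * rh 5 = 0"
    and 9: "B * sg 9 + C * rh 9 = 0" "B' * sg 9 + C' * rh 9 > 0"
    using X[of 5] X[of 9] N_ge b1 time_functional_contact[OF T, of 5] time_functional_pos[OF T, of 9]
    by (simp_all add: sgn_0_0)
  have rh5: "rh 5 > 0" using rh_simps(2)[of 5] N_ge by simp
  have C: "C = - B * sg 5 / rh 5" "C' = - B' * sg 5 / rh 5"
    using 5 rh5 by (simp_all add: field_simps)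
  have "B * (sg 9 - sg 5 * rh 9 / rh 5) = 0" "B' * (sg 9 - sg 5 * rh 9 / rh 5) > 0"
    using 9 by (simp_all add: C algebra_simps)
  then have "B = 0" by auto
  then have "C = 0" by (simp add: C)
  have *: "sgn (A a) = sgn (b a)" if "a < 4" for a
    using X[of a] that N_ge \<open>B = 0\<close> \<open>C = 0\<close> by simp
  have "(\<Sum>a<4. A a * th f a) = 0" if "f < 6" "(\<Sum>a<4. b a * theta f a) = 0" for f
    using W[of f] that \<open>C = 0\<close> by (simp add: sgn_0_0)
  with * show thesis using that by blast
qed

section \<open>Parallel sides of the square\<close>

text \<open>Indicator functions of sets of fibres give proportions in the rows: the even and the odd
  fibres for all rows, fibres 1 and 2 for the opposite sides 0 and 1, fibres 2 and 3 for the
  opposite sides 2 and 3. Rescaling the fibres absorbs three of these four ratios; the remaining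
  slope defect \<open>e\<close> is settled by the time functionals.\<close>

lemma theta_scaling:
  "\<exists>c \<mu> e. (\<forall>a<4. c a > 0) \<and> (\<forall>f<6. \<mu> f > 0) \<and> e > 0 \<and> (\<forall>f<6. \<forall>a<4.
      c a * th f a = \<mu> f * (if (f = 2 \<or> f = 3) \<and> odd a then e else 1) * theta f a)"
proof -
  obtain A1 where A1: "\<And>a. a < 4 \<Longrightarrow> sgn (A1 a) = sgn (if odd a then 1 else 0 :: real)"
      "\<And>f. f < 6 \<Longrightarrow> (\<Sum>a<4. (if odd a then 1 else 0) * theta f a) = 0 \<Longrightarrow> (\<Sum>a<4. A1 a * th f a) = 0"
    by (rule fibre_functional_0[of "\<lambda>a. (if odd a then 1 else 0)"]) auto
  obtain A2 where A2: "\<And>a. a < 4 \<Longrightarrow> sgn (A2 a) = sgn (if a = 1 \<or> a = 2 then 1 else 0 :: real)"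
      "\<And>f. f < 6 \<Longrightarrow> (\<Sum>a<4. (if a = 1 \<or> a = 2 then 1 else 0) * theta f a) = 0 \<Longrightarrow> (\<Sum>a<4. A2 a * th f a) = 0"
    by (rule fibre_functional_0[of "\<lambda>a. (if a = 1 \<or> a = 2 then 1 else 0)"]) auto
  obtain A3 where A3: "\<And>a. a < 4 \<Longrightarrow> sgn (A3 a) = sgn (if a = 2 \<or> a = 3 then 1 else 0 :: real)"
      "\<And>f. f < 6 \<Longrightarrow> (\<Sum>a<4. (if a = 2 \<or> a = 3 then 1 else 0) * theta f a) = 0 \<Longrightarrow> (\<Sum>a<4. A3 a * th f a) = 0"
    by (rule fibre_functional_0[of "\<lambda>a. (if a = 2 \<or> a = 3 then 1 else 0)"]) auto
  \<comment> \<open>Fibre 0 carries weight 1 here, so the contacts have to be taken in fibre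
    1.\<close>
  obtain A0 where A0: "\<And>a. a < 4 \<Longrightarrow> sgn (A0 a) = sgn (if even a then 1 else 0 :: real)"
      "\<And>f. f < 6 \<Longrightarrow> (\<Sum>a<4. (if even a then 1 else 0) * theta f a) = 0 \<Longrightarrow> (\<Sum>a<4. A0 a * th f a) = 0"
    by (rule fibre_functional_1[of "\<lambda>a. (if even a then 1 else 0)"]) auto
  have s0: "A0 1 = 0" "A0 3 = 0" "A0 0 > 0" "A0 2 > 0"
    using A0(1)[of 0] A0(1)[of 1] A0(1)[of 2] A0(1)[of 3] by (simp_all add: sgn_0_0 sgn_1_pos)
  have s1: "A1 0 = 0" "A1 2 = 0" "A1 1 > 0" "A1 3 > 0"
    using A1(1)[of 0] A1(1)[of 1] A1(1)[of 2] A1(1)[of 3] by (simp_all add: sgn_0_0 sgn_1_pos)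
  have s2: "A2 0 = 0" "A2 3 = 0" "A2 1 > 0" "A2 2 > 0"
    using A2(1)[of 0] A2(1)[of 1] A2(1)[of 2] A2(1)[of 3] by (simp_all add: sgn_0_0 sgn_1_pos)
  have s3: "A3 0 = 0" "A3 1 = 0" "A3 2 > 0" "A3 3 > 0"
    using A3(1)[of 0] A3(1)[of 1] A3(1)[of 2] A3(1)[of 3] by (simp_all add: sgn_0_0 sgn_1_pos)
  have e0: "A0 0 * th f 0 + A0 2 * th f 2 = 0" if "f < 6" for f
    using A0(2)[OF that] theta_opposite[OF that] s0 by (simp add: sum_less_4)
  have e1: "A1 1 * th f 1 + A1 3 * th f 3 = 0" if "f < 6" for f
    using A1(2)[OF that] theta_opposite[OF that] s1 by (simp add: sum_less_4)
  have e2: "A2 1 * th f 1 + A2 2 * th f 2 = 0" if "f = 0 \<or> f = 1" for f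
    using A2(2)[of 0] A2(2)[of 1] A2(2)[of 2] A2(2)[of 3] that s2
    by (elim disjE) (simp_all add: sum_less_4 theta_simps)
  have e3: "A3 2 * th f 2 + A3 3 * th f 3 = 0" if "f = 2 \<or> f = 3" for f
    using A3(2)[of 0] A3(2)[of 1] A3(2)[of 2] A3(2)[of 3] that s3
    by (elim disjE) (simp_all add: sum_less_4 theta_simps)
  \<comment> \<open>Fibre 2 is the unit. The scales of fibres 1, 3 and 0 are read off from A2, A1
    and A0, which leaves A3 to define \<open>e\<close>.\<close>
  define c1 where "c1 = A2 1 / A2 2"
  define c3 where "c3 = c1 * A1 3 / A1 1"
  define c where "c = (\<lambda>a::nat. if a = 0 then A0 0 / A0 2 else if a = 1 then c1
    else if a = 2 then 1 else c3)"
  define e where "e = A3 2 * c3 / A3 3"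
  \<comment> \<open>Row 5 vanishes in fibre 2, so its scale is taken from fibre 3.\<close>
  define \<mu> where "\<mu> = (\<lambda>f::nat. if f = 5 then c3 * th 5 3 else \<bar>th f 2\<bar>)"
  have c1: "c1 > 0" using s2 by (simp add: c1_def)
  have c3: "c3 > 0" using s1 c1 by (simp add: c3_def)
  have c_pos: "c a > 0" if "a < 4" for a using that s0 c1 c3 by (simp add: c_def)
  have \<mu>_pos: "\<mu> f > 0" if fl: "f < 6" for f
  proof -
    consider "f = 0" | "f = 1" | "f = 2" | "f = 3" | "f = 4" | "f = 5" using fl by linarith
    then show ?thesis using c3 th_simps by cases (simp_all add: \<mu>_def)
  qed
  have e_pos: "e > 0" using s3 c3 by (simp add: e_def)
  have scaled: "c a * th f a = \<mu> f * (if (f = 2 \<or> f = 3) \<and> odd a then e else 1) * theta f a"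
    if fa: "f < 6" "a < 4" for f a
  proof -
    have t0: "c 0 * th f 0 = - th f 2"
      using e0[OF fa(1)] s0 by (simp add: c_def field_simps)
    have t1: "c 1 * th f 1 = - (c 3 * th f 3)"
    proof -
      have "th f 1 = - (A1 3 * th f 3) / A1 1" using e1[OF fa(1)] s1 by (simp add: field_simps)
      then show ?thesis by (simp add: c_def c3_def)
    qed
    have t2: "c 1 * th f 1 = - th f 2" if "f = 0 \<or> f = 1"
      using e2[OF that] s2 by (simp add: c_def c1_def field_simps)
    have t3: "c 3 * th f 3 = - (e * th f 2)" if "f = 2 \<or> f = 3"
    proof -
      have "th f 3 = - (A3 2 * th f 2) / A3 3" using e3[OF that] s3 by (simp add: field_simps)
      then show ?thesis by (simp add: c_def e_def)
    qed
    have c2: "c 2 = 1" by (simp add: c_def)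
    have m: "\<mu> 0 = th 0 2" "\<mu> 1 = - th 1 2" "\<mu> 2 = - th 2 2" "\<mu> 3 = th 3 2" "\<mu> 4 = th 4 2"
      "\<mu> 5 = c 3 * th 5 3"
      using th_simps by (simp_all add: \<mu>_def c_def)
    consider "f = 0" | "f = 1" | "f = 2" | "f = 3" | "f = 4" | "f = 5" using fa(1) by linarith
    then have "c 0 * th f 0 = \<mu> f * theta f 0 \<and> c 2 * th f 2 = \<mu> f * theta f 2 \<and>
      c 1 * th f 1 = \<mu> f * (if f = 2 \<or> f = 3 then e else 1) * theta f 1 \<and>
      c 3 * th f 3 = \<mu> f * (if f = 2 \<or> f = 3 then e else 1) * theta f 3"
    proof cases
      case 1 then show ?thesis using t0 t1 t2 c2 m(1) by (simp add: theta_simps)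
    next
      case 2 then show ?thesis using t0 t1 t2 c2 m(2) by (simp add: theta_simps)
    next
      case 3 then show ?thesis using t0 t1 t3 c2 m(3) by (simp add: theta_simps)
    next
      case 4 then show ?thesis using t0 t1 t3 c2 m(4) by (simp add: theta_simps)
    next
      case 5 then show ?thesis using t0 t1 c2 m(5) th_simps by (simp add: theta_simps)
    next
      case 6 then show ?thesis using t0 t1 c2 m(6) th_simps by (simp add: theta_simps)
    qed
    moreover have "a = 0 \<or> a = 1 \<or> a = 2 \<or> a = 3" using fa(2) by linarith
    ultimately show ?thesis by (elim disjE) simp_all
  qed
  show ?thesis
    by (rule exI[of _ c], rule exI[of _ \<mu>], rule exI[of _ e])
      (intro conjI allI impI c_pos \<mu>_pos e_pos scaled)
qed

section \<open>Equal spacing and determination of all coordinates\<close>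

lemma coordinates_determined:
  "\<exists>c \<mu> k l. (\<forall>a<4. c a > 0) \<and> (\<forall>f<6. \<mu> f > 0) \<and> k > 0 \<and> l > 0 \<and>
    (\<forall>f<6. \<forall>a<4. c a * th f a = \<mu> f * theta f a) \<and>
    (\<forall>f<6. l * r f = \<mu> f * time_ext 2 f) \<and>
    (\<forall>s<N. k * sg s = c (s mod 4) * (2 * real (s div 2))) \<and>
    (\<forall>s<N. l * rh s = c (s mod 4) * time_val 2 s)"
proof -
  obtain c \<mu> e where c: "\<And>a. a < 4 \<Longrightarrow> c a > 0" and \<mu>: "\<And>f. f < 6 \<Longrightarrow> \<mu> f > 0" and e: "e > 0"
    and th: "\<And>f a. f < 6 \<Longrightarrow> a < 4 \<Longrightarrow>
      c a * th f a = \<mu> f * (if (f = 2 \<or> f = 3) \<and> odd a then e else 1) * theta f a"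
    using theta_scaling by metis
  define R where "R f = r f / \<mu> f" for f
  have R: "R 0 > 0" "R 1 = 0" "R 2 = 0" "R 3 > 0" "R 4 > 0" "R 5 = 0"
    using r_simps \<mu> by (simp_all add: R_def)
  define q where "q A a = A a / c a" for A :: "nat \<Rightarrow> real" and a
  have ext: "sgn ((\<Sum>a<4. q A a * (if (f = 2 \<or> f = 3) \<and> odd a then e else 1) * theta f a) + C * R f)
      = sgn (time_ext t f)" if T: "time_functional t A B C" and f: "f < 6" for t A B C f
  proof -
    have "A a * th f a = \<mu> f * (q A a * (if (f = 2 \<or> f = 3) \<and> odd a then e else 1) * theta f a)"
      if "a < 4" for a
    proof -
      have "A a * th f a = q A a * (c a * th f a)" using c[OF that] by (simp add: q_def)
      also have "\<dots> = \<mu> f * (q A a * (if (f = 2 \<or> f = 3) \<and> odd a then e else 1) * theta f a)"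
        unfolding th[OF f that] by simp
      finally show ?thesis .
    qed
    then have "(\<Sum>a<4. A a * th f a) + C * r f = \<mu> f * ((\<Sum>a<4. q A a *
        (if (f = 2 \<or> f = 3) \<and> odd a then e else 1) * theta f a) + C * R f)"
      using \<mu>[OF f] by (simp add: R_def distrib_left sum_distrib_left)
    moreover have "sgn ((\<Sum>a<4. A a * th f a) + C * r f) = sgn (time_ext t f)"
      using T f by (simp add: time_functional_def)
    ultimately show ?thesis using \<mu>[OF f] by (simp add: sgn_mult)
  qed
  \<comment> \<open>The waves relative to the base functional \<open>rh\<close>, which stands for
    time 2; accordingly both turn out to be 0 at times congruent to 2.\<close>
  define y where "y A C = (q A 2 - q A 0) / C" for A :: "nat \<Rightarrow> real" and C :: real
  define z where "z A C = (q A 3 - q A 1) / C" for A :: "nat \<Rightarrow> real" and C :: real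
  \<comment> \<open>Sides 0 and 1 are opposite and R 1 = 0, so their values add up to C * R 0. Both
    are nonnegative and at every time one of them is positive.\<close>
  have C_pos: "C > 0" if T: "time_functional t A B C" for t A B C
  proof -
    have U: "sgn (- q A 0 - q A 1 + q A 2 + q A 3 + C * R 0) = sgn (time_ext t 0)"
      "sgn (q A 0 + q A 1 - q A 2 - q A 3) = sgn (time_ext t 1)"
      using ext[OF T, of 0] ext[OF T, of 1] R by (simp_all add: sum_less_4 theta_simps)
    have "time_ext t 0 \<ge> 0" "time_ext t 1 \<ge> 0" "time_ext t 0 + time_ext t 1 > 0"
      using mod_4_cases[of t] by (auto simp: time_ext_simps)
    then have "C * R 0 > 0" using U
      by (smt (verit) sgn_if)
    then show ?thesis using R by (simp add: zero_less_mult_iff)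
  qed
  have wave: "sgn (y A C + z A C + R 0) = sgn (time_ext t 0)"
      "sgn (- y A C - z A C) = sgn (time_ext t 1)"
      "sgn (- y A C + e * z A C) = sgn (time_ext t 2)"
      "sgn (y A C - e * z A C + R 3) = sgn (time_ext t 3)"
      "sgn (y A C + R 4) = sgn (time_ext t 4)"
      "sgn (z A C) = sgn (time_ext t 5)"
    if T: "time_functional t A B C" for t A B C
  proof -
    have C: "C > 0" using C_pos[OF T] .
    have sgn_C: "sgn (C * w) = sgn w" for w using C by (simp add: sgn_mult)
    have yC: "q A 2 = q A 0 + C * y A C" and zC: "q A 3 = q A 1 + C * z A C"
      using C by (simp_all add: y_def z_def)
    have "sgn (C * (y A C + z A C + R 0)) = sgn (time_ext t 0)"
      using ext[OF T, of 0] R by (simp add: sum_less_4 theta_simps yC zC algebra_simps)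
    then show "sgn (y A C + z A C + R 0) = sgn (time_ext t 0)" unfolding sgn_C .
    have "sgn (C * (- y A C - z A C)) = sgn (time_ext t 1)"
      using ext[OF T, of 1] R by (simp add: sum_less_4 theta_simps yC zC algebra_simps)
    then show "sgn (- y A C - z A C) = sgn (time_ext t 1)" unfolding sgn_C .
    have "sgn (C * (- y A C + e * z A C)) = sgn (time_ext t 2)"
      using ext[OF T, of 2] R by (simp add: sum_less_4 theta_simps yC zC algebra_simps)
    then show "sgn (- y A C + e * z A C) = sgn (time_ext t 2)" unfolding sgn_C .
    have "sgn (C * (y A C - e * z A C + R 3)) = sgn (time_ext t 3)"
      using ext[OF T, of 3] R by (simp add: sum_less_4 theta_simps yC zC algebra_simps)
    then show "sgn (y A C - e * z A C + R 3) = sgn (time_ext t 3)" unfolding sgn_C .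
    have "sgn (C * (y A C + R 4)) = sgn (time_ext t 4)"
      using ext[OF T, of 4] R by (simp add: sum_less_4 theta_simps yC zC algebra_simps)
    then show "sgn (y A C + R 4) = sgn (time_ext t 4)" unfolding sgn_C .
    have "sgn (C * (z A C)) = sgn (time_ext t 5)"
      using ext[OF T, of 5] R by (simp add: sum_less_4 theta_simps yC zC algebra_simps)
    then show "sgn (z A C) = sgn (time_ext t 5)" unfolding sgn_C .
  qed
  \<comment> \<open>At each of the next three corners two sides and a diagonal meet. Following the
    path from time 2 to time 5 crosses sides of slope 1 and sides of slope depending on
    \<open>e\<close>; the diagonal met at times 3 and 5 is the same, and this forces e^2 =
    1.\<close>
  obtain A3 B3 C3 where T3: "time_functional 3 A3 B3 C3" using ex_time_functional by blast
  obtain A4 B4 C4 where T4: "time_functional 4 A4 B4 C4" using ex_time_functional by blast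
  obtain A5 B5 C5 where T5: "time_functional 5 A5 B5 C5" using ex_time_functional by blast
  have 3: "y A3 C3 + z A3 C3 = 0" "y A3 C3 - e * z A3 C3 + R 3 = 0" "y A3 C3 = - R 4"
    using wave(2,4,5)[OF T3] by (simp_all add: time_ext_simps sgn_0_0)
  have 4: "y A4 C4 + z A4 C4 + R 0 = 0" "y A4 C4 - e * z A4 C4 + R 3 = 0" "z A4 C4 = 0"
    using wave(1,4,6)[OF T4] by (simp_all add: time_ext_simps sgn_0_0)
  have 5: "y A5 C5 + z A5 C5 + R 0 = 0" "y A5 C5 = e * z A5 C5" "y A5 C5 = - R 4"
    using wave(1,3,5)[OF T5] by (simp_all add: time_ext_simps sgn_0_0)
  have R3: "R 3 = R 4 + e * R 4" using 3 by (simp add: algebra_simps)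
  have R0: "R 0 = R 3" using 4 by simp
  have "z A5 C5 = R 4 - R 0" using 5 by simp
  then have "e * (R 4 - R 0) = - R 4" using 5 by simp
  then have "R 4 * (e * e) = R 4 * 1" unfolding R0 R3 by (simp add: algebra_simps)
  then have "e * e = 1" using R(5) by (metis mult_cancel_left less_irrefl)
  then have e1: "e = 1" using e by (metis abs_of_pos abs_square_eq_1 power2_eq_square)
  have R03: "R 0 = 2 * R 4" "R 3 = 2 * R 4" using R0 R3 e1 by simp_all
  have yz: "y A C = (if t mod 4 = 2 then 0 else if t mod 4 = 0 then - 2 * R 4 else - R 4) \<and>
      z A C = (if t mod 4 = 3 then R 4 else if t mod 4 = 1 then - R 4 else 0)"
    if T: "time_functional t A B C" for t A B C
    using mod_4_cases[of t]
  proof (elim disjE)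
    assume t: "t mod 4 = 0"
    with wave(1,6)[OF T] show ?thesis by (simp add: time_ext_simps sgn_0_0 R03)
  next
    assume t: "t mod 4 = 1"
    with wave(3,5)[OF T] show ?thesis by (simp add: time_ext_simps sgn_0_0 e1)
  next
    assume t: "t mod 4 = 2"
    with wave(2,6)[OF T] show ?thesis by (simp add: time_ext_simps sgn_0_0)
  next
    assume t: "t mod 4 = 3"
    with wave(2,5)[OF T] show ?thesis by (simp add: time_ext_simps sgn_0_0)
  qed
  \<comment> \<open>In these scales a contact of time t with the point s reads G t (s mod 4) + b t *
    S s + H s = 0.\<close>
  define S where "S s = sg s / c (s mod 4)" for s
  define H where "H s = rh s / c (s mod 4)" for s
  obtain AA BB CC where TT: "\<And>t. time_functional t (AA t) (BB t) (CC t)"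
    using ex_time_functional by metis
  define G where "G t a = AA t a / c a / CC t" for t a
  define b where "b t = BB t / CC t" for t
  have contact: "G t (s mod 4) = - b t * S s - H s" if "s < N" "s \<le> t + 2" "t \<le> s + 2" for s t
  proof -
    have "AA t (s mod 4) = - (BB t * sg s) - CC t * rh s"
      using time_functional_contact[OF TT that] by linarith
    then show ?thesis
      using C_pos[OF TT[of t]] c[of "s mod 4"] by (simp add: G_def b_def S_def H_def field_simps)
  qed
  have Gy: "G t 2 - G t 0 = (if t mod 4 = 2 then 0 else if t mod 4 = 0 then - 2 * R 4 else - R 4)"
    and Gz: "G t 3 - G t 1 = (if t mod 4 = 3 then R 4 else if t mod 4 = 1 then - R 4 else 0)" for t
    using yz[OF TT[of t]] by (simp_all add: y_def z_def q_def G_def diff_divide_distrib)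
  \<comment> \<open>Both times t and t + 1 touch both points s and s + 2. Combining the four contact
    equations eliminates H and leaves the change of one wave, up to sign, during a time step in
    which it does not bend; this is R 4 in every case.\<close>
  have incr: "(b t - b (t + 1)) * (S (s + 2) - S s) = R 4"
    if s: "s = t \<or> t = s + 1" and N: "s + 2 < N" for s t
  proof -
    have g: "G t (s mod 4) = - b t * S s - H s"
      "G (t+1) (s mod 4) = - b (t+1) * S s - H s"
      "G t ((s+2) mod 4) = - b t * S (s+2) - H (s+2)"
      "G (t+1) ((s+2) mod 4) = - b (t+1) * S (s+2) - H (s+2)"
      by (rule contact; use s N in linarith)+
    have "(b t - b (t + 1)) * (S (s + 2) - S s) =
      (G (t+1) ((s+2) mod 4) - G (t+1) (s mod 4)) - (G t ((s+2) mod 4) - G t (s mod 4))"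
      unfolding g by algebra
    also have "\<dots> = R 4"
      using mod_4_cases[of s]
    proof (elim disjE)
      assume s4: "s mod 4 = 0"
      note s2 = mod_4_add(5)[OF s4]
      from s show ?thesis
      proof
        assume t: "s = t"
        then have t1: "t mod 4 = 0" using s4 by simp
        show ?thesis unfolding s4 s2 using Gy[of t] Gy[of "t+1"] unfolding t1 mod_4_add(1)[OF t1] by simp
      next
        assume t: "t = s + 1"
        then have t1: "t mod 4 = 1" using mod_4_add(1)[OF s4] by simp
        show ?thesis unfolding s4 s2 using Gy[of t] Gy[of "t+1"] unfolding t1 mod_4_add(2)[OF t1] by simp
      qed
      next
      assume s4: "s mod 4 = 1"
      note s2 = mod_4_add(6)[OF s4]
      from s show ?thesis
      proof
        assume t: "s = t"
        then have t1: "t mod 4 = 1" using s4 by simp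
        show ?thesis unfolding s4 s2 using Gz[of t] Gz[of "t+1"] unfolding t1 mod_4_add(2)[OF t1] by simp
      next
        assume t: "t = s + 1"
        then have t1: "t mod 4 = 2" using mod_4_add(2)[OF s4] by simp
        show ?thesis unfolding s4 s2 using Gz[of t] Gz[of "t+1"] unfolding t1 mod_4_add(3)[OF t1] by simp
      qed
      next
      assume s4: "s mod 4 = 2"
      note s2 = mod_4_add(7)[OF s4]
      from s show ?thesis
      proof
        assume t: "s = t"
        then have t1: "t mod 4 = 2" using s4 by simp
        show ?thesis unfolding s4 s2 using Gy[of t] Gy[of "t+1"] unfolding t1 mod_4_add(3)[OF t1] by simp
      next
        assume t: "t = s + 1"
        then have t1: "t mod 4 = 3" using mod_4_add(3)[OF s4] by simp
        show ?thesis unfolding s4 s2 using Gy[of t] Gy[of "t+1"] unfolding t1 mod_4_add(4)[OF t1] by simp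
      qed
      next
      assume s4: "s mod 4 = 3"
      note s2 = mod_4_add(8)[OF s4]
      from s show ?thesis
      proof
        assume t: "s = t"
        then have t1: "t mod 4 = 3" using s4 by simp
        show ?thesis unfolding s4 s2 using Gz[of t] Gz[of "t+1"] unfolding t1 mod_4_add(4)[OF t1] by simp
      next
        assume t: "t = s + 1"
        then have t1: "t mod 4 = 0" using mod_4_add(4)[OF s4] by simp
        show ?thesis unfolding s4 s2 using Gz[of t] Gz[of "t+1"] unfolding t1 mod_4_add(1)[OF t1] by simp
      qed
    qed
    finally show ?thesis .
  qed
  define \<delta> where "\<delta> = S 2"
  have \<delta>: "\<delta> > 0" using sg_simps(3)[of 2] c N_ge by (simp add: \<delta>_def S_def)
  have S01: "S 0 = 0" "S (Suc 0) = 0" by (simp_all add: S_def sg_simps)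
  \<comment> \<open>The time step starting at \<open>Suc s\<close> is shared by the gap from s to s
    + 2 and the gap from s + 1 to s + 3. Both have the same product with the same slope change,
    which is nonzero since R 4 is positive.\<close>
  have step: "S (s + 2) - S s = \<delta>" if "s + 2 < N" for s
    using that
  proof (induction s)
    case 0 then show ?case using S01 by (simp add: \<delta>_def numeral_2_eq_2)
  next
    case (Suc s)
    have "(b (Suc s) - b (Suc s + 1)) * (S (Suc s + 2) - S (Suc s)) = R 4"
      "(b (Suc s) - b (Suc s + 1)) * (S (s + 2) - S s) = R 4"
      by (rule incr; use Suc.prems in linarith)+
    then have "(b (Suc s) - b (Suc s + 1)) * (S (Suc s + 2) - S (Suc s)) =
      (b (Suc s) - b (Suc s + 1)) * (S (s + 2) - S s)" "b (Suc s) - b (Suc s + 1) \<noteq> 0"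
      using R(5) by auto
    then have "S (Suc s + 2) - S (Suc s) = S (s + 2) - S s" by (metis mult_cancel_left)
    then show ?case using Suc by simp
  qed
  have S: "S s = \<delta> * real (s div 2)" if "s < N" for s
    using that
  proof (induction s rule: less_induct)
    case (less s)
    show ?case
    proof (cases "s < 2")
      case True
      then have "s = 0 \<or> s = 1" by linarith
      then show ?thesis using S01 by auto
    next
      case False
      then obtain u where u: "s = u + 2" by (metis add.commute le_Suc_ex not_less)
      then have "S u = \<delta> * real (u div 2)" using less by simp
      then show ?thesis using step[of u] less.prems u by (simp add: algebra_simps)
    qed
  qed
  have b2: "b 2 = 0"
  proof -
    have "G 2 0 = - b 2 * S 0 - H 0" "G 2 0 = - b 2 * S 4 - H 4"
      using contact[of 0 2] contact[of 4 2] N_ge by simp_all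
    moreover have "H 0 = 0" "H 4 = 0" by (simp_all add: H_def rh_simps)
    moreover have "S 4 > 0" using S[of 4] N_ge \<delta> by simp
    ultimately show ?thesis using S01 by simp
  qed
  have bt: "b (t + 2) = - real t * (R 4 / \<delta>)" if "t + 4 < N" for t
    using that
  proof (induction t)
    case 0 then show ?case using b2 by (simp add: numeral_2_eq_2)
  next
    case (Suc t)
    have "(b (t + 2) - b (t + 2 + 1)) * \<delta> = R 4"
      using incr[of "t+2" "t+2"] step[of "t+2"] Suc.prems by simp
    then have "b (t + 2 + 1) = b (t + 2) - R 4 / \<delta>" using \<delta> by (simp add: field_simps)
    then show ?case using Suc by (simp add: algebra_simps diff_divide_distrib)
  qed
  \<comment> \<open>Time s + 2 touches s and s + 4, which lie in one fibre, so the unknown fibre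
    value cancels.\<close>
  have H_step: "H (s + 4) = H s + 2 * R 4 * real s" if "s + 4 < N" for s
  proof -
    have "G (s+2) (s mod 4) = - b (s+2) * S s - H s"
      "G (s+2) ((s+4) mod 4) = - b (s+2) * S (s+4) - H (s+4)"
      by (rule contact; use that in linarith)+
    then have "- b (s+2) * S s - H s = - b (s+2) * S (s+4) - H (s+4)" by simp
    then have "H (s+4) = H s - b (s+2) * (S (s+4) - S s)" by (simp add: right_diff_distrib)
    moreover have "S (s+4) - S s = 2 * \<delta>"
    proof -
      have "s + 2 + 2 = s + 4" by simp
      moreover have "S (s + 2) - S s = \<delta>" "S (s + 2 + 2) - S (s + 2) = \<delta>"
        by (rule step; use that in linarith)+
      ultimately show ?thesis by (simp only:)
    qed
    ultimately show ?thesis using bt[OF that] \<delta> by simp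
  qed
  have H: "4 / R 4 * H s = time_val 2 s" if "s < N" for s
    using that
  proof (induction s rule: less_induct)
    case (less s)
    show ?case
    proof (cases "s < 4")
      case True
      then show ?thesis by (simp add: H_def rh_simps time_val_eq_0_iff)
    next
      case False
      then obtain u where u: "s = u + 4" by (metis add.commute le_Suc_ex not_less)
      then have "4 / R 4 * H u = time_val 2 u" using less by simp
      moreover have "4 / R 4 * H s = 4 / R 4 * H u + 8 * real u"
        using H_step[of u] less.prems u R(5) by (simp add: field_simps)
      ultimately show ?thesis unfolding u time_val_2_add_4 by simp
    qed
  qed
  show ?thesis
  \<comment> \<open>The gap between s and s + 2 is normalized from \<delta> to 2, and R 4 to its
    original value \<open>time_ext 2 4\<close> = 4.\<close>
  proof (rule exI[of _ c], rule exI[of _ \<mu>], rule exI[of _ "2 / \<delta>"], rule exI[of _ "4 / R 4"],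
      intro conjI allI impI)
    show "2 / \<delta> > 0" using \<delta> by simp
    show "4 / R 4 > 0" using R by simp
    show "c a * th f a = \<mu> f * theta f a" if "f < 6" "a < 4" for f a
      using th[OF that] e1 by simp
    show "4 / R 4 * r f = \<mu> f * time_ext 2 f" if f: "f < 6" for f
    proof -
      have "4 / R 4 * r f = \<mu> f * (4 / R 4 * R f)" using \<mu>[OF f] by (simp add: R_def)
      moreover have "4 / R 4 * R f = time_ext 2 f"
      proof -
        consider "f = 0" | "f = 1" | "f = 2" | "f = 3" | "f = 4" | "f = 5" using f by linarith
        then show ?thesis using R R03 by cases (simp_all add: time_ext_simps)
      qed
      ultimately show ?thesis by (simp only:)
    qed
    show "2 / \<delta> * sg s = c (s mod 4) * (2 * real (s div 2))" if s: "s < N" for s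
      using S[OF s] c[of "s mod 4"] \<delta> by (simp add: S_def field_simps)
    show "4 / R 4 * rh s = c (s mod 4) * time_val 2 s" if s: "s < N" for s
      using H[OF s] c[of "s mod 4"] R(5) by (simp add: H_def field_simps)
    show "c a > 0" if "a < 4" for a using c[OF that] .
    show "\<mu> f > 0" if "f < 6" for f using \<mu>[OF that] .
  qed
qed

end

section \<open>The configuration and its realizations\<close>

datatype vx = Long nat | Pos nat | Neg nat | Apex nat

text \<open>
  Coordinates \<open>0,\<dots>,3\<close> belong to the simplex, \<open>4\<close> to the progression, \<open>5,\<dots>,10\<close> are the Lawrence
  coordinates, and \<open>10 + k\<close> is the coordinate of the apex \<open>k \<ge> 1\<close>; the apex \<open>0\<close> is the origin. The
  difference of \<open>Pos f\<close> and \<open>Neg f\<close> is the exterior vector \<open>theta f\<close>.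
\<close>

fun coord :: "vx \<Rightarrow> nat \<Rightarrow> real" where
  "coord (Long s) i = (if i = s mod 4 then 1 else if i = 4 then real s else 0)"
| "coord (Pos f) i = (if i < 4 then (if f < 4 then theta f i else if i = f - 2 then 1 else 0)
    else if i = 5 + f then 1 else 0)"
| "coord (Neg f) i = (if i < 4 then (if f < 4 then 0 else if i = f - 4 then 1 else 0)
    else if i = 5 + f then 1 else 0)"
| "coord (Apex k) i = (if k > 0 \<and> i = 10 + k then 1 else 0)"

fun nrm :: "vx \<Rightarrow> real" where
  "nrm (Long s) = 1 + (real s)\<^sup>2"
| "nrm (Pos f) = (if f < 4 then 5 else 2)"
| "nrm (Neg f) = (if f < 4 then 1 else 2)"
| "nrm (Apex k) = (if k = 0 then 0 else 1)"

definition Idx :: "nat \<Rightarrow> nat \<Rightarrow> vx set" where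
  "Idx N K = Long ` {..<N} \<union> Pos ` {..<6} \<union> Neg ` {..<6} \<union> Apex ` {..K}"

lemma Idx_cases:
  assumes "v \<in> Idx N K"
  obtains s where "v = Long s" "s < N" | f where "v = Pos f" "f < 6"
    | f where "v = Neg f" "f < 6" | k where "v = Apex k" "k \<le> K"
  using assms unfolding Idx_def by blast

lemma in_Idx [simp]:
  "Long s \<in> Idx N K \<longleftrightarrow> s < N" "Pos f \<in> Idx N K \<longleftrightarrow> f < 6" "Neg f \<in> Idx N K \<longleftrightarrow> f < 6"
  "Apex k \<in> Idx N K \<longleftrightarrow> k \<le> K"
  by (auto simp: Idx_def)

lemma finite_Idx: "finite (Idx N K)"
  by (simp add: Idx_def)

lemma card_Idx: "card (Idx N K) = N + 13 + K"
proof -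
  have inj: "inj_on Long A" "inj_on Pos A" "inj_on Neg A" "inj_on Apex A" for A
    by (auto simp: inj_on_def)
  have "card (Idx N K) = card (Long ` {..<N}) + card (Pos ` {..<6::nat}) + card (Neg ` {..<6::nat})
      + card (Apex ` {..K})"
    unfolding Idx_def by (subst card_Un_disjoint; (simp; blast)?)+
  then show ?thesis by (simp add: card_image inj)
qed

section \<open>Evaluation of linear forms on the configuration\<close>

lemma sum_restrict_less:
  fixes g :: "nat \<Rightarrow> real"
  assumes "m \<le> n"
  shows "(\<Sum>i<n. if i < m then g i else 0) = (\<Sum>i<m. g i)"
proof -
  have "(\<Sum>i<n. if i < m then g i else 0) = (\<Sum>i\<in>{..<n} \<inter> {i. i < m}. g i)"
    by (simp add: sum.inter_restrict)
  also have "{..<n} \<inter> {i. i < m} = {..<m}" using assms by auto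
  finally show ?thesis .
qed

lemma sum_coord_Long: "(\<Sum>i<11 + K. \<beta> i * coord (Long s) i) = \<beta> (s mod 4) + \<beta> 4 * real s"
proof -
  have "s mod 4 < 4" by simp
  then have ne: "s mod 4 \<noteq> 4" "s mod 4 < 11 + K" by linarith+
  have "(\<Sum>i<11 + K. \<beta> i * coord (Long s) i) =
      (\<Sum>i<11 + K. (if i = s mod 4 then \<beta> i else 0) + (if i = 4 then \<beta> i * real s else 0))"
    using ne(1) by (intro sum.cong) auto
  then show ?thesis using ne(2) by (simp add: sum.distrib)
qed

lemma sum_coord_Pos:
  assumes "f < 6"
  shows "(\<Sum>i<11 + K. \<beta> i * coord (Pos f) i) =
    (if f < 4 then \<Sum>a<4. \<beta> a * theta f a else \<beta> (f - 2)) + \<beta> (5 + f)"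
proof -
  have "(\<Sum>i<11 + K. \<beta> i * coord (Pos f) i) =
      (\<Sum>i<11 + K. (if i < 4 then \<beta> i * (if f < 4 then theta f i else if i = f - 2 then 1 else 0) else 0)
        + (if i = 5 + f then \<beta> i else 0))"
    by (intro sum.cong) auto
  also have "\<dots> = (\<Sum>i<4. \<beta> i * (if f < 4 then theta f i else if i = f - 2 then 1 else 0)) + \<beta> (5 + f)"
    using assms by (simp add: sum.distrib sum_restrict_less)
  also have "(\<Sum>i<4. \<beta> i * (if f < 4 then theta f i else if i = f - 2 then 1 else 0)) =
      (if f < 4 then \<Sum>a<4. \<beta> a * theta f a else \<beta> (f - 2))"
    using assms by (auto simp: if_distrib[of "(*) _"] cong: if_cong)
  finally show ?thesis .
qed

lemma sum_coord_Neg: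
  assumes "f < 6"
  shows "(\<Sum>i<11 + K. \<beta> i * coord (Neg f) i) = (if f < 4 then 0 else \<beta> (f - 4)) + \<beta> (5 + f)"
proof -
  have "(\<Sum>i<11 + K. \<beta> i * coord (Neg f) i) =
      (\<Sum>i<11 + K. (if i < 4 then \<beta> i * (if f < 4 then 0 else if i = f - 4 then 1 else 0) else 0)
        + (if i = 5 + f then \<beta> i else 0))"
    by (intro sum.cong) auto
  also have "\<dots> = (\<Sum>i<4. \<beta> i * (if f < 4 then 0 else if i = f - 4 then 1 else 0)) + \<beta> (5 + f)"
    using assms by (simp add: sum.distrib sum_restrict_less)
  also have "(\<Sum>i<4. \<beta> i * (if f < 4 then 0 else if i = f - 4 then 1 else 0)) =
      (if f < 4 then 0 else \<beta> (f - 4))"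
    using assms by (auto simp: if_distrib[of "(*) _"] cong: if_cong)
  finally show ?thesis .
qed

lemma sum_coord_Apex:
  assumes "k \<le> K"
  shows "(\<Sum>i<11 + K. \<beta> i * coord (Apex k) i) = (if k = 0 then 0 else \<beta> (10 + k))"
proof -
  have "(\<Sum>i<11 + K. \<beta> i * coord (Apex k) i) = (\<Sum>i<11 + K. if i = 10 + k then (if k = 0 then 0 else \<beta> i) else 0)"
    by (intro sum.cong) auto
  then show ?thesis using assms by simp
qed

lemma sum_coord_sq:
  assumes "v \<in> Idx N K"
  shows "(\<Sum>i<11 + K. (coord v i)\<^sup>2) = nrm v"
proof -
  have "(\<Sum>i<11 + K. coord v i * coord v i) = nrm v"
    using assms
  proof (cases rule: Idx_cases)
    case (1 s)
    have "s mod 4 \<noteq> 4" by (simp add: order_less_imp_not_eq)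
    then show ?thesis unfolding 1(1) sum_coord_Long by (simp add: power2_eq_square)
  next
    case (2 f)
    show ?thesis
    proof (cases "f < 4")
      case True
      then consider "f = 0" | "f = 1" | "f = 2" | "f = 3" by linarith
      then have "(\<Sum>a<4. theta f a * theta f a) = 4" by cases (simp_all add: sum_less_4 theta_simps)
      moreover have "(\<Sum>a<4. coord (Pos f) a * theta f a) = (\<Sum>a<4. theta f a * theta f a)"
        using True by (intro sum.cong) auto
      ultimately show ?thesis using True unfolding 2(1) sum_coord_Pos[OF 2(2)] by simp
    next
      case False
      then show ?thesis using 2(2) unfolding 2(1) sum_coord_Pos[OF 2(2)] by auto
    qed
  next
    case (3 f)
    then show ?thesis unfolding 3(1) sum_coord_Neg[OF 3(2)] by auto
  next
    case (4 k)
    then show ?thesis unfolding 4(1) sum_coord_Apex[OF 4(2)] by auto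
  qed
  then show ?thesis by (simp add: power2_eq_square)
qed

lemma nrm_nonneg: "nrm v \<ge> 0"
  by (cases v) auto

text \<open>An affine functional on the lift to the paraboloid, with \<open>nrm v\<close> as height.
  On the sphere it becomes an affine functional up to the positive factor
  \<open>nrm v + 1\<close>.\<close>

definition lin_val :: "nat \<Rightarrow> real \<Rightarrow> real \<Rightarrow> (nat \<Rightarrow> real) \<Rightarrow> vx \<Rightarrow> real" where
  "lin_val K c \<alpha> \<beta> v = c * nrm v + (\<Sum>i<11 + K. \<beta> i * coord v i) + \<alpha>"

text \<open>Inverse stereographic projection, which makes the polytope inscribed.\<close>

definition pt :: "nat \<Rightarrow> vx \<Rightarrow> rseq" where
  "pt K v = (\<Sum>i<12 + K. Poly_Mapping.single i
    (if i < 11 + K then 2 * coord v i / (nrm v + 1) else (nrm v - 1) / (nrm v + 1)))"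

lemma lookup_pt:
  "Poly_Mapping.lookup (pt K v) i = (if i < 11 + K then 2 * coord v i / (nrm v + 1)
    else if i = 11 + K then (nrm v - 1) / (nrm v + 1) else 0)"
proof -
  have "Poly_Mapping.lookup (pt K v) i = (\<Sum>j<12 + K. if j = i then
      (if i < 11 + K then 2 * coord v i / (nrm v + 1) else (nrm v - 1) / (nrm v + 1)) else 0)"
    unfolding pt_def lookup_sum by (rule sum.cong) (auto simp: lookup_single)
  then show ?thesis by (auto simp: not_less)
qed

lemma pt_in_Rn: "pt K v \<in> Rn (12 + K)"
  by (simp add: in_Rn_iff lookup_pt)

text \<open>With n = \<open>nrm v\<close>, write c n + \<alpha> as (c - \<alpha>)/2 times n - 1 plus
  (c + \<alpha>)/2 times n + 1; division by n + 1 turns these into the last coordinate and a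
  constant.\<close>

lemma lin_val_affine:
  "\<exists>(g::rseq \<Rightarrow> real) c'. linear g \<and> (\<forall>v. g (pt K v) + c' = lin_val K c \<alpha> \<beta> v / (nrm v + 1))"
proof -
  define g :: "rseq \<Rightarrow> real" where "g x = (c - \<alpha>) / 2 * Poly_Mapping.lookup x (11 + K)
    + (\<Sum>i<11 + K. \<beta> i / 2 * Poly_Mapping.lookup x i)" for x
  have "linear g"
    by (rule linearI) (simp_all add: g_def lookup_add algebra_simps sum.distrib sum_distrib_left)
  moreover have "g (pt K v) + (c + \<alpha>) / 2 = lin_val K c \<alpha> \<beta> v / (nrm v + 1)" for v
  proof -
    have n: "nrm v + 1 > 0" using nrm_nonneg[of v] by simp
    have "(\<Sum>i<11 + K. \<beta> i / 2 * Poly_Mapping.lookup (pt K v) i)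
        = (\<Sum>i<11 + K. \<beta> i * coord v i) / (nrm v + 1)"
      unfolding sum_divide_distrib by (rule sum.cong) (simp_all add: lookup_pt)
    moreover have "(c - \<alpha>) / 2 * ((nrm v - 1) / (nrm v + 1)) + (c + \<alpha>) / 2 = (c * nrm v + \<alpha>) / (nrm v + 1)"
      using n by (simp add: field_simps)
    ultimately show ?thesis
      unfolding g_def lin_val_def by (simp add: lookup_pt add_divide_distrib)
  qed
  ultimately show ?thesis by blast
qed

text \<open>
  The order makes the matrix of functionals against the vertices \<open>0, 4, 1, 2, 3, 5\<close>, the \<open>Neg f\<close>
  and the apexes triangular.
\<close>

definition basis_seq :: "(nat \<Rightarrow> 'a) \<Rightarrow> 'a \<Rightarrow> 'a \<Rightarrow> (nat \<Rightarrow> 'a) \<Rightarrow> (nat \<Rightarrow> 'a) \<Rightarrow> nat \<Rightarrow> 'a" where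
  "basis_seq t k r q a i = (if i = 0 then t 0 else if i = 1 then k else if i < 5 then t (i - 1)
    else if i = 5 then r else if i < 12 then q (i - 6) else a (i - 12))"

lemma basis_seq_cases:
  fixes i K :: nat
  assumes "i < 13 + K"
  obtains "i = 0" | "i = 1" | a where "i = Suc a" "1 \<le> a" "a < 4" | "i = 5"
    | f where "i = 6 + f" "f < 6" | k where "i = 12 + k" "k \<le> K"
proof -
  consider "i = 0" | "i = 1" | "2 \<le> i" "i < 5" | "i = 5" | "6 \<le> i" "i < 12" | "12 \<le> i" by atomize_elim arith
  then show thesis
  proof cases
    case 3
    then show ?thesis using that(3)[of "i - 1"] by simp
  next
    case 5
    then show ?thesis using that(5)[of "i - 6"] by simp
  next
    case 6
    then show ?thesis using that(6)[of "i - 12"] assms by simp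
  qed (use that in auto)
qed

lemma basis_seq_simps:
  "basis_seq t k r q a 0 = t 0" "basis_seq t k r q a (Suc 0) = k"
  "1 \<le> b \<Longrightarrow> b < 4 \<Longrightarrow> basis_seq t k r q a (Suc b) = t b"
  "basis_seq t k r q a 5 = r" "f < 6 \<Longrightarrow> basis_seq t k r q a (6 + f) = q f"
  "basis_seq t k r q a (12 + j) = a j"
  by (auto simp: basis_seq_def)

lemma basis_seq_apply:
  "basis_seq t k r q a i x = basis_seq (\<lambda>b. t b x) (k x) (r x) (\<lambda>f. q f x) (\<lambda>j. a j x) i"
  by (simp add: basis_seq_def)

text \<open>Applies to long vertices and exterior vectors, on which the pair and apex functionals
  vanish. The shift from b to b + 1 comes from the entry inserted between fibres 0 and 1.\<close>

lemma sum_basis_seq: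
  fixes t :: "nat \<Rightarrow> real"
  assumes "\<And>f. f < 6 \<Longrightarrow> q f = 0" "\<And>j. j \<le> K \<Longrightarrow> a j = 0"
  shows "(\<Sum>i<13 + K. basis_seq t k r q a i * y i) =
    (\<Sum>b<4. (if b = 0 then y 0 else y (b + 1)) * t b) + y 1 * k + y 5 * r"
proof -
  have z: "basis_seq t k r q a i = 0" if "6 \<le> i" "i < 13 + K" for i
    using that assms by (auto simp: basis_seq_def)
  have "(\<Sum>i<13 + K. basis_seq t k r q a i * y i) = (\<Sum>i<6. basis_seq t k r q a i * y i)"
    by (rule sum.mono_neutral_right) (auto simp: z)
  also have "{..<6::nat} = {0,1,2,3,4,5}" by auto
  finally show ?thesis
    by (simp add: basis_seq_def sum_less_4 numeral_eq_Suc mult.commute)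
qed

text \<open>The normal form shared by all realizations. The fibre and time entries of a pair are the
  positive and negative parts of the value on its exterior vector, since these functionals touch at
  least one vertex of the pair.\<close>

fun canon :: "vx \<Rightarrow> nat \<Rightarrow> real" where
  "canon (Long s) = basis_seq (\<lambda>a. if a = s mod 4 then 1 else 0) (2 * real (s div 2)) (time_val 2 s)
    (\<lambda>_. 0) (\<lambda>_. 0)"
| "canon (Pos f) = basis_seq (\<lambda>a. max 0 (theta f a)) 0 (max 0 (time_ext 2 f)) (\<lambda>g. if g = f then 1 else 0) (\<lambda>_. 0)"
| "canon (Neg f) = basis_seq (\<lambda>a. max 0 (- theta f a)) 0 (max 0 (- time_ext 2 f)) (\<lambda>g. if g = f then 1 else 0) (\<lambda>_. 0)"
| "canon (Apex k) = basis_seq (\<lambda>_. 0) 0 0 (\<lambda>_. 0) (\<lambda>j. if j = k then 1 else 0)"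

section \<open>Realizations in homogeneous coordinates\<close>

text \<open>Intended for the homogenized vertices \<open>w v\<close> of an isomorphic polytope in
  dimension 12 + \<open>K\<close>. Of the isomorphism only \<open>transfer\<close> is kept.\<close>

locale realization =
  fixes K N :: nat and w :: "vx \<Rightarrow> rseq"
  assumes N_ge: "N \<ge> 12" and w_in: "\<And>v. v \<in> Idx N K \<Longrightarrow> w v \<in> Rn (13 + K)"
    and transfer: "\<And>c \<alpha> \<beta>. (\<And>v. v \<in> Idx N K \<Longrightarrow> lin_val K c \<alpha> \<beta> v \<ge> 0) \<Longrightarrow>
      \<exists>h::rseq \<Rightarrow> real. linear h \<and> (\<forall>v\<in>Idx N K. sgn (h (w v)) = sgn (lin_val K c \<alpha> \<beta> v))"
begin

definition base_rep :: "real \<Rightarrow> real \<Rightarrow> (nat \<Rightarrow> real) \<Rightarrow> (rseq \<Rightarrow> real) \<Rightarrow> bool" where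
  "base_rep c e b h \<longleftrightarrow> linear h \<and> (\<forall>s<N. sgn (h (w (Long s))) = sgn (long_val c e b s)) \<and>
    (\<forall>f<6. sgn (h (w (Pos f))) = sgn (max 0 (ext_val c b f)) \<and>
      sgn (h (w (Neg f))) = sgn (max 0 (- ext_val c b f))) \<and>
    (\<forall>k\<le>K. h (w (Apex k)) = 0)"

lemma ex_base_rep:
  assumes long: "\<And>s. s < N \<Longrightarrow> long_val c e b s \<ge> 0"
  shows "\<exists>h. base_rep c e b h"
proof -
  define E where "E = ext_val c b"
  \<comment> \<open>Subtracted is the value on \<open>Neg f\<close> apart from the Lawrence
    coordinate. Thus \<open>Neg f\<close> receives the negative part of E f, and
    \<open>Pos f\<close>, which exceeds it by E f, the positive part.\<close>
  define q where "q f = max 0 (- E f) - (if f < 4 then c else c + b (f - 4))" for f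
  \<comment> \<open>The shifts by -c cancel the constant 1 in the squared norms of the long vertices
    and of the apexes other than the origin.\<close>
  define \<beta> where "\<beta> i = (if i < 4 then b i - c else if i = 4 then e else if i < 11 then q (i - 5) else - c)" for i
  have \<beta>: "\<beta> 0 = b 0 - c" "\<beta> (Suc 0) = b 1 - c" "\<beta> 2 = b 2 - c" "\<beta> 3 = b 3 - c" "\<beta> 4 = e"
    "\<And>f. f < 6 \<Longrightarrow> \<beta> (5 + f) = q f" "\<And>k. k > 0 \<Longrightarrow> \<beta> (10 + k) = - c"
    "\<And>s. \<beta> (s mod 4) = b (s mod 4) - c"
    by (simp_all add: \<beta>_def)
  have Long: "lin_val K c 0 \<beta> (Long s) = long_val c e b s" for s
    unfolding lin_val_def sum_coord_Long \<beta> by (simp add: long_val_def algebra_simps)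
  have Pos: "lin_val K c 0 \<beta> (Pos f) = max 0 (E f)" and Neg: "lin_val K c 0 \<beta> (Neg f) = max 0 (- E f)"
    if f: "f < 6" for f
  proof -
    show "lin_val K c 0 \<beta> (Neg f) = max 0 (- E f)"
    proof (cases "f < 4")
      case True
      then show ?thesis unfolding lin_val_def sum_coord_Neg[OF f] \<beta>(6)[OF f] by (simp add: q_def)
    next
      case False
      have "f - 4 < 4" using f by arith
      then have "\<beta> (f - 4) = b (f - 4) - c" by (simp add: \<beta>_def)
      then show ?thesis
        using False unfolding lin_val_def sum_coord_Neg[OF f] \<beta>(6)[OF f] by (simp add: q_def)
    qed
    have "lin_val K c 0 \<beta> (Pos f) = E f + max 0 (- E f)"
    proof (cases "f < 4")
      case True
      have opp: "theta f 2 = - theta f 0" "theta f 3 = - theta f 1"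
        using theta_opposite[OF f] by linarith+
      have "(\<Sum>a<4. \<beta> a * theta f a) = (\<Sum>a<4. b a * theta f a)"
        by (simp add: sum_less_4 \<beta> opp algebra_simps)
      then show ?thesis
        using True unfolding lin_val_def sum_coord_Pos[OF f] \<beta>(6)[OF f]
        by (simp add: q_def E_def ext_val_def theta_sq_def)
    next
      case False
      then have "f = 4 \<or> f = 5" using f by linarith
      then have "E f = b (f - 2) - b (f - 4)"
        by (elim disjE) (simp_all add: E_def ext_val_def theta_sq_def sum_less_4 theta_simps)
      moreover have "f - 2 < 4" using f by arith
      then have "\<beta> (f - 2) = b (f - 2) - c" by (simp add: \<beta>_def)
      ultimately show ?thesis
        using False unfolding lin_val_def sum_coord_Pos[OF f] \<beta>(6)[OF f] by (simp add: q_def)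
    qed
    then show "lin_val K c 0 \<beta> (Pos f) = max 0 (E f)" by simp
  qed
  have Apex: "lin_val K c 0 \<beta> (Apex k) = 0" if "k \<le> K" for k
    unfolding lin_val_def sum_coord_Apex[OF that] using \<beta>(7)[of k] by simp
  have "lin_val K c 0 \<beta> v \<ge> 0" if "v \<in> Idx N K" for v
    using that by (cases rule: Idx_cases) (simp_all add: Long Pos Neg Apex long)
  then obtain h :: "rseq \<Rightarrow> real" where h: "linear h" "\<forall>v\<in>Idx N K. sgn (h (w v)) = sgn (lin_val K c 0 \<beta> v)"
    using transfer[of c 0 \<beta>] by blast
  have "base_rep c e b h"
    unfolding base_rep_def
  proof (intro conjI allI impI)
    show "linear h" by (fact h(1))
    show "sgn (h (w (Long s))) = sgn (long_val c e b s)" if "s < N" for s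
      using h(2)[rule_format, of "Long s"] that by (simp add: Long)
    show "sgn (h (w (Pos f))) = sgn (max 0 (ext_val c b f))" if "f < 6" for f
      using h(2)[rule_format, of "Pos f"] that by (simp add: Pos E_def)
    show "sgn (h (w (Neg f))) = sgn (max 0 (- ext_val c b f))" if "f < 6" for f
      using h(2)[rule_format, of "Neg f"] that by (simp add: Neg E_def)
    show "h (w (Apex k)) = 0" if "k \<le> K" for k
      using h(2)[rule_format, of "Apex k"] that by (simp add: Apex sgn_0_0)
  qed
  then show ?thesis by blast
qed

lemma ex_pair_functional:
  assumes f: "f < 6"
  shows "\<exists>h::rseq \<Rightarrow> real. linear h \<and> (\<forall>v\<in>Idx N K. sgn (h (w v)) = (if v = Pos f \<or> v = Neg f then 1 else 0))"
proof -
  define \<beta> where "\<beta> i = (if i = 5 + f then 1 else 0 :: real)" for i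
  have \<beta>: "\<beta> (s mod 4) = 0" "\<beta> 4 = 0" "\<beta> 0 = 0" "\<beta> (Suc 0) = 0" "\<beta> 2 = 0" "\<beta> 3 = 0" for s
    using mod_less_divisor[of 4 s] by (simp_all add: \<beta>_def)
  have val: "lin_val K 0 0 \<beta> v = (if v = Pos f \<or> v = Neg f then 1 else 0)" if "v \<in> Idx N K" for v
    using that
  proof (cases rule: Idx_cases)
    case (1 s)
    show ?thesis unfolding 1(1) lin_val_def sum_coord_Long \<beta> by simp
  next
    case (2 g)
    have "(\<Sum>a<4. \<beta> a * theta g a) = 0" by (simp add: sum_less_4 \<beta>)
    moreover have "\<not> g < 4 \<Longrightarrow> \<beta> (g - 2) = 0" using 2(2) by (auto simp: \<beta>_def)
    ultimately show ?thesis unfolding 2(1) lin_val_def sum_coord_Pos[OF 2(2)] by (simp add: \<beta>_def)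
  next
    case (3 g)
    have "\<not> g < 4 \<Longrightarrow> \<beta> (g - 4) = 0" using 3(2) by (auto simp: \<beta>_def)
    then show ?thesis unfolding 3(1) lin_val_def sum_coord_Neg[OF 3(2)] by (simp add: \<beta>_def)
  next
    case (4 k)
    then show ?thesis using f unfolding 4(1) lin_val_def sum_coord_Apex[OF 4(2)] by (simp add: \<beta>_def)
  qed
  then obtain h :: "rseq \<Rightarrow> real" where "linear h" "\<forall>v\<in>Idx N K. sgn (h (w v)) = sgn (lin_val K 0 0 \<beta> v)"
    using transfer[of 0 0 \<beta>] by (metis order_refl zero_le_one)
  then show ?thesis using val by (intro exI[of _ h]) auto
qed

lemma ex_apex_functional:
  assumes k: "k \<le> K"
  shows "\<exists>h::rseq \<Rightarrow> real. linear h \<and> (\<forall>v\<in>Idx N K. sgn (h (w v)) = (if v = Apex k then 1 else 0))"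
proof -
  define \<alpha> where "\<alpha> = (if k = 0 then 1 else 0 :: real)"
  \<comment> \<open>For k = 0: every vertex except the origin satisfies x_0 + ... + x_3 + x_5 + ...
    + x_8 + x_11 + ... = 1, which omits the height and the Lawrence coordinates of the two
    diagonals.\<close>
  define \<beta> where "\<beta> i = (if k = 0 then (if i < 4 \<or> 5 \<le> i \<and> i < 9 \<or> 11 \<le> i then -1 else 0)
    else if i = 10 + k then 1 else 0 :: real)" for i
  have \<beta>: "\<And>s. \<beta> (s mod 4) = - \<alpha>" "\<beta> 4 = 0" "\<beta> 0 = - \<alpha>" "\<beta> (Suc 0) = - \<alpha>" "\<beta> 2 = - \<alpha>" "\<beta> 3 = - \<alpha>"
    "\<And>f. f < 6 \<Longrightarrow> \<beta> (5 + f) = (if f < 4 then - \<alpha> else 0)"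
    "\<And>j. j > 0 \<Longrightarrow> \<beta> (10 + j) = (if k = 0 then -1 else if j = k then 1 else 0)"
    by (auto simp: \<beta>_def \<alpha>_def)
  have val: "lin_val K 0 \<alpha> \<beta> v = (if v = Apex k then 1 else 0)" if "v \<in> Idx N K" for v
    using that
  proof (cases rule: Idx_cases)
    case (1 s)
    show ?thesis unfolding 1(1) lin_val_def sum_coord_Long \<beta> by simp
  next
    case (2 f)
    have opp: "theta f 2 = - theta f 0" "theta f 3 = - theta f 1"
      using theta_opposite[OF 2(2)] by linarith+
    have "(\<Sum>a<4. \<beta> a * theta f a) = 0" by (simp add: sum_less_4 \<beta> opp)
    moreover have "\<not> f < 4 \<Longrightarrow> \<beta> (f - 2) = - \<alpha>" using 2(2) by (auto simp: \<beta>_def \<alpha>_def)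
    ultimately show ?thesis unfolding 2(1) lin_val_def sum_coord_Pos[OF 2(2)] \<beta>(7)[OF 2(2)] by simp
  next
    case (3 f)
    have "\<not> f < 4 \<Longrightarrow> \<beta> (f - 4) = - \<alpha>" using 3(2) by (auto simp: \<beta>_def \<alpha>_def)
    then show ?thesis unfolding 3(1) lin_val_def sum_coord_Neg[OF 3(2)] \<beta>(7)[OF 3(2)] by simp
  next
    case (4 j)
    then show ?thesis unfolding 4(1) lin_val_def sum_coord_Apex[OF 4(2)] using \<beta>(8)[of j]
      by (auto simp: \<alpha>_def)
  qed
  then obtain h :: "rseq \<Rightarrow> real" where "linear h" "\<forall>v\<in>Idx N K. sgn (h (w v)) = sgn (lin_val K 0 \<alpha> \<beta> v)"
    using transfer[of 0 \<alpha> \<beta>] by (metis order_refl zero_le_one)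
  then show ?thesis using val by (intro exI[of _ h]) auto
qed

section \<open>Normal form of a realization\<close>

text \<open>The table \<open>canon\<close> does not mention \<open>w\<close>, so any two
  realizations can be compared through their functionals \<open>F\<close>. The clause on spans
  yields the dimension of the polytope.\<close>

theorem rigid:
  "\<exists>F u lam. dual_basis (13 + K) F u \<and> Rn (13 + K) \<subseteq> span (w ` Idx N K) \<and>
    (\<forall>v\<in>Idx N K. lam v > 0 \<and> (\<forall>i<13 + K. F i (w v) = lam v * canon v i))"
proof -
  have "\<exists>h. base_rep 0 0 (\<lambda>b. if b = a then 1 else 0) h" for a
    by (rule ex_base_rep) (simp add: long_val_def)
  then obtain tau where tau: "\<And>a. base_rep 0 0 (\<lambda>b. if b = a then 1 else 0) (tau a)" by metis
  obtain kap where kap: "base_rep 0 1 kap_coeff kap"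
    using ex_base_rep[of 0 1 kap_coeff] by (auto simp: kap_val)
  have t2: "time_val 2 = long_val 1 (- 2 * real 2) (time_coeff 2)" by (rule time_val_def)
  obtain rho where rho: "base_rep 1 (- 2 * real 2) (time_coeff 2) rho"
    using ex_base_rep[of 1 "- 2 * real 2" "time_coeff 2"] time_val_nonneg[of 2]
    unfolding t2[symmetric] by blast
  have "\<forall>f. \<exists>h::rseq \<Rightarrow> real. f < 6 \<longrightarrow> linear h \<and>
      (\<forall>v\<in>Idx N K. sgn (h (w v)) = (if v = Pos f \<or> v = Neg f then 1 else 0))"
    using ex_pair_functional by blast
  then obtain om :: "nat \<Rightarrow> rseq \<Rightarrow> real" where om: "\<And>f. f < 6 \<Longrightarrow> linear (om f)"
      "\<And>f v. f < 6 \<Longrightarrow> v \<in> Idx N K \<Longrightarrow> sgn (om f (w v)) = (if v = Pos f \<or> v = Neg f then 1 else 0)"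
    by metis
  have "\<forall>k. \<exists>h::rseq \<Rightarrow> real. k \<le> K \<longrightarrow> linear h \<and>
      (\<forall>v\<in>Idx N K. sgn (h (w v)) = (if v = Apex k then 1 else 0))"
    using ex_apex_functional by blast
  then obtain al :: "nat \<Rightarrow> rseq \<Rightarrow> real" where al: "\<And>k. k \<le> K \<Longrightarrow> linear (al k)"
      "\<And>k v. k \<le> K \<Longrightarrow> v \<in> Idx N K \<Longrightarrow> sgn (al k (w v)) = (if v = Apex k then 1 else 0)"
    by metis
  have om0: "om f (w v) = 0" if "f < 6" "v \<in> Idx N K" "v \<noteq> Pos f" "v \<noteq> Neg f" for f v
    using om(2)[OF that(1,2)] that(3,4) by (simp add: sgn_0_0)
  have om1: "om f (w (Pos f)) > 0" "om f (w (Neg f)) > 0" if "f < 6" for f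
    using om(2)[OF that, of "Pos f"] om(2)[OF that, of "Neg f"] that by (simp_all add: sgn_1_pos)
  have al0: "al k (w v) = 0" if "k \<le> K" "v \<in> Idx N K" "v \<noteq> Apex k" for k v
    using al(2)[OF that(1,2)] that(3) by (simp add: sgn_0_0)
  have al1: "al k (w (Apex k)) > 0" if "k \<le> K" for k
    using al(2)[OF that, of "Apex k"] that by (simp add: sgn_1_pos)
  have tau_Long: "tau a (w (Long s)) = 0" if "s < N" "a \<noteq> s mod 4" for a s
    using tau[of a] that by (auto simp: base_rep_def long_val_def sgn_0_0)
  have tau_pos: "tau (s mod 4) (w (Long s)) > 0" if "s < N" for s
  proof -
    have "sgn (tau (s mod 4) (w (Long s))) = 1"
      using tau[of "s mod 4"] that by (simp add: base_rep_def long_val_def)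
    then show ?thesis by (simp add: sgn_1_pos)
  qed
  have sgn_kap: "sgn (kap (w (Long s))) = sgn (long_val 0 1 kap_coeff s)" if "s < N" for s
    using kap that by (simp add: base_rep_def)
  have sgn_rho: "sgn (rho (w (Long s))) = sgn (time_val 2 s)" if "s < N" for s
    using rho that by (simp add: base_rep_def t2)
  have lin: "linear (tau a)" "linear kap" "linear rho" for a
    using tau[of a] kap rho by (simp_all add: base_rep_def)
  have base_Apex: "tau a (w (Apex k)) = 0" "kap (w (Apex k)) = 0" "rho (w (Apex k)) = 0" if "k \<le> K" for a k
    using tau[of a] kap rho that by (simp_all add: base_rep_def)
  define F where "F = basis_seq tau kap rho om al"
  define U where "U = basis_seq (\<lambda>a. w (Long a)) (w (Long 4)) (w (Long 5)) (\<lambda>f. w (Neg f)) (\<lambda>k. w (Apex k))"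
  have kap0: "kap (w (Long 0)) = 0" "kap (w (Long 1)) = 0" "kap (w (Long 4)) > 0"
    using sgn_kap[of 0] sgn_kap[of 1] sgn_kap[of 4] N_ge by (simp_all add: kap_val sgn_0_0 sgn_1_pos)
  have rho0: "rho (w (Long s)) = 0" if "s \<le> 4" for s
    using that sgn_rho[of s] N_ge time_val_eq_0_iff[of 2 s] by (simp add: sgn_0_0)
  have rho5: "rho (w (Long 5)) > 0"
    using sgn_rho[of 5] N_ge time_val_eq_0_iff[of 2 5] time_val_nonneg[of 2 5] by (simp add: sgn_1_pos)
  have U_in: "U i \<in> w ` Idx N K" if "i < 13 + K" for i
    using that N_ge by (cases rule: basis_seq_cases) (auto simp: U_def basis_seq_simps)
  have "\<exists>u. dual_basis (13 + K) F u \<and> (\<forall>i<13 + K. u i \<in> span (U ` {..<13 + K}))"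
  proof (rule dual_basis_triangular)
    fix i assume i: "i < 13 + K"
    show "linear (F i)"
      using i by (cases rule: basis_seq_cases) (simp_all add: F_def basis_seq_simps lin om al)
    show "U i \<in> Rn (13 + K)"
      using i N_ge by (cases rule: basis_seq_cases) (auto simp: U_def basis_seq_simps intro!: w_in)
    show "F i (U i) \<noteq> 0"
      using i
    proof (cases rule: basis_seq_cases)
      case 1
      then show ?thesis using tau_pos[of 0] N_ge by (simp add: F_def U_def basis_seq_simps)
    next
      case 2
      then show ?thesis using kap0 by (simp add: F_def U_def basis_seq_simps)
    next
      case (3 a)
      then show ?thesis using tau_pos[of a] N_ge unfolding 3(1) F_def U_def basis_seq_simps(3)[OF 3(2,3)] by simp
    next
      case 4
      then show ?thesis using rho5 by (simp add: F_def U_def basis_seq_simps)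
    next
      case (5 f)
      then show ?thesis using om1[OF 5(2)] by (simp add: F_def U_def basis_seq_simps)
    next
      case (6 k)
      then show ?thesis using al1[OF 6(2)] by (simp add: F_def U_def basis_seq_simps)
    qed
  next
    fix i j assume ij: "i < j" and j: "j < 13 + K"
    then have i: "i < 13 + K" by simp
    show "F j (U i) = 0"
      using j
    proof (cases rule: basis_seq_cases)
      case 1
      then show ?thesis using ij by simp
    next
      case 2
      then show ?thesis using ij kap0 by (simp add: F_def U_def basis_seq_simps)
    next
      case (3 a)
      have Fj: "F j = tau a" unfolding 3(1) F_def basis_seq_simps(3)[OF 3(2,3)] ..
      from i have "tau a (U i) = 0"
      proof (cases rule: basis_seq_cases)
        case 1
        then show ?thesis using tau_Long[of 0 a] N_ge 3 by (simp add: U_def basis_seq_simps)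
      next
        case 2
        then show ?thesis using tau_Long[of 4 a] N_ge 3 by (simp add: U_def basis_seq_simps)
      next
        case (3 b)
        have "a \<noteq> b mod 4" using 3 ij \<open>j = Suc a\<close> by simp
        then show ?thesis using tau_Long[of b a] N_ge 3(3)
          unfolding 3(1) U_def basis_seq_simps(3)[OF 3(2,3)] by simp
      qed (use ij 3 in auto)
      then show ?thesis unfolding Fj .
    next
      case 4
      have Fj: "F j = rho" unfolding 4(1) F_def basis_seq_simps ..
      from i have "rho (U i) = 0"
      proof (cases rule: basis_seq_cases)
        case (3 b)
        then show ?thesis using rho0[of b] unfolding 3(1) U_def basis_seq_simps(3)[OF 3(2,3)] by simp
      qed (use ij 4 rho0 in \<open>auto simp: U_def basis_seq_simps\<close>)
      then show ?thesis unfolding Fj .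
    next
      case (5 f)
      have Fj: "F j = om f" unfolding 5(1) F_def basis_seq_simps(5)[OF 5(2)] ..
      from i have "om f (U i) = 0"
      proof (cases rule: basis_seq_cases)
        case (3 b)
        then show ?thesis using om0[OF 5(2), of "Long b"] N_ge
          unfolding 3(1) U_def basis_seq_simps(3)[OF 3(2,3)] by simp
      next
        case (5 g)
        then show ?thesis using om0[OF \<open>f < 6\<close>, of "Neg g"] ij \<open>j = 6 + f\<close>
          unfolding 5(1) U_def basis_seq_simps(5)[OF 5(2)] by simp
      qed (use ij 5 N_ge om0[OF 5(2)] in \<open>auto simp: U_def basis_seq_simps\<close>)
      then show ?thesis unfolding Fj .
    next
      case (6 k)
      have Fj: "F j = al k" unfolding 6(1) F_def basis_seq_simps ..
      from i have "al k (U i) = 0"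
      proof (cases rule: basis_seq_cases)
        case (3 b)
        then show ?thesis using al0[OF 6(2), of "Long b"] N_ge
          unfolding 3(1) U_def basis_seq_simps(3)[OF 3(2,3)] by simp
      next
        case (5 g)
        then show ?thesis using al0[OF 6(2), of "Neg g"]
          unfolding 5(1) U_def basis_seq_simps(5)[OF 5(2)] by simp
      next
        case (6 l)
        then show ?thesis using al0[OF \<open>k \<le> K\<close>, of "Apex l"] ij \<open>j = 12 + k\<close>
          unfolding 6(1) U_def basis_seq_simps by simp
      qed (use 6 N_ge al0[OF 6(2)] in \<open>auto simp: U_def basis_seq_simps\<close>)
      then show ?thesis unfolding Fj .
    qed
  qed
  then obtain u where u: "dual_basis (13 + K) F u" and u_span: "\<forall>i<13 + K. u i \<in> span (U ` {..<13 + K})"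
    by blast
  have "span (U ` {..<13 + K}) \<subseteq> span (w ` Idx N K)"
    by (rule span_mono) (use U_in in auto)
  then have u_span': "u i \<in> span (w ` Idx N K)" if "i < 13 + K" for i using u_span that by blast
  have spanning: "Rn (13 + K) \<subseteq> span (w ` Idx N K)"
  proof
    fix x assume "x \<in> Rn (13 + K)"
    then have "x = (\<Sum>i<13 + K. F i x *\<^sub>R u i)" by (rule dual_basisD(4)[OF u])
    also have "\<dots> \<in> span (w ` Idx N K)" by (intro span_sum span_scale u_span') simp
    finally show "x \<in> span (w ` Idx N K)" .
  qed
  \<comment> \<open>Scaled so that the own fibre functional is 1 on a long vertex and the pair
    functional is 1 on both vertices of a pair; hence every pair functional vanishes on the
    difference \<open>W f\<close>.\<close>
  define xx where "xx s = (1 / tau (s mod 4) (w (Long s))) *\<^sub>R w (Long s)" for s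
  define pp where "pp f = (1 / om f (w (Pos f))) *\<^sub>R w (Pos f)" for f
  define qq where "qq f = (1 / om f (w (Neg f))) *\<^sub>R w (Neg f)" for f
  define W where "W f = pp f - qq f" for f
  have xx_in: "xx s \<in> Rn (13 + K)" if "s < N" for s
    unfolding xx_def using that by (intro subspace_scale subspace_Rn w_in) simp
  have W_in: "W f \<in> Rn (13 + K)" if "f < 6" for f
    unfolding W_def pp_def qq_def using that by (intro subspace_scale subspace_diff subspace_Rn w_in) simp_all
  have om_xx: "om f (xx s) = 0" if "f < 6" "s < N" for f s
    unfolding xx_def linear_scale[OF om(1)[OF that(1)]] using om0[OF that(1), of "Long s"] that by simp
  have al_xx: "al k (xx s) = 0" if "k \<le> K" "s < N" for k s
    unfolding xx_def linear_scale[OF al(1)[OF that(1)]] using al0[OF that(1), of "Long s"] that by simp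
  have om_W: "om g (W f) = 0" if "g < 6" "f < 6" for g f
    unfolding W_def pp_def qq_def linear_diff[OF om(1)[OF that(1)]] linear_scale[OF om(1)[OF that(1)]]
    using om0[OF that(1), of "Pos f"] om0[OF that(1), of "Neg f"] om1[OF that(2)] that
    by (cases "f = g") auto
  have al_W: "al k (W f) = 0" if "k \<le> K" "f < 6" for k f
    unfolding W_def pp_def qq_def linear_diff[OF al(1)[OF that(1)]] linear_scale[OF al(1)[OF that(1)]]
    using al0[OF that(1), of "Pos f"] al0[OF that(1), of "Neg f"] that by simp
  have rep_xx: "sgn (h (xx s)) = sgn (long_val c e b s)" if h: "base_rep c e b h" and s: "s < N" for c e b h s
  proof -
    have l: "linear h" using h by (simp add: base_rep_def)
    have "sgn (h (xx s)) = sgn (h (w (Long s)))"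
      unfolding xx_def linear_scale[OF l] using tau_pos[OF s] by (simp add: sgn_mult)
    then show ?thesis using h s by (simp add: base_rep_def)
  qed
  \<comment> \<open>One of the two vertices is always touched, so the value on the difference
    determines both values and its sign is recorded by the faces.\<close>
  have rep_pq: "h (pp f) = max 0 (h (W f))" "h (qq f) = max 0 (- h (W f))"
      "sgn (h (W f)) = sgn (ext_val c b f)" if h: "base_rep c e b h" and f: "f < 6" for c e b h f
  proof -
    have l: "linear h" using h by (simp add: base_rep_def)
    have p: "sgn (h (pp f)) = sgn (max 0 (ext_val c b f))"
      unfolding pp_def linear_scale[OF l] using om1[OF f] h f by (simp add: sgn_mult base_rep_def)
    have q: "sgn (h (qq f)) = sgn (max 0 (- ext_val c b f))"
      unfolding qq_def linear_scale[OF l] using om1[OF f] h f by (simp add: sgn_mult base_rep_def)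
    have W: "h (W f) = h (pp f) - h (qq f)" unfolding W_def by (rule linear_diff[OF l])
    consider "ext_val c b f > 0" | "ext_val c b f = 0" | "ext_val c b f < 0" by linarith
    then have "h (pp f) = max 0 (h (W f)) \<and> h (qq f) = max 0 (- h (W f)) \<and> sgn (h (W f)) = sgn (ext_val c b f)"
    proof cases
      case 1
      then have "h (pp f) > 0" "h (qq f) = 0" using p q by (simp_all add: sgn_1_pos sgn_0_0)
      then show ?thesis using W 1 by simp
    next
      case 2
      then have "h (pp f) = 0" "h (qq f) = 0" using p q by (simp_all add: sgn_0_0)
      then show ?thesis using W 2 by simp
    next
      case 3
      then have "h (pp f) = 0" "h (qq f) > 0" using p q by (simp_all add: sgn_1_pos sgn_0_0)
      then show ?thesis using W 3 by simp
    qed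
    then show "h (pp f) = max 0 (h (W f))" "h (qq f) = max 0 (- h (W f))"
      "sgn (h (W f)) = sgn (ext_val c b f)" by blast+
  qed
  have expand: "h x = (\<Sum>a<4. (if a = 0 then h (u 0) else h (u (a + 1))) * tau a x) + h (u 1) * kap x + h (u 5) * rho x"
    if "linear h" "x \<in> Rn (13 + K)" "\<And>f. f < 6 \<Longrightarrow> om f x = 0" "\<And>k. k \<le> K \<Longrightarrow> al k x = 0" for h x
  proof -
    have "h x = (\<Sum>i<13 + K. F i x * h (u i))" by (rule dual_basis_functional[OF u that(1,2)])
    also have "\<dots> = (\<Sum>i<13 + K. basis_seq (\<lambda>b. tau b x) (kap x) (rho x) (\<lambda>f. om f x) (\<lambda>j. al j x) i * h (u i))"
      unfolding F_def basis_seq_apply ..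
    finally show ?thesis using sum_basis_seq[of "\<lambda>f. om f x" K "\<lambda>j. al j x"] that(3,4) by simp
  qed
  have tau_xx: "tau a (xx s) = (if a = s mod 4 then 1 else 0)" if "s < N" for a s
    unfolding xx_def linear_scale[OF lin(1)] using tau_Long[OF that, of a] tau_pos[OF that] by auto
  \<comment> \<open>The coefficients of \<open>kap_coeff\<close> are equal on fibres 1 and 3, where
    the entries of each row cancel. This is why B does not occur on exterior vectors.\<close>
  have kap_W: "kap (W f) = 0" if "f < 6" for f
  proof -
    have "ext_val 0 kap_coeff f = 0"
      using theta_opposite(2)[OF that] by (simp add: ext_val_def sum_less_4 kap_coeff_def)
    then show ?thesis using rep_pq(3)[OF kap that] by (simp add: sgn_0_0)
  qed
  interpret coords: realization_coordinates N "\<lambda>f a. tau a (W f)" "\<lambda>f. rho (W f)" "\<lambda>s. kap (xx s)" "\<lambda>s. rho (xx s)"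
  proof
    show "12 \<le> N" by (fact N_ge)
    show "sgn (tau a (W f)) = sgn (theta f a)" if "f < 6" "a < 4" for f a
    proof -
      have "(\<Sum>b<4. (if b = a then 1 else 0) * theta f b) = theta f a"
        using that(2) by (simp add: if_distrib[of "\<lambda>x. x * _"] cong: if_cong)
      then show ?thesis using rep_pq(3)[OF tau that(1), of a] by (simp add: ext_val_def)
    qed
    show "sgn (rho (W f)) = sgn (time_ext 2 f)" if "f < 6" for f
      using rep_pq(3)[OF rho that] by (simp add: time_ext_def)
    show "sgn (kap (xx s)) = sgn (long_val 0 1 kap_coeff s)" if "s < N" for s
      by (rule rep_xx[OF kap that])
    show "sgn (rho (xx s)) = sgn (time_val 2 s)" if "s < N" for s
      unfolding t2 by (rule rep_xx[OF rho that])
    fix c e b assume "\<And>s. s < N \<Longrightarrow> long_val c e b s \<ge> 0"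
    then obtain h where h: "base_rep c e b h" using ex_base_rep by blast
    then have l: "linear h" by (simp add: base_rep_def)
    define A where "A a = (if a = 0 then h (u 0) else h (u (a + 1)))" for a :: nat
    have "A (s mod 4) + h (u 1) * kap (xx s) + h (u 5) * rho (xx s) = h (xx s)" if s: "s < N" for s
    proof -
      have "(\<Sum>a<4. A a * tau a (xx s)) = A (s mod 4)"
        by (simp add: tau_xx[OF s] if_distrib[of "(*) _"] cong: if_cong)
      then show ?thesis
        using expand[OF l xx_in[OF s] om_xx[OF _ s] al_xx[OF _ s]] unfolding A_def[symmetric] by simp
    qed
    moreover have "(\<Sum>a<4. A a * tau a (W f)) + h (u 5) * rho (W f) = h (W f)" if f: "f < 6" for f
      using expand[OF l W_in[OF f] om_W[OF _ f] al_W[OF _ f]] kap_W[OF f] unfolding A_def[symmetric] by simp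
    ultimately show "\<exists>A B C. (\<forall>s<N. sgn (A (s mod 4) + B * kap (xx s) + C * rho (xx s)) = sgn (long_val c e b s)) \<and>
        (\<forall>f<6. sgn ((\<Sum>a<4. A a * tau a (W f)) + C * rho (W f)) = sgn (ext_val c b f))"
      using rep_xx[OF h] rep_pq(3)[OF h]
      by (intro exI[of _ A] exI[of _ "h (u 1)"] exI[of _ "h (u 5)"]) simp
  qed
  obtain c \<mu> k l where det: "(\<forall>a<4. c a > 0) \<and> (\<forall>f<6. \<mu> f > 0) \<and> k > 0 \<and> l > 0 \<and>
    (\<forall>f<6. \<forall>a<4. c a * tau a (W f) = \<mu> f * theta f a) \<and>
    (\<forall>f<6. l * rho (W f) = \<mu> f * time_ext 2 f) \<and>
    (\<forall>s<N. k * kap (xx s) = c (s mod 4) * (2 * real (s div 2))) \<and>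
    (\<forall>s<N. l * rho (xx s) = c (s mod 4) * time_val 2 s)"
    using coords.coordinates_determined by (elim exE)
  have c: "c a > 0" if "a < 4" for a using det that by blast
  have \<mu>: "\<mu> f > 0" if "f < 6" for f using det that by blast
  have kl: "k > 0" "l > 0" using det by blast+
  have det_tau: "c a * tau a (W f) = \<mu> f * theta f a" if "f < 6" "a < 4" for f a using det that by blast
  have det_rho: "l * rho (W f) = \<mu> f * time_ext 2 f" if "f < 6" for f using det that by blast
  have det_kap: "k * kap (xx s) = c (s mod 4) * (2 * real (s div 2))" if "s < N" for s
    using det that by blast
  have det_rho_xx: "l * rho (xx s) = c (s mod 4) * time_val 2 s" if "s < N" for s
    using det that by blast
  define sc where "sc = basis_seq c k l \<mu> (\<lambda>_. 1)"
  have sc_pos: "sc i > 0" if "i < 13 + K" for i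
    using that
  proof (cases rule: basis_seq_cases)
    case (3 a)
    then show ?thesis using c[of a] unfolding 3(1) sc_def basis_seq_simps(3)[OF 3(2,3)] by simp
  qed (simp_all add: sc_def basis_seq_simps c \<mu> kl)
  have db: "dual_basis (13 + K) (\<lambda>i x. sc i * F i x) (\<lambda>i. (1 / sc i) *\<^sub>R u i)"
    using dual_basis_rescale[OF u sc_pos] .
  have sF: "sc i * F i x = basis_seq (\<lambda>a. c a * tau a x) (k * kap x) (l * rho x) (\<lambda>f. \<mu> f * om f x) (\<lambda>j. al j x) i" for i x
    by (simp add: sc_def F_def basis_seq_def)
  \<comment> \<open>The value at \<open>v\<close> of the rescaled fibre, pair or apex functional
    whose entry in \<open>canon v\<close> is 1.\<close>
  define lam where "lam v = (case v of Long s \<Rightarrow> c (s mod 4) * tau (s mod 4) (w (Long s))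
    | Pos f \<Rightarrow> \<mu> f * om f (w (Pos f)) | Neg f \<Rightarrow> \<mu> f * om f (w (Neg f)) | Apex k \<Rightarrow> al k (w (Apex k)))" for v
  have eq_seq: "basis_seq t1 k1 r1 q1 a1 i = y * basis_seq t2 k2 r2 q2 a2 i"
    if "i < 13 + K" "\<And>a. a < 4 \<Longrightarrow> t1 a = y * t2 a" "k1 = y * k2" "r1 = y * r2"
      "\<And>f. f < 6 \<Longrightarrow> q1 f = y * q2 f" "\<And>j. j \<le> K \<Longrightarrow> a1 j = y * a2 j" for i y t1 k1 r1 q1 a1 t2 k2 r2 q2 a2
    using that by (auto simp: basis_seq_def)
  have "lam v > 0 \<and> (\<forall>i<13 + K. sc i * F i (w v) = lam v * canon v i)" if v: "v \<in> Idx N K" for v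
    using v
  proof (cases rule: Idx_cases)
    case (1 s)
    have wx: "w (Long s) = tau (s mod 4) (w (Long s)) *\<^sub>R xx s"
      unfolding xx_def using tau_pos[OF 1(2)] by simp
    have "lam v > 0" using tau_pos[OF 1(2)] c[of "s mod 4"] by (simp add: lam_def 1)
    moreover have "sc i * F i (w v) = lam v * canon v i" if i: "i < 13 + K" for i
      unfolding sF 1(1) canon.simps lam_def vx.case
    proof (rule eq_seq[OF i])
      show "c a * tau a (w (Long s)) = c (s mod 4) * tau (s mod 4) (w (Long s)) * (if a = s mod 4 then 1 else 0)" for a
        using tau_Long[OF 1(2), of a] by auto
      have "kap (w (Long s)) = tau (s mod 4) (w (Long s)) * kap (xx s)"
        by (subst wx) (simp add: linear_scale[OF lin(2)])
      then show "k * kap (w (Long s)) = c (s mod 4) * tau (s mod 4) (w (Long s)) * (2 * real (s div 2))"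
        using det_kap[OF 1(2)] by (simp add: mult.left_commute[of k] mult.assoc)
      have "rho (w (Long s)) = tau (s mod 4) (w (Long s)) * rho (xx s)"
        by (subst wx) (simp add: linear_scale[OF lin(3)])
      then show "l * rho (w (Long s)) = c (s mod 4) * tau (s mod 4) (w (Long s)) * time_val 2 s"
        using det_rho_xx[OF 1(2)] by (simp add: mult.left_commute[of l] mult.assoc)
    qed (use om0[of _ "Long s"] al0[of _ "Long s"] 1(2) in auto)
    ultimately show ?thesis by blast
  next
    case (2 f)
    have wx: "w (Pos f) = om f (w (Pos f)) *\<^sub>R pp f"
      unfolding pp_def using om1[OF 2(2)] by simp
    have scal: "h (w (Pos f)) = om f (w (Pos f)) * h (pp f)" if "linear h" for h :: "rseq \<Rightarrow> real"
      by (subst wx) (simp add: linear_scale[OF that])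
    have "lam v > 0" using om1[OF 2(2)] \<mu>[OF 2(2)] by (simp add: lam_def 2)
    moreover have "sc i * F i (w v) = lam v * canon v i" if i: "i < 13 + K" for i
      unfolding sF 2(1) canon.simps lam_def vx.case
    proof (rule eq_seq[OF i])
      show "c a * tau a (w (Pos f)) = \<mu> f * om f (w (Pos f)) * max 0 (theta f a)" if a: "a < 4" for a
      proof -
        have "c a * max 0 (tau a (W f)) = max 0 (c a * tau a (W f))"
          using c[OF a] by (simp add: max_mult_distrib_left)
        also have "\<dots> = \<mu> f * max 0 (theta f a)"
          unfolding det_tau[OF 2(2) a] using \<mu>[OF 2(2)] by (simp add: max_mult_distrib_left)
        finally show ?thesis
          unfolding scal[OF lin(1)] rep_pq(1)[OF tau 2(2)] by (simp add: mult.left_commute[of "c a"] mult.assoc mult.left_commute)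
      qed
      show "k * kap (w (Pos f)) = \<mu> f * om f (w (Pos f)) * 0"
        unfolding scal[OF lin(2)] rep_pq(1)[OF kap 2(2)] kap_W[OF 2(2)] by simp
      have "l * max 0 (rho (W f)) = max 0 (l * rho (W f))"
        using kl by (simp add: max_mult_distrib_left)
      also have "\<dots> = \<mu> f * max 0 (time_ext 2 f)"
        unfolding det_rho[OF 2(2)] using \<mu>[OF 2(2)] by (simp add: max_mult_distrib_left)
      finally show "l * rho (w (Pos f)) = \<mu> f * om f (w (Pos f)) * max 0 (time_ext 2 f)"
        unfolding scal[OF lin(3)] rep_pq(1)[OF rho 2(2)] by (simp add: mult.left_commute[of l] mult.assoc mult.left_commute)
      show "\<mu> g * om g (w (Pos f)) = \<mu> f * om f (w (Pos f)) * (if g = f then 1 else 0)" if "g < 6" for g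
        using om0[OF that, of "Pos f"] 2(2) by auto
    qed (use al0[of _ "Pos f"] 2(2) in auto)
    ultimately show ?thesis by blast
  next
    case (3 f)
    have wx: "w (Neg f) = om f (w (Neg f)) *\<^sub>R qq f"
      unfolding qq_def using om1[OF 3(2)] by simp
    have scal: "h (w (Neg f)) = om f (w (Neg f)) * h (qq f)" if "linear h" for h :: "rseq \<Rightarrow> real"
      by (subst wx) (simp add: linear_scale[OF that])
    have "lam v > 0" using om1[OF 3(2)] \<mu>[OF 3(2)] by (simp add: lam_def 3)
    moreover have "sc i * F i (w v) = lam v * canon v i" if i: "i < 13 + K" for i
      unfolding sF 3(1) canon.simps lam_def vx.case
    proof (rule eq_seq[OF i])
      show "c a * tau a (w (Neg f)) = \<mu> f * om f (w (Neg f)) * max 0 (- theta f a)" if a: "a < 4" for a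
      proof -
        have "c a * max 0 (- tau a (W f)) = max 0 (- (c a * tau a (W f)))"
          using c[OF a] by (simp add: max_mult_distrib_left)
        also have "\<dots> = \<mu> f * max 0 (- theta f a)"
          unfolding det_tau[OF 3(2) a] using \<mu>[OF 3(2)] by (simp add: max_mult_distrib_left)
        finally show ?thesis
          unfolding scal[OF lin(1)] rep_pq(2)[OF tau 3(2)] by (simp add: mult.left_commute[of "c a"] mult.assoc mult.left_commute)
      qed
      show "k * kap (w (Neg f)) = \<mu> f * om f (w (Neg f)) * 0"
        unfolding scal[OF lin(2)] rep_pq(2)[OF kap 3(2)] kap_W[OF 3(2)] by simp
      have "l * max 0 (- rho (W f)) = max 0 (- (l * rho (W f)))"
        using kl by (simp add: max_mult_distrib_left)
      also have "\<dots> = \<mu> f * max 0 (- time_ext 2 f)"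
        unfolding det_rho[OF 3(2)] using \<mu>[OF 3(2)] by (simp add: max_mult_distrib_left)
      finally show "l * rho (w (Neg f)) = \<mu> f * om f (w (Neg f)) * max 0 (- time_ext 2 f)"
        unfolding scal[OF lin(3)] rep_pq(2)[OF rho 3(2)] by (simp add: mult.left_commute[of l] mult.assoc mult.left_commute)
      show "\<mu> g * om g (w (Neg f)) = \<mu> f * om f (w (Neg f)) * (if g = f then 1 else 0)" if "g < 6" for g
        using om0[OF that, of "Neg f"] 3(2) by auto
    qed (use al0[of _ "Neg f"] 3(2) in auto)
    ultimately show ?thesis by blast
  next
    case (4 j)
    have "lam v > 0" using al1[OF 4(2)] by (simp add: lam_def 4)
    moreover have "sc i * F i (w v) = lam v * canon v i" if i: "i < 13 + K" for i
      unfolding sF 4(1) canon.simps lam_def vx.case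
    proof (rule eq_seq[OF i])
      show "\<mu> g * om g (w (Apex j)) = al j (w (Apex j)) * 0" if "g < 6" for g
        using om0[OF that, of "Apex j"] 4(2) by simp
      show "al i (w (Apex j)) = al j (w (Apex j)) * (if i = j then 1 else 0)" if "i \<le> K" for i
        using al0[OF that, of "Apex j"] 4(2) by auto
    qed (use base_Apex[OF 4(2)] in auto)
    ultimately show ?thesis by blast
  qed
  then show ?thesis
    by (intro exI[of _ "\<lambda>i x. sc i * F i x"] exI[of _ "\<lambda>i. (1 / sc i) *\<^sub>R u i"] exI[of _ lam])
      (use db spanning in blast)
qed

end

section \<open>The polytopes\<close>

lemma coord_pair:
  assumes "v \<in> Idx N K" "f < 6"
  shows "coord v (5 + f) = (if v = Pos f \<or> v = Neg f then 1 else 0)"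
  using assms(1)
proof (cases rule: Idx_cases)
  case (1 s)
  have "s mod 4 < 4" by simp
  then show ?thesis unfolding 1(1) by simp
qed (use assms(2) in auto)

lemma coord_apex:
  assumes "v \<in> Idx N K" "1 \<le> k"
  shows "coord v (10 + k) = (if v = Apex k then 1 else 0)"
  using assms(1)
proof (cases rule: Idx_cases)
  case (1 s)
  have "s mod 4 < 4" by simp
  then show ?thesis unfolding 1(1) by simp
qed (use assms(2) in auto)

lemma theta_0_nonzero: "f < 4 \<Longrightarrow> theta f 0 \<noteq> 0"
proof -
  assume "f < 4"
  then consider "f = 0" | "f = 1" | "f = 2" | "f = 3" by linarith
  then show ?thesis by cases (simp_all add: theta_simps)
qed

text \<open>Pairs and nonzero apexes are recognized by their own coordinates, long vertices by the
  height; a fibre coordinate 1 separates the latter from the origin.\<close>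

lemma coord_inj:
  assumes v: "v \<in> Idx N K" and v': "v' \<in> Idx N K" and eq: "\<And>i. i < 11 + K \<Longrightarrow> coord v i = coord v' i"
  shows "v = v'"
proof -
  have pair: "(v = Pos f \<or> v = Neg f) \<longleftrightarrow> (v' = Pos f \<or> v' = Neg f)" if "f < 6" for f
    using eq[of "5 + f"] coord_pair[OF v that] coord_pair[OF v' that] that by (auto split: if_splits)
  have apex: "v = Apex k \<longleftrightarrow> v' = Apex k" if "1 \<le> k" "k \<le> K" for k
    using eq[of "10 + k"] coord_apex[OF v that(1)] coord_apex[OF v' that(1)] that by (auto split: if_splits)
  have sep: "coord (Pos f) j \<noteq> coord (Neg f) j" if "f < 6" "j = (if f < 4 then 0 else f - 2)" for f j
    using that theta_0_nonzero[of f] by (auto split: if_splits)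
  have pn: "\<not> (v = Pos f \<and> v' = Neg f)" "\<not> (v = Neg f \<and> v' = Pos f)" if "f < 6" for f
    using eq[of "if f < 4 then 0 else f - 2"] sep[OF that refl] that by (auto split: if_splits)
  show ?thesis
    using v
  proof (cases rule: Idx_cases)
    case (1 s)
    from v' show ?thesis
    proof (cases rule: Idx_cases)
      case (1 s')
      have "s mod 4 \<noteq> 4" "s' mod 4 \<noteq> 4" by (simp_all add: order_less_imp_not_eq)
      then show ?thesis using eq[of 4] 1 \<open>v = Long s\<close> by simp
    next
      case (4 k)
      have "s mod 4 < 4" by simp
      then have "s mod 4 \<noteq> 10 + k" by linarith
      then have "coord v' (s mod 4) = 0" unfolding 4(1) by simp
      moreover have "coord v (s mod 4) = 1" unfolding 1(1) by simp
      ultimately show ?thesis using eq[of "s mod 4"] by (simp add: less_trans[of _ 4])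
    qed (use pair 1 in auto)
  next
    case (2 f)
    then show ?thesis using pair[OF 2(2)] pn[OF 2(2)] by auto
  next
    case (3 f)
    then show ?thesis using pair[OF 3(2)] pn[OF 3(2)] by auto
  next
    case (4 k)
    show ?thesis
    proof (cases "k = 0")
      case False
      then show ?thesis using apex[of k] 4 by simp
    next
      case True
      from v' show ?thesis
      proof (cases rule: Idx_cases)
        case (1 s)
        have "s mod 4 < 4" by simp
        moreover have "coord v' (s mod 4) = 1" unfolding 1(1) by simp
        ultimately show ?thesis using eq[of "s mod 4"] 4 True by (simp add: less_trans[of _ 4])
      next
        case (4 k')
        then show ?thesis using apex[of k'] \<open>v = Apex k\<close> True by (cases "k' = 0") auto
      qed (use pair 4 in auto)
    qed
  qed
qed

section \<open>Convex position and inscription\<close>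

text \<open>The tangent functional of the paraboloid at \<open>v\<close>. It vanishes at
  \<open>v\<close> alone, which makes every point of the configuration a vertex.\<close>

lemma lin_val_dist:
  assumes "v \<in> Idx N K" "v' \<in> Idx N K"
  shows "lin_val K 1 (nrm v) (\<lambda>i. - 2 * coord v i) v' = (\<Sum>i<11 + K. (coord v i - coord v' i)\<^sup>2)"
proof -
  have "(\<Sum>i<11 + K. (coord v i - coord v' i)\<^sup>2) = (\<Sum>i<11 + K. (coord v i)\<^sup>2)
      + (\<Sum>i<11 + K. (coord v' i)\<^sup>2) + (\<Sum>i<11 + K. - 2 * coord v i * coord v' i)"
    unfolding sum.distrib[symmetric] by (rule sum.cong) (simp_all add: power2_eq_square algebra_simps)
  then show ?thesis
    unfolding lin_val_def sum_coord_sq[OF assms(1)] sum_coord_sq[OF assms(2)] by simp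
qed

lemma sgn_lin_val: "sgn (lin_val K c \<alpha> \<beta> v / (nrm v + 1)) = sgn (lin_val K c \<alpha> \<beta> v)"
proof -
  have "nrm v + 1 > 0" using nrm_nonneg[of v] by simp
  then show ?thesis by (simp add: sgn_divide)
qed

definition verts :: "nat \<Rightarrow> nat \<Rightarrow> rseq set" where
  "verts K N = pt K ` Idx N K"

lemma finite_verts: "finite (verts K N)"
  by (simp add: verts_def finite_Idx)

lemma verts_sub_Rn: "verts K N \<subseteq> Rn (12 + K)"
  by (auto simp: verts_def pt_in_Rn)

lemma inj_on_pt_and_extreme:
  assumes v: "v \<in> Idx N K"
  shows "\<And>v'. v' \<in> Idx N K \<Longrightarrow> pt K v = pt K v' \<Longrightarrow> v = v'"
    and "pt K v extreme_point_of convex hull verts K N"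
proof -
  obtain g :: "rseq \<Rightarrow> real" and c where g: "linear g"
      "\<And>v'. g (pt K v') + c = lin_val K 1 (nrm v) (\<lambda>i. - 2 * coord v i) v' / (nrm v' + 1)"
    using lin_val_affine[of K 1 "nrm v" "\<lambda>i. - 2 * coord v i"] by blast
  have sg: "sgn (g (pt K v') + c) = sgn (\<Sum>i<11 + K. (coord v i - coord v' i)\<^sup>2)" if "v' \<in> Idx N K" for v'
    unfolding g(2) sgn_lin_val unfolding lin_val_dist[OF v that] ..
  have zero: "g (pt K v') + c = 0 \<longleftrightarrow> v = v'" if v': "v' \<in> Idx N K" for v'
  proof
    assume "g (pt K v') + c = 0"
    then have "(\<Sum>i<11 + K. (coord v i - coord v' i)\<^sup>2) = 0" using sg[OF v'] by (simp add: sgn_0_0)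
    then have "\<forall>i\<in>{..<11 + K}. (coord v i - coord v' i)\<^sup>2 = 0"
      by (subst (asm) sum_nonneg_eq_0_iff) auto
    then show "v = v'" by (intro coord_inj[OF v v']) simp
  next
    assume "v = v'"
    then show "g (pt K v') + c = 0" using sg[OF v'] by (simp add: sgn_0_0)
  qed
  show "v = v'" if "v' \<in> Idx N K" "pt K v = pt K v'" for v'
    using zero[OF that(1)] zero[OF v] that(2) by simp
  have nonneg: "g (pt K v') + c \<ge> 0" if "v' \<in> Idx N K" for v'
  proof -
    have "(\<Sum>i<11 + K. (coord v i - coord v' i)\<^sup>2) \<ge> 0" by (intro sum_nonneg) simp
    then show ?thesis using sg[OF that] by (auto simp: sgn_if split: if_splits)
  qed
  define F where "F = {x \<in> convex hull verts K N. g x + c = 0}"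
  have F: "F face_of convex hull verts K N"
    unfolding F_def using g(1) nonneg by (intro supporting_face) (auto simp: verts_def)
  have "verts K N \<inter> F = {pt K v}"
    using zero v by (auto simp: verts_def F_def hull_inc)
  then have "F = {pt K v}" using face_of_hull_finite[OF finite_verts F] by simp
  then show "pt K v extreme_point_of convex hull verts K N" using F by (simp add: face_of_singleton)
qed

lemma inj_on_pt: "inj_on (pt K) (Idx N K)"
  using inj_on_pt_and_extreme(1) by (auto simp: inj_on_def)

lemma verts_extreme: "x \<in> verts K N \<Longrightarrow> x extreme_point_of convex hull verts K N"
  using inj_on_pt_and_extreme(2) by (auto simp: verts_def)

lemma vertices_hull_verts: "vertices (convex hull verts K N) = verts K N"
  unfolding vertices_def using verts_extreme extreme_point_of_convex_hull by blast

lemma card_verts: "card (verts K N) = N + 13 + K"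
  unfolding verts_def by (simp add: card_image inj_on_pt card_Idx)

lemma inscribed_hull_verts: "inscribed (12 + K) (convex hull verts K N)"
  unfolding inscribed_def vertices_hull_verts
proof (intro bexI[of _ 0] exI[of _ 1] conjI ballI)
  fix x assume "x \<in> verts K N"
  then obtain v where v: "v \<in> Idx N K" "x = pt K v" by (auto simp: verts_def)
  define n where "n = nrm v"
  have n: "n + 1 > 0" using nrm_nonneg[of v] by (simp add: n_def)
  have "(\<Sum>i<12 + K. (Poly_Mapping.lookup x i)\<^sup>2)
      = (\<Sum>i<11 + K. (2 * coord v i / (n + 1))\<^sup>2) + ((n - 1) / (n + 1))\<^sup>2"
  proof -
    have "12 + K = Suc (11 + K)" by simp
    then have "(\<Sum>i<12 + K. (Poly_Mapping.lookup x i)\<^sup>2)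
        = (\<Sum>i<11 + K. (Poly_Mapping.lookup x i)\<^sup>2) + (Poly_Mapping.lookup x (11 + K))\<^sup>2"
      by (simp only: sum.lessThan_Suc)
    then show ?thesis by (simp add: v(2) lookup_pt n_def)
  qed
  also have "(\<Sum>i<11 + K. (2 * coord v i / (n + 1))\<^sup>2) = 4 * n / (n + 1)\<^sup>2"
    using sum_coord_sq[OF v(1)] unfolding n_def
    by (simp add: power_divide power_mult_distrib sum_divide_distrib[symmetric] sum_distrib_left[symmetric])
  also have "4 * n / (n + 1)\<^sup>2 + ((n - 1) / (n + 1))\<^sup>2 = (4 * n + (n - 1)\<^sup>2) / (n + 1)\<^sup>2"
    by (simp add: power_divide add_divide_distrib)
  also have "4 * n + (n - 1)\<^sup>2 = (n + 1)\<^sup>2" by (simp add: power2_eq_square algebra_simps)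
  also have "(n + 1)\<^sup>2 / (n + 1)\<^sup>2 = 1" using n by simp
  finally show "L2_set (\<lambda>i. Poly_Mapping.lookup x i - Poly_Mapping.lookup 0 i) {..<12 + K} = 1"
    by (simp add: L2_set_def)
qed (auto simp: in_Rn_iff)

section \<open>Isomorphic polytopes as realizations\<close>

lemma realization_of_iso:
  assumes N: "N \<ge> 12" and P': "polytope P'" "P' \<subseteq> Rn (12 + K)"
    and iso: "face_lattice_iso f (convex hull verts K N) P'"
  shows "\<exists>\<phi>. (\<forall>v\<in>verts K N. f {v} = {\<phi> v}) \<and> inj_on \<phi> (verts K N) \<and> \<phi> ` verts K N \<subseteq> Rn (12 + K) \<and>
    P' = convex hull (\<phi> ` verts K N) \<and> realization K N (\<lambda>x. homogenize (12 + K) (\<phi> (pt K x)))"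
proof -
  obtain \<phi> where \<phi>: "\<forall>v\<in>verts K N. f {v} = {\<phi> v}" "inj_on \<phi> (verts K N)" "\<phi> ` verts K N \<subseteq> Rn (12 + K)"
      "P' = convex hull (\<phi> ` verts K N)"
    and tr: "\<And>(g::rseq \<Rightarrow> real) c. linear g \<Longrightarrow> \<forall>v\<in>verts K N. g v + c \<ge> 0 \<Longrightarrow>
      \<exists>h::rseq \<Rightarrow> real. linear h \<and> (\<forall>v\<in>verts K N. sgn (h (homogenize (12 + K) (\<phi> v))) = sgn (g v + c))"
    using functional_transfer[OF finite_verts verts_extreme P' iso] by blast
  have "realization K N (\<lambda>x. homogenize (12 + K) (\<phi> (pt K x)))"
  proof
    show "12 \<le> N" by (fact N)
    fix v assume "v \<in> Idx N K"
    then have "\<phi> (pt K v) \<in> Rn (12 + K)" using \<phi>(3) by (auto simp: verts_def)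
    from homogenize_in_Rn[OF this] show "homogenize (12 + K) (\<phi> (pt K v)) \<in> Rn (13 + K)"
      by simp
  next
    fix c \<alpha> \<beta> assume nonneg: "\<And>v. v \<in> Idx N K \<Longrightarrow> lin_val K c \<alpha> \<beta> v \<ge> 0"
    obtain g :: "rseq \<Rightarrow> real" and c' where g: "linear g"
        "\<And>v. g (pt K v) + c' = lin_val K c \<alpha> \<beta> v / (nrm v + 1)"
      using lin_val_affine[of K c \<alpha> \<beta>] by blast
    have "\<forall>v\<in>verts K N. g v + c' \<ge> 0"
      using nonneg nrm_nonneg by (auto simp: verts_def g(2) intro!: divide_nonneg_nonneg)
    then obtain h :: "rseq \<Rightarrow> real" where h: "linear h"
        "\<forall>v\<in>verts K N. sgn (h (homogenize (12 + K) (\<phi> v))) = sgn (g v + c')"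
      using tr[OF g(1)] by blast
    have "sgn (h (homogenize (12 + K) (\<phi> (pt K v)))) = sgn (lin_val K c \<alpha> \<beta> v)" if "v \<in> Idx N K" for v
    proof -
      have "pt K v \<in> verts K N" using that by (simp add: verts_def)
      then have "sgn (h (homogenize (12 + K) (\<phi> (pt K v)))) = sgn (g (pt K v) + c')" using h(2) by blast
      then show ?thesis unfolding g(2) sgn_lin_val .
    qed
    then show "\<exists>h::rseq \<Rightarrow> real. linear h \<and>
        (\<forall>v\<in>Idx N K. sgn (h (homogenize (12 + K) (\<phi> (pt K v)))) = sgn (lin_val K c \<alpha> \<beta> v))"
      using h(1) by blast
  qed
  then show ?thesis using \<phi> by blast
qed

lemma polytope_hull_verts: "polytope (convex hull verts K N)"
  unfolding polytope_def using finite_verts by blast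

lemma hull_verts_sub_Rn: "convex hull verts K N \<subseteq> Rn (12 + K)"
  by (intro hull_minimal verts_sub_Rn) (auto intro: subspace_imp_convex subspace_Rn)

text \<open>The identity isomorphism makes the polytope a realization of itself, so rigidity
  supplies both its dimension and its own normal form.\<close>

lemma realization_self:
  assumes "N \<ge> 12"
  shows "realization K N (\<lambda>x. homogenize (12 + K) (pt K x))"
proof -
  have iso: "face_lattice_iso (\<lambda>F. F) (convex hull verts K N) (convex hull verts K N)"
    by (simp add: face_lattice_iso_def bij_betw_def)
  obtain \<phi> where \<phi>: "\<forall>v\<in>verts K N. {v} = {\<phi> v}"
      "realization K N (\<lambda>x. homogenize (12 + K) (\<phi> (pt K x)))"
    using realization_of_iso[OF assms polytope_hull_verts hull_verts_sub_Rn iso] by blast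
  have "\<phi> (pt K v) = pt K v" if "v \<in> Idx N K" for v using \<phi>(1) that by (simp add: verts_def)
  then show ?thesis using \<phi>(2) by (simp add: realization_def cong: ball_cong)
qed

section \<open>Dimension and projective uniqueness\<close>

lemma has_aff_dim_Rn:
  assumes "affine hull S = Rn d"
  shows "has_aff_dim S d"
proof -
  let ?e = "\<lambda>i. Poly_Mapping.single i (1::real)"
  have inj: "inj_on ?e A" for A by (auto simp: inj_on_def) (metis lookup_single_eq lookup_single_not_eq zero_neq_one)
  have ind: "independent (?e ` {..<d})"
  proof (rule independent_if_scalars_zero)
    fix c x assume sum0: "(\<Sum>x\<in>?e ` {..<d}. c x *\<^sub>R x) = 0" and "x \<in> ?e ` {..<d}"
    then obtain j where j: "j < d" "x = ?e j" by blast
    have "(\<Sum>i<d. c (?e i) *\<^sub>R ?e i) = 0" using sum0 by (simp add: sum.reindex[OF inj])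
    then have "Poly_Mapping.lookup (\<Sum>i<d. c (?e i) *\<^sub>R ?e i) j = 0" by simp
    moreover have "Poly_Mapping.lookup (\<Sum>i<d. c (?e i) *\<^sub>R ?e i) j = (\<Sum>i<d. if i = j then c (?e j) else 0)"
      unfolding lookup_sum by (rule sum.cong) (auto simp: lookup_single)
    ultimately show "c x = 0" using j by simp
  qed simp
  have nz: "0 \<notin> ?e ` {..<d}" by (metis dependent_zero ind)
  have "affine hull (insert 0 (?e ` {..<d})) = span (insert 0 (?e ` {..<d}))"
    by (intro affine_hull_span_0 hull_inc) simp
  then have "affine hull (insert 0 (?e ` {..<d})) = affine hull S"
    using assms Rn_eq_span by (simp add: span_insert_0)
  moreover have "\<not> affine_dependent (insert 0 (?e ` {..<d}))"
    using ind affine_dependent_iff_dependent[OF nz] by simp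
  moreover have "card (insert 0 (?e ` {..<d})) = d + 1"
    using nz by (simp add: card_image[OF inj])
  ultimately show ?thesis unfolding has_aff_dim_def by blast
qed

text \<open>The homogenized vertices span by \<open>rigid\<close>, and in a linear representation of
  a homogenized point the last coordinate forces the coefficients to sum to 1.\<close>

lemma affine_hull_verts:
  assumes "N \<ge> 12"
  shows "affine hull verts K N = Rn (12 + K)"
proof
  have "affine (Rn (12 + K))" by (intro subspace_imp_affine subspace_Rn)
  then show "affine hull verts K N \<subseteq> Rn (12 + K)" by (intro hull_minimal verts_sub_Rn)
  interpret realization K N "\<lambda>x. homogenize (12 + K) (pt K x)" by (rule realization_self[OF assms])
  let ?h = "homogenize (12 + K)"
  have span: "Rn (13 + K) \<subseteq> span (?h ` verts K N)"
    using rigid by (auto simp: verts_def image_image)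
  have inj: "inj_on ?h A" for A using inj_homogenize by (rule inj_on_subset) simp
  show "Rn (12 + K) \<subseteq> affine hull verts K N"
  proof
    fix x assume x: "x \<in> Rn (12 + K)"
    have "?h x \<in> Rn (13 + K)" using homogenize_in_Rn[OF x] by simp
    then obtain c0 where "?h x = (\<Sum>a\<in>?h ` verts K N. c0 a *\<^sub>R a)"
      using span finite_verts by (auto simp: span_finite)
    then have eq: "?h x = (\<Sum>v\<in>verts K N. c0 (?h v) *\<^sub>R ?h v)" by (simp add: sum.reindex[OF inj])
    define c where "c v = c0 (?h v)" for v
    have eq': "?h x = (\<Sum>v\<in>verts K N. c v *\<^sub>R ?h v)" using eq by (simp add: c_def)
    have "Poly_Mapping.lookup (?h v) (12 + K) = 1" if "v \<in> verts K N" for v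
      using that verts_sub_Rn lookup_homogenize by blast
    then have "sum c (verts K N) = 1"
      using arg_cong[OF eq', of "\<lambda>y. Poly_Mapping.lookup y (12 + K)"] lookup_homogenize[OF x]
      by (simp add: lookup_sum)
    moreover have "(\<Sum>v\<in>verts K N. c v *\<^sub>R v) = x"
      using eq' calculation unfolding sum_homogenize by (simp add: homogenize_def)
    ultimately show "x \<in> affine hull verts K N"
      unfolding affine_hull_finite[OF finite_verts] by blast
  qed
qed

lemma d_polytope_hull_verts:
  assumes "N \<ge> 12"
  shows "d_polytope (12 + K) (convex hull verts K N)"
  unfolding d_polytope_def
  by (intro conjI polytope_hull_verts hull_verts_sub_Rn has_aff_dim_Rn)
    (simp add: affine_hull_convex_hull affine_hull_verts[OF assms])

text \<open>Matching the dual bases of the polytope and of the given realization sends each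
  homogenized vertex to a multiple of its partner, because both have the same row of
  \<open>canon\<close>; the multiple is the positive quotient of the two scales.\<close>

lemma projectively_unique_hull_verts:
  assumes N: "N \<ge> 12"
  shows "projectively_unique (12 + K) (convex hull verts K N)"
  unfolding projectively_unique_def
proof (intro conjI allI impI)
  show "d_polytope (12 + K) (convex hull verts K N)" by (rule d_polytope_hull_verts[OF N])
  fix P' f assume "polytope P' \<and> P' \<subseteq> Rn (12 + K) \<and> face_lattice_iso f (convex hull verts K N) P'"
  then have P': "polytope P'" "P' \<subseteq> Rn (12 + K)" "face_lattice_iso f (convex hull verts K N) P'" by auto
  let ?h = "homogenize (12 + K)"
  obtain \<phi> where \<phi>: "\<forall>v\<in>verts K N. f {v} = {\<phi> v}" "inj_on \<phi> (verts K N)" "\<phi> ` verts K N \<subseteq> Rn (12 + K)"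
      "P' = convex hull (\<phi> ` verts K N)" and R1: "realization K N (\<lambda>x. ?h (\<phi> (pt K x)))"
    using realization_of_iso[OF N P'] by blast
  have R0: "realization K N (\<lambda>x. ?h (pt K x))" by (rule realization_self[OF N])
  obtain F0 u0 lam0 where db0: "dual_basis (13 + K) F0 u0"
    and lam0: "\<And>v. v \<in> Idx N K \<Longrightarrow> lam0 v > 0"
      "\<And>v i. v \<in> Idx N K \<Longrightarrow> i < 13 + K \<Longrightarrow> F0 i (?h (pt K v)) = lam0 v * canon v i"
    using realization.rigid[OF R0] by blast
  obtain F1 u1 lam1 where db1: "dual_basis (13 + K) F1 u1"
    and lam1: "\<And>v. v \<in> Idx N K \<Longrightarrow> lam1 v > 0"
      "\<And>v i. v \<in> Idx N K \<Longrightarrow> i < 13 + K \<Longrightarrow> F1 i (?h (\<phi> (pt K v))) = lam1 v * canon v i"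
    using realization.rigid[OF R1] by blast
  define L where "L x = (\<Sum>i<13 + K. F0 i x *\<^sub>R u1 i)" for x
  have aut: "linear_automorphism (12 + K + 1) L"
    using dual_basis_automorphism[OF db0 db1] by (simp add: L_def[abs_def])
  \<comment> \<open>The factor is needed as a function of the point rather than of its label;
    \<open>pt K\<close> is injective on the labels.\<close>
  define t where "t p = (let v = inv_into (Idx N K) (pt K) p in lam0 v / lam1 v)" for p
  have t_pt: "t (pt K v) = lam0 v / lam1 v" if "v \<in> Idx N K" for v
    by (simp add: t_def inv_into_f_f[OF inj_on_pt that])
  have L_pt: "L (?h (pt K v)) = t (pt K v) *\<^sub>R ?h (\<phi> (pt K v))" if v: "v \<in> Idx N K" for v
  proof -
    have "\<phi> (pt K v) \<in> Rn (12 + K)" using \<phi>(3) v by (auto simp: verts_def)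
    then have "?h (\<phi> (pt K v)) \<in> Rn (13 + K)" using homogenize_in_Rn by force
    then have "?h (\<phi> (pt K v)) = (\<Sum>i<13 + K. F1 i (?h (\<phi> (pt K v))) *\<^sub>R u1 i)"
      by (rule dual_basisD(4)[OF db1])
    also have "\<dots> = (\<Sum>i<13 + K. (lam1 v * canon v i) *\<^sub>R u1 i)"
      by (rule sum.cong) (simp_all add: lam1(2)[OF v])
    finally have h1: "?h (\<phi> (pt K v)) = (\<Sum>i<13 + K. (lam1 v * canon v i) *\<^sub>R u1 i)" .
    have "L (?h (pt K v)) = (\<Sum>i<13 + K. (lam0 v * canon v i) *\<^sub>R u1 i)"
      unfolding L_def by (rule sum.cong) (simp_all add: lam0(2)[OF v])
    also have "\<dots> = (lam0 v / lam1 v) *\<^sub>R (\<Sum>i<13 + K. (lam1 v * canon v i) *\<^sub>R u1 i)"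
      unfolding scaleR_sum_right by (rule sum.cong) (use lam1(1)[OF v] in auto)
    finally show ?thesis unfolding h1[symmetric] t_pt[OF v] .
  qed
  have Lin: "linear L" using aut by (simp add: linear_automorphism_def)
  have tpos: "t p > 0" if "p \<in> verts K N" for p
    using that t_pt lam0(1) lam1(1) by (auto simp: verts_def)
  have Lv: "L (?h p) = t p *\<^sub>R ?h (\<phi> p)" if "p \<in> verts K N" for p
    using that L_pt by (auto simp: verts_def)
  note pm = projective_map_hull[where t = t, OF finite_verts verts_sub_Rn \<phi>(2,3) Lin]
  show "\<exists>L. linear_automorphism (12 + K + 1) L \<and> projective_map_defined_on (12 + K) L (convex hull verts K N) \<and>
      projective_map (12 + K) L ` (convex hull verts K N) = P' \<and>
      (\<forall>v\<in>vertices (convex hull verts K N). f {v} = {projective_map (12 + K) L v})"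
    unfolding vertices_hull_verts
  proof (intro exI[of _ L] conjI ballI)
    show "linear_automorphism (12 + K + 1) L" by (fact aut)
    show "projective_map_defined_on (12 + K) L (convex hull verts K N)"
      by (rule pm(1)) (use tpos Lv in auto)
    show "projective_map (12 + K) L ` (convex hull verts K N) = P'"
      unfolding \<phi>(4) by (rule pm(2)) (use tpos Lv in auto)
    show "f {v} = {projective_map (12 + K) L v}" if v: "v \<in> verts K N" for v
    proof -
      have "projective_map (12 + K) L v = \<phi> v" by (rule pm(3)) (use tpos Lv v in auto)
      then show ?thesis using \<phi>(1) v by simp
    qed
  qed
qed

text \<open>An isomorphism preserves the number of vertices, which is N + 13 + K.\<close>

lemma combinatorially_equivalent_card:
  assumes "combinatorially_equivalent (convex hull verts K N) (convex hull verts K N')"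
  shows "N = N'"
proof -
  obtain f where "face_lattice_iso f (convex hull verts K N) (convex hull verts K N')"
    using assms by (auto simp: combinatorially_equivalent_def)
  then obtain \<phi> where "inj_on \<phi> (verts K N)" "\<phi> ` verts K N = {e. e extreme_point_of convex hull verts K N'}"
    using face_iso_vertices[OF finite_verts verts_extreme polytope_hull_verts] by blast
  then have "card (verts K N) = card (verts K N')"
    using card_image vertices_hull_verts by (metis vertices_def)
  then show ?thesis by (simp add: card_verts)
qed

theorem theoremA33:
  shows "\<exists>D::nat. \<forall>d\<ge>D. \<exists>P :: nat \<Rightarrow> rseq set.
    (\<forall>n\<ge>1. d_polytope d (P n) \<and> inscribed d (P n) \<and>
            card (vertices (P n)) = 12 * (n + 1) + d + D - 9 \<and>
            projectively_unique d (P n)) \<and>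
    (\<forall>m\<ge>1. \<forall>n\<ge>1. m \<noteq> n \<longrightarrow> \<not> combinatorially_equivalent (P m) (P n))"
proof (intro exI[of _ 14] allI impI)
  fix d :: nat assume "14 \<le> d"
  then obtain K where d: "d = 12 + K" using le_Suc_ex[of 12 d] by auto
  \<comment> \<open>There are N + 13 + K = N + d + 1 vertices, and for D = 14 the required number is
    12 n + 17 + d, hence N = 12 n + 16.\<close>
  define P where "P n = convex hull verts K (12 * n + 16)" for n
  have "d_polytope d (P n)" "inscribed d (P n)" "projectively_unique d (P n)" for n
    unfolding P_def d
    by (intro d_polytope_hull_verts inscribed_hull_verts projectively_unique_hull_verts; simp)+
  moreover have "card (vertices (P n)) = 12 * (n + 1) + d + 14 - 9" for n
    by (simp add: P_def d vertices_hull_verts card_verts)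
  moreover have "\<not> combinatorially_equivalent (P m) (P n)" if "m \<noteq> n" for m n
    using that combinatorially_equivalent_card[of K "12 * m + 16" "12 * n + 16"] by (auto simp: P_def)
  ultimately show "\<exists>P :: nat \<Rightarrow> rseq set.
    (\<forall>n\<ge>1. d_polytope d (P n) \<and> inscribed d (P n) \<and>
            card (vertices (P n)) = 12 * (n + 1) + d + 14 - 9 \<and>
            projectively_unique d (P n)) \<and>
    (\<forall>m\<ge>1. \<forall>n\<ge>1. m \<noteq> n \<longrightarrow> \<not> combinatorially_equivalent (P m) (P n))"
    by (intro exI[of _ P]) blast
qed

end
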